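(* There exists $\delta>0$ such that for every $\mu>0$ the following holds. Let $b_0\in C^3([-\pi,\pi])$ satisfy $\int_{-\pi}^{\pi}b_0(x)\,dx=0$ and $$\|b_0-\mu\cos(\cdot)\|_{C^3([-\pi,\pi])}\le \delta\mu .$$ Then the unique $C^3$ solution $b$ of the nonlocal equation $$\partial_\tau b+\Big(\int_{-\pi}^x b(\tau,\bar x)\,d\bar x\Big)\partial_x b-b^2+\frac1\pi\int_{-\pi}^{\pi}b^2\,dx=\frac1\pi\Big(\int_0^\tau\int_{-\pi}^{\pi}b^2(\bar\tau,x)\,dx\,d\bar\tau\Big)\,b,\qquad x\in[-\pi,\pi],$$ with $\int_{-\pi}^\pi b(\tau,x)\,dx=0$ and $b(0,\cdot)=b_0$, blows up in finite time $\tau^*$ for some $\tau^*>0$. Moreover it can be decomposed as $$b(\tau,x)=\frac{1}{\tau^*-\tau}\cos(x)+\tilde b(\tau,x),$$ where $\|\tilde b(\tau)\|_{C^1([-\pi,\pi])}\lesssim(\tau^*-\tau)^{-3/4}$ for $\tau\in[0,\tau^* )$ (i.e. bounded by a constant times $(\tau^*-\tau)^{-3/4}$).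
   Context: This equation describes the infinite-energy solutions of the 2D incompressible porous medium equation with stream function $y f(\tau,x)$, $f(\tau,x)=\int_{-\pi}^x b(\tau,\bar x)d\bar x$. Solutions are required to satisfy the mean-free condition $\int_{-\pi}^\pi b(\tau,x)dx=0$ for all $\tau$. *)

theory Defs
  imports "HOL-Analysis.Analysis"
begin

abbreviation Ipi :: "real set" where "Ipi \<equiv> {-pi..pi}"

fun Dx :: "nat \<Rightarrow> (real \<Rightarrow> real) \<Rightarrow> real \<Rightarrow> real" where
  "Dx 0 f = f"
| "Dx (Suc k) f = (\<lambda>x. vector_derivative (Dx k f) (at x within Ipi))"

definition Ck_on :: "nat \<Rightarrow> (real \<Rightarrow> real) \<Rightarrow> bool" where
  "Ck_on k f \<longleftrightarrow>
     (\<forall>j<k. \<forall>x\<in>Ipi. (Dx j f has_vector_derivative Dx (Suc j) f x) (at x within Ipi))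
     \<and> continuous_on Ipi (Dx k f)"

definition Ck_norm :: "nat \<Rightarrow> (real \<Rightarrow> real) \<Rightarrow> real" where
  "Ck_norm k f = (\<Sum>j\<le>k. Sup ((\<lambda>x. \<bar>Dx j f x\<bar>) ` Ipi))"

definition Dt :: "real \<Rightarrow> (real \<Rightarrow> real \<Rightarrow> real) \<Rightarrow> real \<Rightarrow> real \<Rightarrow> real" where
  "Dt T b tau x = vector_derivative (\<lambda>s. b s x) (at tau within {0..<T})"

definition is_sol :: "real \<Rightarrow> (real \<Rightarrow> real) \<Rightarrow> (real \<Rightarrow> real \<Rightarrow> real) \<Rightarrow> bool" where
  "is_sol T b0 b \<longleftrightarrow> T > 0
    \<and> (\<forall>tau\<in>{0..<T}. Ck_on 3 (b tau))
    \<and> (\<forall>j\<le>3. continuous_on ({0..<T} \<times> Ipi) (\<lambda>p. Dx j (b (fst p)) (snd p)))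
    \<and> (\<forall>tau\<in>{0..<T}. \<forall>x\<in>Ipi.
          ((\<lambda>s. b s x) has_vector_derivative Dt T b tau x) (at tau within {0..<T}))
    \<and> continuous_on ({0..<T} \<times> Ipi) (\<lambda>p. Dt T b (fst p) (snd p))
    \<and> (\<forall>x\<in>Ipi. b 0 x = b0 x)
    \<and> (\<forall>tau\<in>{0..<T}. integral Ipi (b tau) = 0)
    \<and> (\<forall>tau\<in>{0..<T}. \<forall>x\<in>Ipi.
          Dt T b tau x + integral {-pi..x} (b tau) * Dx 1 (b tau) x - (b tau x)\<^sup>2
            + (1/pi) * integral Ipi (\<lambda>y. (b tau y)\<^sup>2)
          = (1/pi) * integral {0..tau} (\<lambda>s. integral Ipi (\<lambda>y. (b s y)\<^sup>2)) * b tau x)"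

end

(*
Along characteristics the reciprocal w of the Jacobian of the flow satisfies w'' = (B w)', where
B(t) = (1/pi) int_0^t int b^2, so w' = B w - b0. In the variable s = int_0^t exp(- int B) this integrates
to w = P (1 - s b0), and incompressibility (the Jacobian 1/w has mean one) determines
P(s) = (1/2 pi) int 1 / (1 - s b0). Hence dt = P ds, and on the characteristic issuing from a the
solution equals b0(a) / (P (1 - s b0(a))) - P'/P^2. It blows up as s tends to 1/M with M = max b0.

Put 1/s - M = q^4 and M - b0(x) ~ r^2 (x - alpha)^2 near the nondegenerate maximum alpha. If M - b0 were
exactly quadratic, the flow map would be a |-> 2 arctan (r (a - alpha) / q^2) up to boundary terms and the
solution a multiple of cos. The cubic error costs a relative error O(q), because
|y| <= (q + y^2/q)/2 gives int |y| / (q^4 + y^2) dy = O(1/q), whereas tstar - t ~ q^2 / (M r). So the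
remainder is O(1/q) = O((tstar - t)^(-1/2)), better than needed.

Uniqueness: Gronwall for int d^2 + beta^2, d and beta being the differences of two solutions and of
their functions B.
*)
theory Submission
  imports Defs "HOL-Real_Asymp.Real_Asymp"
begin

section \<open>Calculus on intervals\<close>

text \<open>Why the characteristics close: the reciprocal Jacobian satisfies w' = - b w, and along a
  characteristic b' = b^2 - B' + B b, where ' is d/dt. So w'' = - b' w + b^2 w = B' w - B b w = (B
  w)'. With P = exp(int B) as integrating factor, b = - w'/w gives the explicit formula, and dP/dt =
  B P gives B = (dP/ds)/P^2. Existence is then a verification, but the inverse flow map has to be
  differentiated up to the ends of the interval and at time 0, hence the one-sided calculus at the
  start. Near blowup the formula is affine in 1/(q^4 + M - b0), hence in (q^4 - N)/(q^4 + N) with N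
  = M - b0; for quadratic N this is (1 - v^2)/(1 + v^2) = cos (2 arctan v). The additive constant
  contains B, whose singular integral is never expanded: the zero mean of b bounds it. The fourth
  power: the layer around the maximum has width q^2, and AM-GM balances |y| at the intermediate
  scale q, so every order is an integer power of q.\<close>

text \<open>The endpoints may come in either order and may lie on the boundary of \<open>C\<close>.
  That \<open>z\<close> is no farther from \<open>x\<close> than \<open>y\<close> is forces
  intermediate points to converge, and keeps the order of Taylor remainders.\<close>

lemma real_mvt_segment:
  fixes f f' :: "real \<Rightarrow> real"
  assumes C: "convex C" and x: "x \<in> C" and y: "y \<in> C"
    and d: "\<And>z. z \<in> C \<Longrightarrow> (f has_real_derivative f' z) (at z within C)"
  obtains z where "z \<in> C" "\<bar>z - x\<bar> \<le> \<bar>y - x\<bar>" "f y - f x = f' z * (y - x)"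
proof -
  have *: "\<exists>z\<in>{a..b}. f b - f a = f' z * (b - a)" if "a \<le> b" "a \<in> C" "b \<in> C" for a b
  proof -
    have sub: "{a..b} \<subseteq> C"
      using that C closed_segment_eq_real_ivl1 closed_segment_subset by metis
    have "(f has_derivative (*) (f' z)) (at z within {a..b})" if "a \<le> z" "z \<le> b" for z
      using d[of z] sub that has_derivative_subset[of f "(*) (f' z)" z C "{a..b}"]
      by (auto simp: has_field_derivative_def)
    then show ?thesis
      by (rule mvt_very_simple[OF that(1)])
  qed
  have sub: "{min x y..max x y} \<subseteq> C"
    using x y C closed_segment_eq_real_ivl[of x y] closed_segment_subset[of x C y]
    by (auto simp: min_def max_def split: if_splits)
  show ?thesis
  proof (cases "x \<le> y")
    case True
    then obtain z where "z \<in> {x..y}" "f y - f x = f' z * (y - x)" using *[of x y] x y by auto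
    then show ?thesis using that[of z] sub True by auto
  next
    case False
    then obtain z where "z \<in> {y..x}" "f x - f y = f' z * (x - y)" using *[of y x] x y by auto
    then show ?thesis using that[of z] sub False by (auto simp: algebra_simps)
  qed
qed

text \<open>Implicit differentiation with one-sided derivatives in both variables. The difference
  quotient of \<open>y\<close> equals minus that of \<open>H\<close> in its first argument, divided
  by \<open>H'\<close> at an intermediate point, which converges because \<open>y\<close> is
  continuous at \<open>r0\<close>. It serves the inverse flow map in space, in \<open>s\<close>, and
  the inverse time change.\<close>

lemma implicit_real_derivative:
  fixes H H' :: "real \<Rightarrow> real \<Rightarrow> real" and y :: "real \<Rightarrow> real"
  assumes C: "convex C" and r0: "r0 \<in> R"
    and y: "\<And>r. r \<in> R \<Longrightarrow> y r \<in> C" and H0: "\<And>r. r \<in> R \<Longrightarrow> H r (y r) = 0"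
    and dH: "\<And>r a. r \<in> R \<Longrightarrow> a \<in> C \<Longrightarrow> (H r has_real_derivative H' r a) (at a within C)"
    and cont: "continuous_on (R \<times> C) (\<lambda>p. H' (fst p) (snd p))"
    and pos: "\<And>r a. r \<in> R \<Longrightarrow> a \<in> C \<Longrightarrow> H' r a > 0"
    and dr: "((\<lambda>r. H r (y r0)) has_real_derivative d) (at r0 within R)"
    and ycont: "(y \<longlongrightarrow> y r0) (at r0 within R)"
  shows "(y has_real_derivative - d / H' r0 (y r0)) (at r0 within R)"
proof -
  have "\<exists>z. r \<in> R \<longrightarrow> z \<in> C \<and> \<bar>z - y r0\<bar> \<le> \<bar>y r - y r0\<bar> \<and>
       H r (y r) - H r (y r0) = H' r z * (y r - y r0)" for r
    using real_mvt_segment[OF C y[OF r0] y[of r] dH[of r]] by metis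
  then obtain z where z: "\<And>r. r \<in> R \<Longrightarrow> z r \<in> C \<and> \<bar>z r - y r0\<bar> \<le> \<bar>y r - y r0\<bar> \<and>
       H r (y r) - H r (y r0) = H' r (z r) * (y r - y r0)" by metis
  have evR: "eventually (\<lambda>r. r \<in> R \<and> r \<noteq> r0) (at r0 within R)"
    by (auto simp: eventually_at_filter)
  have "((\<lambda>r. z r - y r0) \<longlongrightarrow> 0) (at r0 within R)"
  proof (rule Lim_null_comparison)
    show "eventually (\<lambda>r. norm (z r - y r0) \<le> \<bar>y r - y r0\<bar>) (at r0 within R)"
      using evR by eventually_elim (use z in auto)
    show "((\<lambda>r. \<bar>y r - y r0\<bar>) \<longlongrightarrow> 0) (at r0 within R)"
      using ycont by (auto intro: tendsto_eq_intros simp: LIM_zero_iff tendsto_rabs_zero_iff)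
  qed
  then have zl: "(z \<longlongrightarrow> y r0) (at r0 within R)" by (simp add: LIM_zero_iff)
  have pair: "((\<lambda>r. (r, z r)) \<longlongrightarrow> (r0, y r0)) (at r0 within R)"
    by (intro tendsto_intros zl)
  have "((\<lambda>p. H' (fst p) (snd p)) \<longlongrightarrow> H' r0 (y r0)) (at (r0, y r0) within R \<times> C)"
    using cont r0 y[OF r0] by (auto simp: continuous_on_def)
  then have Hl: "((\<lambda>r. H' r (z r)) \<longlongrightarrow> H' r0 (y r0)) (at r0 within R)"
  proof -
    \<comment> \<open>Prescribing the value \<open>y r0\<close> at \<open>r0\<close> turns the limit
      of \<open>z\<close> into continuity there, which composes with the continuity of
      \<open>H'\<close> on \<open>R \<times> C\<close>.\<close>
    have "continuous (at r0 within R) (\<lambda>r. (r, if r = r0 then y r0 else z r))"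
      unfolding continuous_within
      by (rule Lim_transform_eventually[OF pair[THEN tendsto_eq_rhs]])
        (auto simp: eventually_at_filter)
    moreover have "(\<lambda>r. (r, if r = r0 then y r0 else z r)) ` R \<subseteq> R \<times> C"
      using z y r0 by auto
    ultimately have "continuous (at r0 within R) ((\<lambda>p. H' (fst p) (snd p)) \<circ> (\<lambda>r. (r, if r = r0 then y r0 else z r)))"
      using cont r0 y[OF r0]
      by (intro continuous_within_compose) 
         (auto intro: continuous_within_subset simp: continuous_on_eq_continuous_within)
    then have "((\<lambda>r. H' r (if r = r0 then y r0 else z r)) \<longlongrightarrow> H' r0 (y r0)) (at r0 within R)"
      by (simp add: continuous_within o_def)
    then show ?thesis
      by (rule Lim_transform_eventually) (auto simp: eventually_at_filter)
  qed
  have "((\<lambda>r. (H r (y r0) - H r0 (y r0)) / (r - r0)) \<longlongrightarrow> d) (at r0 within R)"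
    using dr by (simp add: has_field_derivative_iff)
  then have "((\<lambda>r. - ((H r (y r0) - H r0 (y r0)) / (r - r0)) / H' r (z r)) \<longlongrightarrow> - d / H' r0 (y r0)) (at r0 within R)"
    using Hl pos[OF r0 y[OF r0]] by (intro tendsto_intros) auto
  then have "((\<lambda>r. (y r - y r0) / (r - r0)) \<longlongrightarrow> - d / H' r0 (y r0)) (at r0 within R)"
  proof (rule Lim_transform_eventually)
    show "\<forall>\<^sub>F r in at r0 within R. - ((H r (y r0) - H r0 (y r0)) / (r - r0)) / H' r (z r) = (y r - y r0) / (r - r0)"
      using evR
    proof eventually_elim
      case (elim r)
      have "- H r (y r0) = H' r (z r) * (y r - y r0)" using z[of r] H0[of r] elim by auto
      moreover have "H' r (z r) > 0" using pos z elim by auto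
      ultimately show ?case using H0[OF r0] elim by (simp add: field_simps)
    qed
  qed
  then show ?thesis by (simp add: has_field_derivative_iff)
qed

text \<open>The function exp(- C t) G has nonpositive derivative, so it cannot rise above its
  initial value 0.\<close>

lemma gronwall_zero:
  fixes G G' :: "real \<Rightarrow> real"
  assumes d: "\<And>t. t \<in> {0..b} \<Longrightarrow> (G has_real_derivative G' t) (at t within {0..b})"
    and le: "\<And>t. t \<in> {0..b} \<Longrightarrow> G' t \<le> C * G t"
    and "G 0 = 0" and nonneg: "\<And>t. t \<in> {0..b} \<Longrightarrow> G t \<ge> 0" and t: "t \<in> {0..b}"
  shows "G t = 0"
proof -
  have "((\<lambda>t. exp (- C * t) * G t) has_real_derivative exp (- C * t) * (G' t - C * G t)) (at t within {0..b})"
    if "t \<in> {0..b}" for t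
  proof -
    have "((\<lambda>t. exp (- C * t)) has_real_derivative exp (- C * t) * (- C)) (at t within {0..b})"
      by (auto intro!: derivative_eq_intros)
    from DERIV_mult[OF this d[OF that]] show ?thesis by (simp add: algebra_simps)
  qed
  note der = this
  obtain z where z: "z \<in> {0..b}"
     "exp (- C * t) * G t - exp (- C * 0) * G 0 = (exp (- C * z) * (G' z - C * G z)) * (t - 0)"
  proof -
    have "convex {0..b}" "0 \<in> {0..b}" using t by auto
    from real_mvt_segment[OF this t der] that show thesis by blast
  qed
  have "(exp (- C * z) * (G' z - C * G z)) * (t - 0) \<le> 0"
    using le[OF z(1)] t by (intro mult_nonpos_nonneg mult_nonneg_nonpos) auto
  with z(2) assms(3) have "exp (- C * t) * G t \<le> 0" by simp
  then have "G t \<le> 0" by (simp add: mult_le_0_iff)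
  with nonneg[OF t] show ?thesis by simp
qed

text \<open>Lets compact initial pieces stand in for half-open time intervals, since the two sets
  coincide near \<open>t\<close>.\<close>

lemma at_within_Icc_Ico:
  fixes a b c t :: real
  assumes "t < b" "b \<le> c"
  shows "at t within {a..b} = at t within {a..<c}"
  by (rule at_within_nhd[of t "{..<b}"]) (use assms in auto)

lemma integral_Ico_derivative:
  fixes g :: "real \<Rightarrow> real"
  assumes g: "continuous_on {a..<c} g" and t: "t \<in> {a..<c}"
  shows "((\<lambda>x. integral {a..x} g) has_real_derivative g t) (at t within {a..<c})"
proof -
  obtain b where b: "t < b" "b < c" using t dense by auto
  have "((\<lambda>x. integral {a..x} g) has_real_derivative g t) (at t within {a..b})"
    by (rule integral_has_real_derivative) (use b t in \<open>auto intro: continuous_on_subset[OF g]\<close>)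
  then show ?thesis using at_within_Icc_Ico[of t b c a] b by simp
qed

section \<open>Iterated one-sided derivatives and the C^k norm\<close>

text \<open>\<open>Dx\<close> and \<open>Dt\<close> are choice terms; the derivative they pick is
  unique only where the filter is nontrivial.\<close>

lemma Ipi_not_bot: "x \<in> Ipi \<Longrightarrow> at x within Ipi \<noteq> bot"
  by (auto simp: trivial_limit_within islimpt_Icc)

lemma Ico_not_bot: "t \<in> {0..<c} \<Longrightarrow> at t within {0..<c} \<noteq> bot" for c :: real
  by (auto simp: trivial_limit_within islimpt_Ico)

text \<open>An explicit list of successive derivatives pins down \<open>Dx\<close>. Agreement of
  \<open>f\<close> with \<open>D 0\<close> on \<open>Ipi\<close> alone suffices because every
  derivative is taken within \<open>Ipi\<close>.\<close>

lemma Dx_eq: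
  assumes D0: "\<And>x. x \<in> Ipi \<Longrightarrow> f x = D 0 x"
    and D: "\<And>j x. j < k \<Longrightarrow> x \<in> Ipi \<Longrightarrow> (D j has_real_derivative D (Suc j) x) (at x within Ipi)"
  shows "j \<le> k \<Longrightarrow> x \<in> Ipi \<Longrightarrow> Dx j f x = D j x"
proof (induction j arbitrary: x)
  case 0
  then show ?case using D0 by simp
next
  case (Suc j)
  have "(D j has_vector_derivative D (Suc j) x) (at x within Ipi)"
    using D[of j x] Suc by (simp add: has_real_derivative_iff_has_vector_derivative)
  then have "(Dx j f has_vector_derivative D (Suc j) x) (at x within Ipi)"
    by (rule has_vector_derivative_transform[rotated 2]) (use Suc in auto)
  then show ?case
    using vector_derivative_within[OF Ipi_not_bot] Suc.prems by auto
qed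

lemma Ck_onI:
  assumes D0: "\<And>x. x \<in> Ipi \<Longrightarrow> f x = D 0 x"
    and D: "\<And>j x. j < k \<Longrightarrow> x \<in> Ipi \<Longrightarrow> (D j has_real_derivative D (Suc j) x) (at x within Ipi)"
    and c: "continuous_on Ipi (D k)"
  shows "Ck_on k f"
  unfolding Ck_on_def
proof (intro conjI allI impI ballI)
  fix j x assume jx: "j < k" "x \<in> Ipi"
  have "(D j has_vector_derivative D (Suc j) x) (at x within Ipi)"
    using D[of j x] jx by (simp add: has_real_derivative_iff_has_vector_derivative)
  then have "(Dx j f has_vector_derivative D (Suc j) x) (at x within Ipi)"
    by (rule has_vector_derivative_transform[rotated 2]) (use jx Dx_eq[of f D k, OF D0 D] in auto)
  then show "(Dx j f has_vector_derivative Dx (Suc j) f x) (at x within Ipi)"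
    using Dx_eq[of f D k "Suc j", OF D0 D] jx by simp
next
  show "continuous_on Ipi (Dx k f)"
    using c by (rule continuous_on_eq) (use Dx_eq[of f D k, OF D0 D] in auto)
qed

lemma Ck_onD:
  assumes "Ck_on k f" "j < k" "x \<in> Ipi"
  shows "(Dx j f has_real_derivative Dx (Suc j) f x) (at x within Ipi)"
  using assms by (simp add: Ck_on_def has_real_derivative_iff_has_vector_derivative)

lemma Ck_on_continuous:
  assumes "Ck_on k f" "j \<le> k"
  shows "continuous_on Ipi (Dx j f)"
proof (cases "j = k")
  case False
  then have "\<And>x. x \<in> Ipi \<Longrightarrow> continuous (at x within Ipi) (Dx j f)"
    using Ck_onD[OF assms(1)] assms(2) by (meson DERIV_continuous order_le_neq_trans)
  then show ?thesis by (simp add: continuous_on_eq_continuous_within)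
qed (use assms in \<open>auto simp: Ck_on_def\<close>)

lemma bdd_Dx:
  assumes "continuous_on Ipi (Dx j f)"
  shows "bdd_above ((\<lambda>x. \<bar>Dx j f x\<bar>) ` Ipi)"
  by (intro bounded_imp_bdd_above compact_imp_bounded compact_continuous_image
       continuous_intros assms) auto

text \<open>Continuity makes the suprema in \<open>Ck_norm\<close> genuine: \<open>Sup\<close> of an
  unbounded set of reals carries no information.\<close>

lemma abs_Dx_le_Ck_norm:
  assumes "\<And>j. j \<le> k \<Longrightarrow> continuous_on Ipi (Dx j f)" "j \<le> k" "x \<in> Ipi"
  shows "\<bar>Dx j f x\<bar> \<le> Ck_norm k f"
proof -
  have nn: "0 \<le> Sup ((\<lambda>x. \<bar>Dx i f x\<bar>) ` Ipi)" if "i \<le> k" for i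
    using bdd_Dx[OF assms(1)[OF that]] assms(3) by (intro cSUP_upper2[of _ _ x]) auto
  have "\<bar>Dx j f x\<bar> \<le> Sup ((\<lambda>x. \<bar>Dx j f x\<bar>) ` Ipi)"
    using bdd_Dx[OF assms(1)[OF assms(2)]] assms(3) by (intro cSUP_upper) auto
  also have "\<dots> \<le> Ck_norm k f"
    unfolding Ck_norm_def by (rule member_le_sum) (use assms(2) nn in auto)
  finally show ?thesis .
qed

lemma Ck_norm_1_le:
  assumes "\<And>x. x \<in> Ipi \<Longrightarrow> \<bar>f x\<bar> \<le> A" "\<And>x. x \<in> Ipi \<Longrightarrow> \<bar>Dx 1 f x\<bar> \<le> B"
  shows "Ck_norm 1 f \<le> A + B"
proof -
  have "Sup ((\<lambda>x. \<bar>f x\<bar>) ` Ipi) \<le> A" "Sup ((\<lambda>x. \<bar>Dx 1 f x\<bar>) ` Ipi) \<le> B"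
    using assms by (intro cSUP_least; force)+
  then show ?thesis by (simp add: Ck_norm_def)
qed

section \<open>Parameter integrals, chain rule and joint continuity\<close>

lemma leibniz_real:
  fixes h h' :: "real \<Rightarrow> real \<Rightarrow> real"
  assumes "\<And>s x. s \<in> S \<Longrightarrow> x \<in> {a..b} \<Longrightarrow> ((\<lambda>s. h s x) has_real_derivative h' s x) (at s within S)"
    and "\<And>s. s \<in> S \<Longrightarrow> continuous_on {a..b} (h s)"
    and "continuous_on (S \<times> {a..b}) (\<lambda>p. h' (fst p) (snd p))"
    and "convex S" "s \<in> S"
  shows "((\<lambda>s. integral {a..b} (h s)) has_real_derivative integral {a..b} (h' s)) (at s within S)"
  using leibniz_rule_field_derivative[of S a b h h' s] assms
  by (auto simp: case_prod_beta intro: integrable_continuous_real)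

lemma real_FTC:
  fixes f f' :: "real \<Rightarrow> real"
  assumes "a \<le> b" and sub: "{a..b} \<subseteq> A"
    and d: "\<And>x. x \<in> {a..b} \<Longrightarrow> (f has_real_derivative f' x) (at x within A)"
  shows "(f' has_integral (f b - f a)) {a..b}"
  using assms(1)
proof (rule fundamental_theorem_of_calculus)
  show "(f has_vector_derivative f' x) (at x within {a..b})" if "x \<in> {a..b}" for x
    using DERIV_subset[OF d[OF that] sub] by (simp add: has_real_derivative_iff_has_vector_derivative)
qed

lemma real_chain_within:
  fixes f g :: "real \<Rightarrow> real"
  assumes "(f has_real_derivative a) (at (g x) within B)"
    and "(g has_real_derivative b) (at x within A)" and "g ` A \<subseteq> B"
  shows "((\<lambda>x. f (g x)) has_real_derivative a * b) (at x within A)"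
  using DERIV_image_chain[OF DERIV_subset[OF assms(1,3)] assms(2)] by (simp add: o_def)

lemma continuous_compact_abs_bound:
  fixes g :: "'a::topological_space \<Rightarrow> real"
  assumes "compact K" "continuous_on K g"
  obtains B where "B > 0" "\<And>x. x \<in> K \<Longrightarrow> \<bar>g x\<bar> \<le> B"
proof -
  have "bounded (g ` K)" using assms by (intro compact_imp_bounded compact_continuous_image)
  then show ?thesis using that by (auto simp: bounded_pos)
qed

text \<open>On a compact product \<open>h\<close> is bounded, so \<open>g\<close> is Lipschitz in
  \<open>a\<close> uniformly in \<open>s\<close>. Moving first in \<open>a\<close>, then in
  \<open>s\<close> with \<open>a\<close> frozen, gives the majorant \<open>F\<close>, which tends to
  0.\<close>

lemma joint_continuity_compact:
  fixes g h :: "real \<Rightarrow> real \<Rightarrow> real"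
  assumes T: "compact T" and C: "compact C" "convex C"
    and d: "\<And>s a. s \<in> T \<Longrightarrow> a \<in> C \<Longrightarrow> (g s has_real_derivative h s a) (at a within C)"
    and h: "continuous_on (T \<times> C) (\<lambda>p. h (fst p) (snd p))"
    and g: "\<And>a. a \<in> C \<Longrightarrow> continuous_on T (\<lambda>s. g s a)"
  shows "continuous_on (T \<times> C) (\<lambda>p. g (fst p) (snd p))"
  unfolding continuous_on_def
proof
  fix p0 assume p0: "p0 \<in> T \<times> C"
  obtain K where K: "\<And>p. p \<in> T \<times> C \<Longrightarrow> \<bar>h (fst p) (snd p)\<bar> \<le> K"
    using continuous_compact_abs_bound[OF compact_Times[OF T C(1)] h] by blast
  define F where "F p = K * \<bar>snd p - snd p0\<bar> + \<bar>g (fst p) (snd p0) - g (fst p0) (snd p0)\<bar>" for p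
  have "continuous_on (T \<times> C) (\<lambda>p. g (fst p) (snd p0))"
    by (rule continuous_on_compose2[OF g[of "snd p0"]]) (use p0 in \<open>auto intro: continuous_intros\<close>)
  then have "continuous_on (T \<times> C) F"
    unfolding F_def by (intro continuous_intros)
  then have "(F \<longlongrightarrow> F p0) (at p0 within T \<times> C)" using p0 by (auto simp: continuous_on_def)
  then have F: "(F \<longlongrightarrow> 0) (at p0 within T \<times> C)" by (simp add: F_def)
  have le: "\<bar>g (fst p) (snd p) - g (fst p0) (snd p0)\<bar> \<le> F p" if p: "p \<in> T \<times> C" for p
  proof -
    obtain z where z: "z \<in> C" "g (fst p) (snd p) - g (fst p) (snd p0) = h (fst p) z * (snd p - snd p0)"
    proof -
      have mem: "fst p \<in> T" "snd p0 \<in> C" "snd p \<in> C" using p p0 by (auto simp: mem_Times_iff)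
      from real_mvt_segment[OF C(2) mem(2,3) d[OF mem(1)]] that show thesis by blast
    qed
    have "\<bar>h (fst p) z\<bar> \<le> K" using K[of "(fst p, z)"] z p by (auto simp: mem_Times_iff)
    then have "\<bar>g (fst p) (snd p) - g (fst p) (snd p0)\<bar> \<le> K * \<bar>snd p - snd p0\<bar>"
      unfolding z(2) abs_mult by (intro mult_right_mono) auto
    then show ?thesis unfolding F_def by linarith
  qed
  have "\<forall>\<^sub>F p in at p0 within T \<times> C. norm (g (fst p) (snd p) - g (fst p0) (snd p0)) \<le> F p"
    unfolding eventually_at_filter using le by (intro always_eventually) auto
  from Lim_null_comparison[OF this F] 
  show "((\<lambda>p. g (fst p) (snd p)) \<longlongrightarrow> g (fst p0) (snd p0)) (at p0 within T \<times> C)"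
    by (simp add: LIM_zero_iff)
qed

lemma continuous_on_Ico_Times:
  fixes f :: "real \<times> real \<Rightarrow> real"
  assumes "\<And>b. b < c \<Longrightarrow> continuous_on ({0..b} \<times> C) f"
  shows "continuous_on ({0..<c} \<times> C) f"
  unfolding continuous_on_def
proof
  fix p assume p: "p \<in> {0..<c} \<times> C"
  then obtain b where b: "fst p < b" "b < c" using dense[of "fst p" c] by auto
  have "at p within {0..b} \<times> C = at p within {0..<c} \<times> C"
    by (rule at_within_nhd[of p "{..<b} \<times> UNIV"]) (use b p in \<open>auto intro: open_Times simp: mem_Times_iff\<close>)
  moreover have "(f \<longlongrightarrow> f p) (at p within {0..b} \<times> C)"
    using assms[OF b(2)] p b unfolding continuous_on_def by (cases p) auto
  ultimately show "(f \<longlongrightarrow> f p) (at p within {0..<c} \<times> C)" by simp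
qed

section \<open>The explicit solution\<close>

text \<open>The derivatives are passed as functions so that explicit formulas can be written with
  them. Here \<open>M\<close> is any positive upper bound; in \<open>ipm_peak\<close> the expansion
  at \<alpha> forces it to be attained.\<close>

locale ipm_data =
  fixes u u1 u2 u3 :: "real \<Rightarrow> real" and M :: real
  assumes du: "\<And>x. x \<in> Ipi \<Longrightarrow> (u has_real_derivative u1 x) (at x within Ipi)"
    and du1: "\<And>x. x \<in> Ipi \<Longrightarrow> (u1 has_real_derivative u2 x) (at x within Ipi)"
    and du2: "\<And>x. x \<in> Ipi \<Longrightarrow> (u2 has_real_derivative u3 x) (at x within Ipi)"
    and cu3: "continuous_on Ipi u3"
    and mean: "integral Ipi u = 0"
    and M: "M > 0" and u_le: "\<And>x. x \<in> Ipi \<Longrightarrow> u x \<le> M"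
begin

text \<open>
  \<open>s\<close> ranges over \<open>S\<close>, \<open>X s\<close> is the flow map at the time \<open>t\<close> with \<open>s = \<integral>\<^sub>0\<^sup>t 1/P\<close>, and \<open>1 / (P s * D s a)\<close> is its
  Jacobian. \<open>Y s\<close> is the inverse of \<open>X s\<close>, meaningful on \<open>Ipi\<close> only, and \<open>Xs\<close> is the \<open>s\<close>-derivative of \<open>X\<close>.
\<close>

definition "S = {0..<1/M}"
definition "D s x = 1 - s * u x"
definition "G s x = integral {-pi..x} (\<lambda>a. 1 / D s a)"
definition "G1 s x = integral {-pi..x} (\<lambda>a. u a / (D s a)\<^sup>2)"
definition "P s = G s pi / (2 * pi)"
definition "P1 s = G1 s pi / (2 * pi)"
definition "P2 s = integral Ipi (\<lambda>a. 2 * (u a)\<^sup>2 / (D s a) ^ 3) / (2 * pi)"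
definition "X s a = - pi + G s a / P s"
definition "Y s x = (THE a. a \<in> Ipi \<and> X s a = x)"
definition "Xs s a = G1 s a / P s - G s a * P1 s / (P s)\<^sup>2"

section \<open>Regularity of \<open>P\<close> and of the label integrals\<close>

lemma cu: "continuous_on Ipi u" and cu1: "continuous_on Ipi u1" and cu2: "continuous_on Ipi u2"
  using du du1 du2 by (meson DERIV_continuous continuous_on_eq_continuous_within)+

lemma S_convex: "convex S" and zero_S: "0 \<in> S"
  using M by (auto simp: S_def)

lemma D_pos: "s \<in> S \<Longrightarrow> x \<in> Ipi \<Longrightarrow> D s x > 0"
proof -
  assume s: "s \<in> S" and x: "x \<in> Ipi"
  have "s * u x \<le> s * M" using u_le[OF x] s by (intro mult_left_mono) (auto simp: S_def)
  also have "\<dots> < 1" using s M by (auto simp: S_def field_simps)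
  finally show ?thesis by (simp add: D_def)
qed

lemma cont_snd: 
  assumes "continuous_on Ipi g"
  shows "continuous_on (A \<times> Ipi) (\<lambda>p. g (snd p))"
  by (rule continuous_on_compose2[OF assms]) (auto intro: continuous_intros)

lemma cont_fst: 
  assumes "continuous_on S g"
  shows "continuous_on (S \<times> A) (\<lambda>p. g (fst p))"
  by (rule continuous_on_compose2[OF assms]) (auto intro: continuous_intros)

lemma cont_D2: "continuous_on (S \<times> Ipi) (\<lambda>p. D (fst p) (snd p))"
  unfolding D_def by (intro continuous_intros cont_snd cu)

lemma cont_D: "s \<in> S \<Longrightarrow> continuous_on Ipi (D s)"
  unfolding D_def by (intro continuous_intros cu)

lemma D_nz: "s \<in> S \<Longrightarrow> x \<in> Ipi \<Longrightarrow> D s x \<noteq> 0"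
  using D_pos by force

lemma cont_Ds:
  "s \<in> S \<Longrightarrow> continuous_on Ipi (\<lambda>a. 1 / D s a)"
  "s \<in> S \<Longrightarrow> continuous_on Ipi (\<lambda>a. u a / (D s a)\<^sup>2)"
  "s \<in> S \<Longrightarrow> continuous_on Ipi (\<lambda>a. 2 * (u a)\<^sup>2 / (D s a) ^ 3)"
  by (auto intro!: continuous_intros cont_D cu simp: D_nz)

lemma cont_D2s:
  "continuous_on (S \<times> Ipi) (\<lambda>p. u (snd p) / (D (fst p) (snd p))\<^sup>2)"
  "continuous_on (S \<times> Ipi) (\<lambda>p. 2 * (u (snd p))\<^sup>2 / (D (fst p) (snd p)) ^ 3)"
  by (auto intro!: continuous_intros cont_D2 cont_snd cu simp: D_nz)

lemma dD: "((\<lambda>s. D s x) has_real_derivative - u x) (at s within A)"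
  unfolding D_def by (auto intro!: derivative_eq_intros)

lemma dG_s:
  assumes s: "s \<in> S" and x: "x \<in> Ipi"
  shows "((\<lambda>s. G s x) has_real_derivative G1 s x) (at s within S)"
  unfolding G_def G1_def
proof (rule leibniz_real[where h = "\<lambda>s a. 1 / D s a" and h' = "\<lambda>s a. u a / (D s a)\<^sup>2"])
  have sub: "{-pi..x} \<subseteq> Ipi" using x by auto
  then show "continuous_on {-pi..x} (\<lambda>a. 1 / D s a)" if "s \<in> S" for s
    using cont_Ds(1)[OF that] continuous_on_subset by blast
  show "continuous_on (S \<times> {-pi..x}) (\<lambda>p. u (snd p) / (D (fst p) (snd p))\<^sup>2)"
    by (rule continuous_on_subset[OF cont_D2s(1)]) (use sub in auto)
  show "((\<lambda>s. 1 / D s a) has_real_derivative u a / (D s a)\<^sup>2) (at s within S)"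
    if "s \<in> S" "a \<in> {-pi..x}" for s a
    using that sub D_nz[of s a]
    by (auto intro!: derivative_eq_intros dD simp: power2_eq_square)
qed (use s S_convex in auto)

lemma dP: "s \<in> S \<Longrightarrow> (P has_real_derivative P1 s) (at s within S)"
  unfolding P_def P1_def using DERIV_cdivide[OF dG_s[of s pi]] by auto

lemma dP1:
  assumes s: "s \<in> S"
  shows "(P1 has_real_derivative P2 s) (at s within S)"
proof -
  have "((\<lambda>s. G1 s pi) has_real_derivative integral Ipi (\<lambda>a. 2 * (u a)\<^sup>2 / (D s a) ^ 3)) (at s within S)"
    unfolding G1_def
  proof (rule leibniz_real[where h = "\<lambda>s a. u a / (D s a)\<^sup>2" and h' = "\<lambda>s a. 2 * (u a)\<^sup>2 / (D s a) ^ 3"])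
    show "((\<lambda>s. u a / (D s a)\<^sup>2) has_real_derivative 2 * (u a)\<^sup>2 / (D s a) ^ 3) (at s within S)"
      if "s \<in> S" "a \<in> Ipi" for s a
      using that D_nz[of s a]
      by (auto intro!: derivative_eq_intros dD simp: power2_eq_square power3_eq_cube field_simps)
  qed (use s S_convex cont_Ds cont_D2s in auto)
  from DERIV_cdivide[OF this, of "2 * pi"] show ?thesis unfolding P1_def P2_def by simp
qed

lemma dG_x: "s \<in> S \<Longrightarrow> x \<in> Ipi \<Longrightarrow> (G s has_real_derivative 1 / D s x) (at x within Ipi)"
  unfolding G_def by (rule integral_has_real_derivative) (use cont_Ds in auto)

lemma dG1_x: "s \<in> S \<Longrightarrow> x \<in> Ipi \<Longrightarrow> (G1 s has_real_derivative u x / (D s x)\<^sup>2) (at x within Ipi)"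
  unfolding G1_def by (rule integral_has_real_derivative) (use cont_Ds in auto)

lemma G_minus_pi [simp]: "G s (-pi) = 0" and G1_minus_pi [simp]: "G1 s (-pi) = 0"
  by (simp_all add: G_def G1_def)

lemma P_pos: "s \<in> S \<Longrightarrow> P s > 0"
proof -
  assume s: "s \<in> S"
  have pi: "-pi < pi" by simp
  have nn: "1 / D s x \<ge> 0" if "x \<in> Ipi" for x using D_pos[OF s that] by simp
  have "G s pi \<noteq> 0"
    unfolding G_def using integral_eq_0_iff[OF cont_Ds(1)[OF s] pi nn] D_nz[OF s, of 0] by auto
  moreover have "G s pi \<ge> 0" unfolding G_def
    by (rule integral_nonneg) (use nn in \<open>auto intro: integrable_continuous_real cont_Ds s\<close>)
  ultimately show ?thesis by (simp add: P_def)
qed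

lemma P_nz: "s \<in> S \<Longrightarrow> P s \<noteq> 0" using P_pos by force

lemma cont_P: "continuous_on S P" and cont_P1: "continuous_on S P1"
  using dP dP1 by (meson DERIV_continuous continuous_on_eq_continuous_within)+

lemma cont_P2: "continuous_on S P2"
proof -
  have "continuous_on S (\<lambda>s. integral (cbox (-pi) pi) (\<lambda>a. 2 * (u a)\<^sup>2 / (D s a) ^ 3))"
    by (rule integral_continuous_on_param) (use cont_D2s(2) in \<open>auto simp: case_prod_beta\<close>)
  then show ?thesis unfolding P2_def by (auto intro!: continuous_intros)
qed

section \<open>The flow map and its inverse\<close>

lemma X_ends: "X s (-pi) = -pi" "s \<in> S \<Longrightarrow> X s pi = pi"
  using P_nz[of s] by (auto simp: X_def P_def)

lemma dX_a: 
  assumes "s \<in> S" "a \<in> Ipi"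
  shows "(X s has_real_derivative 1 / (P s * D s a)) (at a within Ipi)"
proof -
  have "((\<lambda>a. - pi + G s a / P s) has_real_derivative 0 + 1 / D s a / P s) (at a within Ipi)"
    by (intro DERIV_add DERIV_const DERIV_cdivide dG_x assms)
  then show ?thesis unfolding X_def by (simp add: mult.commute)
qed

lemma dX_s:
  assumes "s \<in> S" "a \<in> Ipi"
  shows "((\<lambda>s. X s a) has_real_derivative Xs s a) (at s within S)"
  unfolding X_def Xs_def using P_nz[OF assms(1)]
  by (auto intro!: derivative_eq_intros dG_s dP assms simp: field_simps power2_eq_square)

lemma PD_pos: "s \<in> S \<Longrightarrow> a \<in> Ipi \<Longrightarrow> 1 / (P s * D s a) > 0"
  using P_pos D_pos by simp

lemma Ipi_convex: "convex Ipi" by simp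

lemma X_strict: 
  assumes s: "s \<in> S" and "a \<in> Ipi" "a' \<in> Ipi" "a < a'"
  shows "X s a < X s a'"
proof -
  obtain z where "z \<in> Ipi" "X s a' - X s a = 1 / (P s * D s z) * (a' - a)"
    using real_mvt_segment[OF Ipi_convex assms(2,3) dX_a[OF s]] by blast
  then show ?thesis using PD_pos[OF s] assms(4) by (metis diff_gt_0_iff_gt mult_pos_pos)
qed

lemma X_inj: "s \<in> S \<Longrightarrow> a \<in> Ipi \<Longrightarrow> a' \<in> Ipi \<Longrightarrow> X s a = X s a' \<Longrightarrow> a = a'"
  using X_strict by (metis linorder_less_linear order_less_irrefl)

lemma cont_X: "s \<in> S \<Longrightarrow> continuous_on Ipi (X s)"
  using dX_a by (meson DERIV_continuous continuous_on_eq_continuous_within)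

lemma X_Ipi: "s \<in> S \<Longrightarrow> a \<in> Ipi \<Longrightarrow> X s a \<in> Ipi"
  using X_strict[of s "-pi" a] X_strict[of s a pi] X_ends[of s] by fastforce

lemma Y_ex1: 
  assumes s: "s \<in> S" and x: "x \<in> Ipi"
  shows "\<exists>!a. a \<in> Ipi \<and> X s a = x"
proof -
  have "\<exists>a\<ge>-pi. a \<le> pi \<and> X s a = x"
    by (rule IVT') (use X_ends[of s] s x cont_X[OF s] in auto)
  then show ?thesis using X_inj[OF s] by auto
qed

lemma Y_Ipi: "s \<in> S \<Longrightarrow> x \<in> Ipi \<Longrightarrow> Y s x \<in> Ipi"
  and X_Y: "s \<in> S \<Longrightarrow> x \<in> Ipi \<Longrightarrow> X s (Y s x) = x"
  unfolding Y_def using theI'[OF Y_ex1[of s x]] by auto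

lemma Y_X: "s \<in> S \<Longrightarrow> a \<in> Ipi \<Longrightarrow> Y s (X s a) = a"
  using X_inj[of s "Y s (X s a)" a] Y_Ipi X_Y X_Ipi by blast

lemma Y_ends: "s \<in> S \<Longrightarrow> Y s (-pi) = -pi" "s \<in> S \<Longrightarrow> Y s pi = pi"
  using Y_X[of s "-pi"] Y_X[of s pi] X_ends[of s] by auto

lemma abs_u_bound: obtains L where "L > 0" "\<And>x. x \<in> Ipi \<Longrightarrow> \<bar>u x\<bar> \<le> L"
  using continuous_compact_abs_bound[OF _ cu] by auto

text \<open>The reciprocal Jacobian \<open>P s * D s z\<close> is at most
  \<open>P s * (1 + s * L)\<close>. The reference label \<open>b\<close> is independent of
  \<open>s\<close>, so one bound controls the variation of \<open>Y\<close> in both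
  variables.\<close>

lemma Y_lipschitz:
  assumes L: "\<And>x. x \<in> Ipi \<Longrightarrow> \<bar>u x\<bar> \<le> L" and s: "s \<in> S" and x: "x \<in> Ipi" and b: "b \<in> Ipi"
  shows "\<bar>Y s x - b\<bar> \<le> P s * (1 + s * L) * \<bar>x - X s b\<bar>"
proof -
  obtain z where z: "z \<in> Ipi" "X s (Y s x) - X s b = 1 / (P s * D s z) * (Y s x - b)"
    using real_mvt_segment[OF Ipi_convex b Y_Ipi[OF s x] dX_a[OF s]] by blast
  then have "Y s x - b = P s * D s z * (x - X s b)"
    using X_Y[OF s x] P_nz[OF s] D_nz[OF s z(1)] by (simp add: field_simps)
  then have "\<bar>Y s x - b\<bar> = P s * D s z * \<bar>x - X s b\<bar>"
    using P_pos[OF s] D_pos[OF s z(1)] by (simp add: abs_mult)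
  also have "\<dots> \<le> P s * (1 + s * L) * \<bar>x - X s b\<bar>"
  proof -
    have "s * - u z \<le> s * L" using s L[OF z(1)] by (intro mult_left_mono) (auto simp: S_def)
    then show ?thesis using P_pos[OF s] unfolding D_def by (intro mult_right_mono mult_left_mono) auto
  qed
  finally show ?thesis .
qed

text \<open>With \<open>b\<close> the value of \<open>Y\<close> at the base point, the bound of
  \<open>Y_lipschitz\<close> is a continuous function of \<open>(s, x)\<close> that vanishes
  there.\<close>

lemma Y_cont: "continuous_on (S \<times> Ipi) (\<lambda>p. Y (fst p) (snd p))"
  unfolding continuous_on_def
proof
  fix p0 assume p0: "p0 \<in> S \<times> Ipi"
  obtain s0 x0 where p0_eq: "p0 = (s0, x0)" and s0: "s0 \<in> S" and x0: "x0 \<in> Ipi" using p0 by auto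
  obtain L where L: "\<And>x. x \<in> Ipi \<Longrightarrow> \<bar>u x\<bar> \<le> L" using abs_u_bound by blast
  define b where "b = Y s0 x0"
  have b: "b \<in> Ipi" unfolding b_def using Y_Ipi s0 x0 by auto
  have Xb: "continuous_on S (\<lambda>s. X s b)"
    using dX_s b by (meson DERIV_continuous continuous_on_eq_continuous_within)
  then have "continuous_on (S \<times> Ipi) (\<lambda>p. P (fst p) * (1 + fst p * L) * \<bar>snd p - X (fst p) b\<bar>)"
    by (intro continuous_intros cont_fst[OF cont_P] cont_fst[OF Xb])
  then have "((\<lambda>p. P (fst p) * (1 + fst p * L) * \<bar>snd p - X (fst p) b\<bar>) \<longlongrightarrow> 0) (at p0 within S \<times> Ipi)"
    unfolding continuous_on_def using p0 X_Y[OF s0 x0] by (force simp: p0_eq b_def)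
  moreover have "\<forall>\<^sub>F p in at p0 within S \<times> Ipi. norm (Y (fst p) (snd p) - b) \<le> P (fst p) * (1 + fst p * L) * \<bar>snd p - X (fst p) b\<bar>"
    unfolding eventually_at_filter using Y_lipschitz[OF L _ _ b] by (intro always_eventually) auto
  ultimately have "((\<lambda>p. Y (fst p) (snd p) - b) \<longlongrightarrow> 0) (at p0 within S \<times> Ipi)"
    by (rule Lim_null_comparison[rotated])
  then show "((\<lambda>p. Y (fst p) (snd p)) \<longlongrightarrow> Y (fst p0) (snd p0)) (at p0 within S \<times> Ipi)"
    by (simp add: LIM_zero_iff p0_eq b_def)
qed

lemma Y_cont_x: "s \<in> S \<Longrightarrow> continuous_on Ipi (Y s)"
  and Y_cont_s: "x \<in> Ipi \<Longrightarrow> continuous_on S (\<lambda>s. Y s x)" for s x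
proof -
  show "continuous_on Ipi (Y s)" if "s \<in> S"
    using continuous_on_compose2[OF Y_cont, of Ipi "\<lambda>x. (s, x)"] that by (force intro: continuous_intros)
  show "continuous_on S (\<lambda>s. Y s x)" if "x \<in> Ipi"
    using continuous_on_compose2[OF Y_cont, of S "\<lambda>s. (s, x)"] that by (force intro: continuous_intros)
qed

lemma dY_x:
  assumes s: "s \<in> S" and x: "x \<in> Ipi"
  shows "(Y s has_real_derivative P s * D s (Y s x)) (at x within Ipi)"
proof -
  have "(Y s has_real_derivative - (-1) / (1 / (P s * D s (Y s x)))) (at x within Ipi)"
  proof (rule implicit_real_derivative[where C = Ipi and H = "\<lambda>r a. X s a - r" and H' = "\<lambda>r a. 1 / (P s * D s a)"])
    show "((\<lambda>a. X s a - r) has_real_derivative 1 / (P s * D s a)) (at a within Ipi)" if "a \<in> Ipi" for r a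
      using DERIV_diff[OF dX_a[OF s that] DERIV_const] by simp
    show "continuous_on (Ipi \<times> Ipi) (\<lambda>p. 1 / (P s * D s (snd p)))"
      by (intro continuous_intros cont_snd cont_D s) (use P_nz[OF s] D_nz[OF s] in auto)
    show "(Y s \<longlongrightarrow> Y s x) (at x within Ipi)" using Y_cont_x[OF s] x by (auto simp: continuous_on_def)
    show "((\<lambda>r. X s (Y s x) - r) has_real_derivative - 1) (at x within Ipi)"
      by (auto intro!: derivative_eq_intros)
  qed (use s x Y_Ipi X_Y PD_pos in auto)
  then show ?thesis by simp
qed

text \<open>Differentiate \<open>X s (Y s x) = x\<close> in \<open>s\<close> at fixed
  \<open>x\<close>.\<close>

lemma dY_s:
  assumes s: "s \<in> S" and x: "x \<in> Ipi"
  shows "((\<lambda>s. Y s x) has_real_derivative - Xs s (Y s x) * (P s * D s (Y s x))) (at s within S)"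
proof -
  have "((\<lambda>s. Y s x) has_real_derivative - Xs s (Y s x) / (1 / (P s * D s (Y s x)))) (at s within S)"
  proof (rule implicit_real_derivative[where C = Ipi and H = "\<lambda>s a. X s a - x" and H' = "\<lambda>s a. 1 / (P s * D s a)"])
    show "((\<lambda>a. X s a - x) has_real_derivative 1 / (P s * D s a)) (at a within Ipi)" if "s \<in> S" "a \<in> Ipi" for s a
      using DERIV_diff[OF dX_a[OF that] DERIV_const] by simp
    show "continuous_on (S \<times> Ipi) (\<lambda>p. 1 / (P (fst p) * D (fst p) (snd p)))"
      by (intro continuous_intros cont_D2 cont_fst[OF cont_P])
         (use P_nz D_nz in auto)
    show "((\<lambda>s. Y s x) \<longlongrightarrow> Y s x) (at s within S)" using Y_cont_s[OF x] s by (auto simp: continuous_on_def)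
    show "((\<lambda>r. X r (Y s x) - x) has_real_derivative Xs s (Y s x)) (at s within S)"
      using DERIV_diff[OF dX_s[OF s Y_Ipi[OF s x]] DERIV_const] by simp
  qed (use s x Y_Ipi X_Y PD_pos S_convex in auto)
  then show ?thesis by simp
qed

text \<open>The substitution x = X s a moves spatial integrals of the solution to labels, where they
  reduce to \<open>G\<close>, \<open>G1\<close>, \<open>P\<close> and their derivatives.\<close>

lemma integral_Y_subst:
  assumes s: "s \<in> S" and x: "x \<in> Ipi" and g: "continuous_on Ipi g"
  shows "integral {-pi..x} (\<lambda>x. g (Y s x)) = integral {-pi..Y s x} (\<lambda>a. g a / (P s * D s a))"
proof -
  define H where "H a = integral {-pi..a} (\<lambda>a. g a / (P s * D s a))" for a
  have dH: "(H has_real_derivative g a / (P s * D s a)) (at a within Ipi)" if "a \<in> Ipi" for a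
    unfolding H_def
    by (rule integral_has_real_derivative)
      (use that P_nz D_nz s in \<open>auto intro!: continuous_intros g cont_D\<close>)
  have d: "((\<lambda>x. H (Y s x)) has_real_derivative g (Y s y)) (at y within Ipi)" if "y \<in> Ipi" for y
  proof -
    have "((\<lambda>x. H (Y s x)) has_real_derivative g (Y s y) / (P s * D s (Y s y)) * (P s * D s (Y s y))) (at y within Ipi)"
      by (rule real_chain_within[OF dH[OF Y_Ipi[OF s that]] dY_x[OF s that]]) (use Y_Ipi[OF s] in auto)
    then show ?thesis using P_nz[OF s] D_nz[OF s Y_Ipi[OF s that]] by simp
  qed
  have "((\<lambda>x. g (Y s x)) has_integral (H (Y s x) - H (Y s (-pi)))) {-pi..x}"
    by (rule real_FTC[where A = Ipi]) (use d x in auto)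
  then show ?thesis using Y_ends[OF s] by (simp add: H_def integral_unique)
qed

text \<open>
  \<open>W 0\<close> is the solution as a function of \<open>s\<close> and \<open>x\<close>, and \<open>W j\<close> for \<open>j \<le> 3\<close> is its \<open>j\<close>-th \<open>x\<close>-derivative. \<open>Fs\<close> is the
  \<open>s\<close>-derivative of \<open>E 0\<close> at a fixed label \<open>a\<close>, \<open>Ws\<close> that of \<open>W 0\<close> at fixed \<open>x\<close>. In the original time variable \<open>A\<close> is the
  mean \<open>(1/\<pi>) \<integral> b\<^sup>2\<close> and \<open>B\<close> its primitive.
\<close>

definition "E j s a =
  (if j = 0 then u a / (P s * D s a) - P1 s / (P s)\<^sup>2
   else if j = 1 then u1 a / D s a
   else if j = 2 then P s * (u2 a + s * (u1 a)\<^sup>2 / D s a)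
   else (P s)\<^sup>2 * (D s a * u3 a + 2 * s * u1 a * u2 a + s\<^sup>2 * (u1 a) ^ 3 / D s a))" for j :: nat
definition "W j s x = E j s (Y s x)"
definition "B s = P1 s / (P s)\<^sup>2"
definition "A s = P2 s / (P s) ^ 3 - 2 * (P1 s)\<^sup>2 / (P s) ^ 4"
definition "Fs s a = (u a)\<^sup>2 / (P s * (D s a)\<^sup>2) - u a * P1 s / ((P s)\<^sup>2 * D s a) - P s * A s"
definition "Ws s x = Fs s (Y s x) - E 1 s (Y s x) * Xs s (Y s x)"

section \<open>Derivatives of the solution in space and time\<close>

lemma dD_a: "a \<in> Ipi \<Longrightarrow> (D s has_real_derivative - s * u1 a) (at a within Ipi)"
  unfolding D_def by (auto intro!: derivative_eq_intros du)

text \<open>In labels d/dx is \<open>P s * D s a\<close> times d/da, so each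
  \<open>E (Suc j)\<close> is that multiple of the derivative of \<open>E j\<close>. The relation D
  + s u = 1 reduces the derivative of u/D to u1/D^2, which makes \<open>E 1\<close> independent of
  \<open>P\<close>.\<close>

lemma dE_a:
  assumes s: "s \<in> S" and a: "a \<in> Ipi" and j: "j < 3"
  shows "(E j s has_real_derivative E (Suc j) s a / (P s * D s a)) (at a within Ipi)"
proof -
  have nz: "P s \<noteq> 0" "D s a \<noteq> 0" using P_nz D_nz s a by auto
  have su: "u a * s = 1 - D s a" by (simp add: D_def)
  consider "j = 0" | "j = 1" | "j = 2" using j by linarith
  then show ?thesis
  proof cases
    case 1
    have "((\<lambda>a. u a / (P s * D s a) - P1 s / (P s)\<^sup>2) has_real_derivative
        (u1 a * (P s * D s a) - u a * (P s * (- s * u1 a))) / (P s * D s a * (P s * D s a)) - 0) (at a within Ipi)"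
      by (intro DERIV_diff DERIV_divide DERIV_cmult du dD_a a DERIV_const) (use nz in auto)
    moreover have "(u1 a * (P s * D s a) - u a * (P s * (- s * u1 a))) = P s * u1 a * (D s a + u a * s)"
      by (simp add: algebra_simps)
    ultimately show ?thesis using 1 nz unfolding su E_def by (simp add: field_simps)
  next
    case 2
    have "((\<lambda>a. u1 a / D s a) has_real_derivative
        (u2 a * D s a - u1 a * (- s * u1 a)) / (D s a * D s a)) (at a within Ipi)"
      by (intro DERIV_divide du1 dD_a a) (use nz in auto)
    moreover have "E 2 s a / (P s * D s a) = (u2 a * D s a - u1 a * (- s * u1 a)) / (D s a * D s a)"
      using nz by (simp add: E_def field_simps power2_eq_square)
    moreover have "E j s = (\<lambda>a. u1 a / D s a)" "Suc j = 2" using 2 by (auto simp: E_def)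
    ultimately show ?thesis by (simp only:)
  next
    case 3
    have "((\<lambda>a. P s * (u2 a + s * (u1 a)\<^sup>2 / D s a)) has_real_derivative
        P s * (u3 a + (s * (2 * u1 a * u2 a) * D s a - s * (u1 a)\<^sup>2 * (- s * u1 a)) / (D s a * D s a))) (at a within Ipi)"
      using DERIV_power[OF du1[OF a], of 2]
      by (intro DERIV_cmult DERIV_add DERIV_divide du2 dD_a a) (use nz in \<open>auto simp: ac_simps\<close>)
    moreover have "E 3 s a / (P s * D s a) =
       P s * (u3 a + (s * (2 * u1 a * u2 a) * D s a - s * (u1 a)\<^sup>2 * (- s * u1 a)) / (D s a * D s a))"
      using nz by (simp add: E_def field_simps power2_eq_square power3_eq_cube)
    moreover have "E j s = (\<lambda>a. P s * (u2 a + s * (u1 a)\<^sup>2 / D s a))" "Suc j = 3" using 3 by (auto simp: E_def)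
    ultimately show ?thesis by (simp only:)
  qed
qed

lemma dW_x:
  assumes s: "s \<in> S" and x: "x \<in> Ipi" and j: "j < 3"
  shows "(W j s has_real_derivative W (Suc j) s x) (at x within Ipi)"
proof -
  have Y: "Y s x \<in> Ipi" using Y_Ipi s x by auto
  have "((\<lambda>x. E j s (Y s x)) has_real_derivative
      E (Suc j) s (Y s x) / (P s * D s (Y s x)) * (P s * D s (Y s x))) (at x within Ipi)"
    by (rule real_chain_within[OF dE_a[OF s Y j] dY_x[OF s x]]) (use Y_Ipi[OF s] in auto)
  moreover have "P s * D s (Y s x) \<noteq> 0" using P_nz[OF s] D_nz[OF s Y] by simp
  ultimately show ?thesis unfolding W_def by (simp del: mult_eq_0_iff)
qed

lemma E_cont: "continuous_on (S \<times> Ipi) (\<lambda>p. E j (fst p) (snd p))"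
proof -
  note ci = continuous_intros cont_D2 cont_fst[OF cont_P] cont_fst[OF cont_P1] cont_snd cu cu1 cu2 cu3
  consider "j = 0" | "j = 1" | "j = 2" | "j \<noteq> 0" "j \<noteq> 1" "j \<noteq> 2" by blast
  then show ?thesis
  proof cases
    case 1
    have "continuous_on (S \<times> Ipi) (\<lambda>p. u (snd p) / (P (fst p) * D (fst p) (snd p)) - P1 (fst p) / (P (fst p))\<^sup>2)"
      by (intro ci) (use P_nz D_nz in auto)
    then show ?thesis using 1 by (simp add: E_def)
  next
    case 2
    have "continuous_on (S \<times> Ipi) (\<lambda>p. u1 (snd p) / D (fst p) (snd p))"
      by (intro ci) (use D_nz in auto)
    then show ?thesis using 2 by (simp add: E_def)
  next
    case 3
    have "continuous_on (S \<times> Ipi) (\<lambda>p. P (fst p) * (u2 (snd p) + fst p * (u1 (snd p))\<^sup>2 / D (fst p) (snd p)))"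
      by (intro ci) (use D_nz in auto)
    then show ?thesis using 3 by (simp add: E_def)
  next
    case 4
    have "continuous_on (S \<times> Ipi) (\<lambda>p. (P (fst p))\<^sup>2 * (D (fst p) (snd p) * u3 (snd p) +
        2 * fst p * u1 (snd p) * u2 (snd p) + (fst p)\<^sup>2 * (u1 (snd p)) ^ 3 / D (fst p) (snd p)))"
      by (intro ci) (use D_nz in auto)
    then show ?thesis using 4 by (simp add: E_def)
  qed
qed

lemma cont_Y_comp:
  assumes "continuous_on (S \<times> Ipi) (\<lambda>p. g (fst p) (snd p))"
  shows "continuous_on (S \<times> Ipi) (\<lambda>p. g (fst p) (Y (fst p) (snd p)))"
  using continuous_on_compose2[OF assms, of "S \<times> Ipi" "\<lambda>p. (fst p, Y (fst p) (snd p))"] Y_Ipi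
  by (force intro!: continuous_intros Y_cont)

lemma W_cont: "continuous_on (S \<times> Ipi) (\<lambda>p. W j (fst p) (snd p))"
  unfolding W_def by (rule cont_Y_comp[OF E_cont])

lemma W_cont_x: "s \<in> S \<Longrightarrow> continuous_on Ipi (W j s)"
  using continuous_on_compose2[OF W_cont[of j], of Ipi "\<lambda>x. (s, x)"] by (force intro: continuous_intros)

lemma E_cont_a: "s \<in> S \<Longrightarrow> continuous_on Ipi (E j s)"
  using continuous_on_compose2[OF E_cont[of j], of Ipi "\<lambda>x. (s, x)"] by (force intro: continuous_intros)

text \<open>The factor \<open>P s\<close> is dt/ds: in physical time the derivative of
  \<open>B\<close> is \<open>A\<close>.\<close>

lemma dB: 
  assumes "s \<in> S" shows "(B has_real_derivative P s * A s) (at s within S)"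
proof -
  have nz: "P s \<noteq> 0" using P_nz assms by auto
  have "((\<lambda>s. P1 s / (P s)\<^sup>2) has_real_derivative
     (P2 s * (P s)\<^sup>2 - P1 s * (2 * P s * P1 s)) / ((P s)\<^sup>2 * (P s)\<^sup>2)) (at s within S)"
    using DERIV_power[OF dP[OF assms], of 2]
    by (intro DERIV_divide dP1 assms) (use nz in \<open>auto simp: ac_simps\<close>)
  moreover have "(P2 s * (P s)\<^sup>2 - P1 s * (2 * P s * P1 s)) / ((P s)\<^sup>2 * (P s)\<^sup>2) = P s * A s"
    using nz by (simp add: A_def field_simps power2_eq_square power3_eq_cube power4_eq_xxxx)
  ultimately show ?thesis unfolding B_def by simp
qed

text \<open>At fixed \<open>x\<close> the label moves with velocity \<open>- Xs * P * D\<close>.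
  Since \<open>P * D\<close> times the label derivative of \<open>E 0\<close> is \<open>E 1\<close>,
  this produces the transport term in \<open>Ws\<close>; the rest is the change along a
  characteristic.\<close>

lemma dW_s:
  assumes s: "s \<in> S" and x: "x \<in> Ipi"
  shows "((\<lambda>s. W 0 s x) has_real_derivative Ws s x) (at s within S)"
proof -
  define a where "a = Y s x"
  have a: "a \<in> Ipi" using Y_Ipi s x a_def by auto
  have nz: "P s \<noteq> 0" "D s a \<noteq> 0" using P_nz D_nz s a by auto
  \<comment> \<open>The change of \<open>u (Y s x)\<close> due to the moving label; the label
    \<open>a\<close> itself is frozen at the current \<open>s\<close>.\<close>
  define v' where "v' = u1 a * (- Xs s a * (P s * D s a))"
  have duY: "((\<lambda>s. u (Y s x)) has_real_derivative v') (at s within S)"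
    unfolding v'_def a_def
    by (rule real_chain_within[OF du dY_s[OF s x]]) (use Y_Ipi x s in auto)
  have dDY: "((\<lambda>s. D s (Y s x)) has_real_derivative - (u a + s * v')) (at s within S)"
    unfolding D_def a_def by (auto intro!: derivative_eq_intros duY)
  have "((\<lambda>s. u (Y s x) / (P s * D s (Y s x)) - B s) has_real_derivative
     (v' * (P s * D s a) - u a * (P1 s * D s a + (- (u a + s * v')) * P s)) / (P s * D s a * (P s * D s a)) - P s * A s) (at s within S)"
    using nz unfolding a_def
    by (intro DERIV_diff DERIV_divide DERIV_mult duY dDY[unfolded a_def] dP dB s) auto
  moreover have "(v' * (P s * D s a) - u a * (P1 s * D s a + (- (u a + s * v')) * P s)) / (P s * D s a * (P s * D s a)) - P s * A s
      = Fs s a - E 1 s a * Xs s a"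
  proof -
    have "v' * (P s * D s a) - u a * (P1 s * D s a + (- (u a + s * v')) * P s) 
        = v' * P s * (D s a + s * u a) - u a * P1 s * D s a + (u a)\<^sup>2 * P s"
      by (simp add: algebra_simps power2_eq_square)
    also have "D s a + s * u a = 1" by (simp add: D_def)
    finally have "v' * (P s * D s a) - u a * (P1 s * D s a + (- (u a + s * v')) * P s) 
        = v' * P s - u a * P1 s * D s a + (u a)\<^sup>2 * P s" by simp
    then show ?thesis using nz
      by (simp add: Fs_def E_def v'_def field_simps power2_eq_square)
  qed
  ultimately show ?thesis unfolding W_def E_def Ws_def a_def[symmetric] B_def by simp
qed

section \<open>The nonlocal terms in label coordinates\<close>

lemma int_Ds:
  assumes "s \<in> S" "a \<in> Ipi"
  shows "((\<lambda>a. 1 / D s a) has_integral G s a) {-pi..a}"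
    and "((\<lambda>a. u a / (D s a)\<^sup>2) has_integral G1 s a) {-pi..a}"
  unfolding G_def G1_def using assms
  by (auto intro!: integrable_integral integrable_continuous_real intro: continuous_on_subset[OF cont_Ds(1)] continuous_on_subset[OF cont_Ds(2)])

text \<open>The nonlocal velocity is dX/dt, so the characteristics of the equation are the curves t
  -> X. In labels the integrand splits into multiples of the integrands of \<open>G1\<close> and
  \<open>G\<close>.\<close>

lemma integral_W:
  assumes s: "s \<in> S" and x: "x \<in> Ipi"
  shows "integral {-pi..x} (W 0 s) = Xs s (Y s x) / P s"
proof -
  define a where "a = Y s x"
  have a: "a \<in> Ipi" using Y_Ipi s x a_def by auto
  have nz: "P s \<noteq> 0" using P_nz s by auto
  have "((\<lambda>a. u a / (D s a)\<^sup>2 * (1 / (P s)\<^sup>2) - 1 / D s a * (P1 s / (P s) ^ 3)) has_integral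
     G1 s a * (1 / (P s)\<^sup>2) - G s a * (P1 s / (P s) ^ 3)) {-pi..a}"
    by (intro has_integral_diff has_integral_mult_left int_Ds s a)
  also have "G1 s a * (1 / (P s)\<^sup>2) - G s a * (P1 s / (P s) ^ 3) = Xs s a / P s"
    using nz by (simp add: Xs_def field_simps power2_eq_square power3_eq_cube)
  finally have "((\<lambda>a. E 0 s a / (P s * D s a)) has_integral Xs s a / P s) {-pi..a}"
  proof (rule has_integral_eq[rotated])
    fix y assume "y \<in> {-pi..a}"
    then have "D s y \<noteq> 0" using D_nz[OF s] a by auto
    then show "u y / (D s y)\<^sup>2 * (1 / (P s)\<^sup>2) - 1 / D s y * (P1 s / (P s) ^ 3) = E 0 s y / (P s * D s y)"
      using nz by (simp add: E_def field_simps power2_eq_square power3_eq_cube)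
  qed
  then show ?thesis using integral_Y_subst[OF s x E_cont_a[OF s, of 0]]
    by (simp add: W_def[abs_def] a_def integral_unique)
qed

lemma Xs_pi: "s \<in> S \<Longrightarrow> Xs s pi = 0"
  using P_nz[of s] by (simp add: Xs_def P_def P1_def field_simps power2_eq_square)

lemma mean_W: "s \<in> S \<Longrightarrow> integral Ipi (W 0 s) = 0"
  using integral_W[of s pi] Xs_pi Y_ends by simp

text \<open>Expanding the square leaves integrals of 1/D, u/D^2 and u^2/D^3, whose totals are
  multiples of \<open>P\<close>, \<open>P1\<close> and \<open>P2\<close>. Hence the form of
  \<open>A\<close>, which \<open>dB\<close> identifies with the time derivative of
  \<open>B\<close>.\<close>

lemma integral_W2:
  assumes s: "s \<in> S"
  shows "integral Ipi (\<lambda>x. (W 0 s x)\<^sup>2) = pi * A s"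
proof -
  have nz: "P s \<noteq> 0" using P_nz s by auto
  have i3: "((\<lambda>a. 2 * (u a)\<^sup>2 / (D s a) ^ 3) has_integral 2 * pi * P2 s) Ipi"
    using integrable_integral[OF integrable_continuous_real[OF cont_Ds(3)[OF s]]] by (simp add: P2_def)
  have pi: "pi \<in> Ipi" by simp
  have "((\<lambda>a. 2 * (u a)\<^sup>2 / (D s a) ^ 3 * (1 / (2 * (P s) ^ 3)) - u a / (D s a)\<^sup>2 * (2 * P1 s / (P s) ^ 4)
       + 1 / D s a * ((P1 s)\<^sup>2 / (P s) ^ 5)) has_integral
     2 * pi * P2 s * (1 / (2 * (P s) ^ 3)) - G1 s pi * (2 * P1 s / (P s) ^ 4) + G s pi * ((P1 s)\<^sup>2 / (P s) ^ 5)) Ipi"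
    by (intro has_integral_add has_integral_diff has_integral_mult_left int_Ds[OF s pi] i3)
  also have "2 * pi * P2 s * (1 / (2 * (P s) ^ 3)) - G1 s pi * (2 * P1 s / (P s) ^ 4) + G s pi * ((P1 s)\<^sup>2 / (P s) ^ 5) = pi * A s"
  proof -
    have "G1 s pi = 2 * pi * P1 s" "G s pi = 2 * pi * P s" by (simp_all add: P_def P1_def)
    then show ?thesis using nz by (simp add: A_def field_simps eval_nat_numeral)
  qed
  finally have "((\<lambda>a. (E 0 s a)\<^sup>2 / (P s * D s a)) has_integral pi * A s) Ipi"
  proof (rule has_integral_eq[rotated])
    fix y assume "y \<in> Ipi"
    then have "D s y \<noteq> 0" using D_nz[OF s] by auto
    then show "2 * (u y)\<^sup>2 / (D s y) ^ 3 * (1 / (2 * (P s) ^ 3)) - u y / (D s y)\<^sup>2 * (2 * P1 s / (P s) ^ 4)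
       + 1 / D s y * ((P1 s)\<^sup>2 / (P s) ^ 5) = (E 0 s y)\<^sup>2 / (P s * D s y)"
      using nz by (simp add: E_def field_simps eval_nat_numeral)
  qed
  then show ?thesis
    using integral_Y_subst[OF s pi, of "\<lambda>a. (E 0 s a)\<^sup>2"] E_cont_a[OF s, of 0] Y_ends[OF s]
    by (simp add: W_def integral_unique continuous_on_power)
qed

text \<open>The equation along a characteristic: \<open>Fs s a / P s\<close> is the time derivative
  at fixed label, and no transport term remains.\<close>

lemma riccati:
  assumes s: "s \<in> S" and a: "a \<in> Ipi"
  shows "Fs s a / P s - (E 0 s a)\<^sup>2 + A s = B s * E 0 s a"
  using P_nz[OF s] D_nz[OF s a]
  by (simp add: Fs_def E_def B_def field_simps power2_eq_square)

text \<open>The derivatives in \<open>a\<close> are unbounded as \<open>s\<close> tends to 1/M when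
  the bound \<open>M\<close> is attained, so the compact criterion is applied on each
  \<open>{0..b}\<close> and the pieces are exhausted.\<close>

lemma G_cont:
  "continuous_on (S \<times> Ipi) (\<lambda>p. G (fst p) (snd p))"
  "continuous_on (S \<times> Ipi) (\<lambda>p. G1 (fst p) (snd p))"
proof -
  have sub: "{0..b} \<subseteq> S" if "b < 1/M" for b using that by (auto simp: S_def)
  have inv: "continuous_on (S \<times> Ipi) (\<lambda>p. 1 / D (fst p) (snd p))"
    by (intro continuous_intros cont_D2) (use D_nz in auto)
  have Gs: "continuous_on S (\<lambda>s. G s a)" if "a \<in> Ipi" for a
    using dG_s[OF _ that] by (meson DERIV_continuous continuous_on_eq_continuous_within)
  have G1s: "continuous_on S (\<lambda>s. G1 s a)" if "a \<in> Ipi" for a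
  proof -
    have "continuous_on (S \<times> {-pi..a}) (\<lambda>(s, x). u x / (D s x)\<^sup>2)"
      unfolding case_prod_beta by (rule continuous_on_subset[OF cont_D2s(1)]) (use that in auto)
    from integral_continuous_on_param[of S "-pi" a, unfolded box_real, OF this]
    show ?thesis unfolding G1_def by simp
  qed
  show "continuous_on (S \<times> Ipi) (\<lambda>p. G (fst p) (snd p))"
    unfolding S_def
  proof (rule continuous_on_Ico_Times)
    fix b assume b: "b < 1 / M"
    show "continuous_on ({0..b} \<times> Ipi) (\<lambda>p. G (fst p) (snd p))"
      by (rule joint_continuity_compact[where h = "\<lambda>s a. 1 / D s a"])
        (use sub[OF b] in \<open>auto intro!: subsetD[OF sub[OF b]] intro: dG_x continuous_on_subset[OF inv] continuous_on_subset[OF Gs]\<close>)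
  qed
  show "continuous_on (S \<times> Ipi) (\<lambda>p. G1 (fst p) (snd p))"
    unfolding S_def
  proof (rule continuous_on_Ico_Times)
    fix b assume b: "b < 1 / M"
    show "continuous_on ({0..b} \<times> Ipi) (\<lambda>p. G1 (fst p) (snd p))"
      by (rule joint_continuity_compact[where h = "\<lambda>s a. u a / (D s a)\<^sup>2"])
        (use sub[OF b] in \<open>auto intro!: subsetD[OF sub[OF b]] intro: dG1_x continuous_on_subset[OF cont_D2s(1)] continuous_on_subset[OF G1s]\<close>)
  qed
qed

lemma A_cont: "continuous_on S A"
  unfolding A_def by (intro continuous_intros cont_P cont_P1 cont_P2) (use P_nz in auto)

lemma Ws_cont: "continuous_on (S \<times> Ipi) (\<lambda>p. Ws (fst p) (snd p))"
proof -
  have "continuous_on (S \<times> Ipi) (\<lambda>p. Fs (fst p) (snd p) - E 1 (fst p) (snd p) * Xs (fst p) (snd p))"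
    unfolding Fs_def Xs_def
    by (intro continuous_intros E_cont G_cont cont_fst[OF A_cont] cont_fst[OF cont_P] cont_fst[OF cont_P1] cont_snd cu cont_D2)
      (use P_nz D_nz in auto)
  then show ?thesis unfolding Ws_def by (rule cont_Y_comp)
qed

section \<open>Return to physical time\<close>

definition "T s = integral {0..s} P"

lemma dT: "s \<in> S \<Longrightarrow> (T has_real_derivative P s) (at s within S)"
  unfolding T_def[abs_def] S_def by (rule integral_Ico_derivative) (use cont_P in \<open>auto simp: S_def\<close>)

lemma T_strict: 
  assumes s: "s \<in> S" and s': "s' \<in> S" and "s < s'"
  shows "T s < T s'"
proof -
  obtain z where "z \<in> S" "T s' - T s = P z * (s' - s)"
    using real_mvt_segment[OF S_convex s s' dT] by blast
  then show ?thesis using P_pos assms(3) by (metis diff_gt_0_iff_gt mult_pos_pos)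
qed

lemma T_inj: "inj_on T S"
  by (intro inj_onI) (metis T_strict linorder_less_linear order_less_irrefl)

lemma T_0 [simp]: "T 0 = 0" by (simp add: T_def)

text \<open>On \<open>S\<close> the denominators satisfy D <= 1 + L/M, so their reciprocals have
  mean at least 1/(1 + L/M). This uniform bound makes the inverse time change Lipschitz.\<close>

lemma P_lower: obtains p0 where "p0 > 0" "\<And>s. s \<in> S \<Longrightarrow> P s \<ge> p0"
proof -
  obtain L where L: "L > 0" "\<And>x. x \<in> Ipi \<Longrightarrow> \<bar>u x\<bar> \<le> L" using abs_u_bound by blast
  have pos: "1 + L / M > 0" using L M by (simp add: add_pos_pos)
  have "P s \<ge> 1 / (1 + L / M)" if s: "s \<in> S" for s
  proof -
    have "integral Ipi (\<lambda>x. 1 / (1 + L / M)) \<le> G s pi"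
      unfolding G_def
    proof (rule integral_le)
      show "(\<lambda>x. 1 / D s x) integrable_on Ipi" by (intro integrable_continuous_real cont_Ds s)
      fix x assume x: "x \<in> Ipi"
      have "s * - u x \<le> s * L" using s L(2)[OF x] by (intro mult_left_mono) (auto simp: S_def)
      also have "\<dots> \<le> 1 / M * L" using s L by (intro mult_right_mono) (auto simp: S_def)
      finally show "1 / (1 + L / M) \<le> 1 / D s x" 
        using D_pos[OF s x] by (intro divide_left_mono) (auto simp: D_def mult_pos_pos pos)
    qed auto
    then have "1 / (1 + L / M) * (2 * pi) \<le> G s pi" by simp
    then show ?thesis by (simp add: P_def pos_le_divide_eq)
  qed
  then show ?thesis using that pos by (meson divide_pos_pos zero_less_one)
qed

text \<open>\<open>T\<close> is the physical time as a function of \<open>s\<close>, and \<open>\<sigma>\<close> its inverse.\<close>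

definition "\<sigma> t = inv_into S T t"

lemma sigma:
  assumes "T ` S = {0..<c}" "t \<in> {0..<c}"
  shows "\<sigma> t \<in> S" "T (\<sigma> t) = t"
  using assms by (auto simp: \<sigma>_def inv_into_into f_inv_into_f)

lemma sigma_T: "s \<in> S \<Longrightarrow> \<sigma> (T s) = s"
  by (simp add: \<sigma>_def T_inj)

text \<open>\<open>P_lower\<close> supplies the continuity of \<open>\<sigma>\<close> that implicit
  differentiation of \<open>T s - t = 0\<close> presupposes.\<close>

lemma sigma_deriv:
  assumes im: "T ` S = {0..<c}" and t: "t \<in> {0..<c}"
  shows "(\<sigma> has_real_derivative 1 / P (\<sigma> t)) (at t within {0..<c})"
proof -
  have "(\<sigma> has_real_derivative - (-1) / P (\<sigma> t)) (at t within {0..<c})"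
  proof (rule implicit_real_derivative[where C = S and H = "\<lambda>t s. T s - t" and H' = "\<lambda>t s. P s"])
    show "((\<lambda>s. T s - r) has_real_derivative P a) (at a within S)" if "a \<in> S" for r a
      using DERIV_diff[OF dT[OF that] DERIV_const] by simp
    show "continuous_on ({0..<c} \<times> S) (\<lambda>p. P (snd p))"
      by (rule continuous_on_compose2[OF cont_P]) (auto intro: continuous_intros)
    show "((\<lambda>r. T (\<sigma> t) - r) has_real_derivative - 1) (at t within {0..<c})"
      by (auto intro!: derivative_eq_intros)
    obtain p0 where p0: "p0 > 0" "\<And>s. s \<in> S \<Longrightarrow> P s \<ge> p0" using P_lower by blast
    have le: "\<bar>\<sigma> r - \<sigma> t\<bar> \<le> \<bar>r - t\<bar> / p0" if r: "r \<in> {0..<c}" for r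
    proof -
      obtain z where z: "z \<in> S" "T (\<sigma> r) - T (\<sigma> t) = P z * (\<sigma> r - \<sigma> t)"
        using real_mvt_segment[OF S_convex sigma(1)[OF im t] sigma(1)[OF im r] dT] by blast
      have "\<bar>\<sigma> r - \<sigma> t\<bar> * p0 \<le> \<bar>\<sigma> r - \<sigma> t\<bar> * P z" using p0(2)[OF z(1)] by (intro mult_left_mono) auto
      also have "\<dots> = \<bar>r - t\<bar>" using z P_pos[OF z(1)] sigma(2)[OF im t] sigma(2)[OF im r]
        by (simp add: abs_mult)
      finally show ?thesis using p0 by (simp add: pos_le_divide_eq)
    qed
    have "((\<lambda>r. \<bar>r - t\<bar> / p0) \<longlongrightarrow> \<bar>t - t\<bar> / p0) (at t within {0..<c})"
      using p0 by (intro tendsto_intros) auto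
    then have lim: "((\<lambda>r. \<bar>r - t\<bar> / p0) \<longlongrightarrow> 0) (at t within {0..<c})" by simp
    have "\<forall>\<^sub>F r in at t within {0..<c}. norm (\<sigma> r - \<sigma> t) \<le> \<bar>r - t\<bar> / p0"
      unfolding eventually_at_filter using le by (intro always_eventually) auto
    from Lim_null_comparison[OF this lim] show "(\<sigma> \<longlongrightarrow> \<sigma> t) (at t within {0..<c})" by (simp add: LIM_zero_iff)
  qed (use t sigma[OF im] P_pos S_convex in auto)
  then show ?thesis by simp
qed

definition "sol t x = W 0 (\<sigma> t) x"

lemma Dx_W: "s \<in> S \<Longrightarrow> j \<le> 3 \<Longrightarrow> x \<in> Ipi \<Longrightarrow> Dx j (W 0 s) x = W j s x"
  using Dx_eq[of "W 0 s" "\<lambda>j. W j s" 3] dW_x by auto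

lemma Ck_on_W: "s \<in> S \<Longrightarrow> Ck_on 3 (W 0 s)"
  by (rule Ck_onI[of _ "\<lambda>j. W j s"]) (auto intro: dW_x W_cont_x)

text \<open>The lifespan \<open>c\<close> stays abstract: whether the integral of \<open>P\<close>
  converges is a question about the maximum of \<open>u\<close>, settled only in
  \<open>ipm_peak\<close>.\<close>

lemma is_sol_sol:
  assumes im: "T ` S = {0..<c}"
  shows "is_sol c u sol"
proof -
  have c: "c > 0" using zero_S im T_0 by (metis atLeastLessThan_iff imageI order.strict_trans1)
  have sol_eq: "sol t = W 0 (\<sigma> t)" for t by (auto simp: sol_def)
  have \<sigma>_cont: "continuous_on {0..<c} \<sigma>"
    using sigma_deriv[OF im] by (meson DERIV_continuous continuous_on_eq_continuous_within)
  have comp: "continuous_on ({0..<c} \<times> Ipi) (\<lambda>p. g (\<sigma> (fst p)) (snd p))"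
    if "continuous_on (S \<times> Ipi) (\<lambda>p. g (fst p) (snd p))" for g :: "real \<Rightarrow> real \<Rightarrow> real"
  proof -
    have "continuous_on ({0..<c} \<times> Ipi) (\<lambda>p. \<sigma> (fst p))"
      by (rule continuous_on_compose2[OF \<sigma>_cont]) (auto intro: continuous_intros)
    then show ?thesis
      using continuous_on_compose2[OF that, of "{0..<c} \<times> Ipi" "\<lambda>p. (\<sigma> (fst p), snd p)"] sigma[OF im]
      by (force intro: continuous_intros)
  qed
  have dt: "((\<lambda>t. sol t x) has_real_derivative Ws (\<sigma> t) x / P (\<sigma> t)) (at t within {0..<c})"
    if "t \<in> {0..<c}" "x \<in> Ipi" for t x
    using real_chain_within[OF dW_s sigma_deriv[OF im that(1)], of x] sigma[OF im] that
    by (force simp: sol_def)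
  then have Dt: "Dt c sol t x = Ws (\<sigma> t) x / P (\<sigma> t)" if "t \<in> {0..<c}" "x \<in> Ipi" for t x
    unfolding Dt_def using that Ico_not_bot[of t c]
    by (intro vector_derivative_within) (auto simp: has_real_derivative_iff_has_vector_derivative)
  have \<sigma>0: "\<sigma> 0 = 0" using sigma_T[OF zero_S] by simp
  \<comment> \<open>Here the zero mean of the data enters: at \<open>s = 0\<close> all denominators
    are 1 and \<open>G1 0 pi\<close> is the integral of \<open>u\<close>. So \<open>B\<close> is
    exactly the primitive of \<open>A\<close> that starts from 0.\<close>
  have B0: "B 0 = 0" using mean by (simp add: B_def P1_def G1_def D_def)
  have dB': "((\<lambda>t. B (\<sigma> t)) has_real_derivative A (\<sigma> t)) (at t within {0..<c})" if "t \<in> {0..<c}" for t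
  proof -
    have "((\<lambda>t. B (\<sigma> t)) has_real_derivative P (\<sigma> t) * A (\<sigma> t) * (1 / P (\<sigma> t))) (at t within {0..<c})"
      by (rule real_chain_within[OF dB sigma_deriv[OF im that]]) (use sigma[OF im] that in auto)
    then show ?thesis using P_nz[OF sigma(1)[OF im that]] by simp
  qed
  have intA: "integral {0..t} (\<lambda>s. integral Ipi (\<lambda>y. (sol s y)\<^sup>2)) = pi * B (\<sigma> t)" if t: "t \<in> {0..<c}" for t
  proof -
    have "((\<lambda>t. pi * A (\<sigma> t)) has_integral pi * B (\<sigma> t) - pi * B (\<sigma> 0)) {0..t}"
      by (rule real_FTC[where A = "{0..<c}"], use t in simp, use t in force, rule DERIV_cmult[OF dB'])
        (use t in auto)
    then have "((\<lambda>s. integral Ipi (\<lambda>y. (sol s y)\<^sup>2)) has_integral pi * B (\<sigma> t)) {0..t}"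
      by (rule has_integral_eq[rotated, OF has_integral_eq_rhs])
        (use t integral_W2 sigma(1)[OF im] in \<open>auto simp: \<sigma>0 B0 sol_def\<close>)
    then show ?thesis by (rule integral_unique)
  qed
  show ?thesis
    unfolding is_sol_def
  proof (intro conjI ballI allI impI)
    fix j :: nat assume j: "j \<le> 3"
    show "continuous_on ({0..<c} \<times> Ipi) (\<lambda>p. Dx j (sol (fst p)) (snd p))"
      by (rule continuous_on_eq[OF comp[OF W_cont[of j]]])
        (use Dx_W j sigma[OF im] in \<open>auto simp: sol_eq\<close>)
  next
    fix t x assume tx: "t \<in> {0..<c}" "x \<in> Ipi"
    show "((\<lambda>s. sol s x) has_vector_derivative Dt c sol t x) (at t within {0..<c})"
      using dt[OF tx] Dt[OF tx] by (simp add: has_real_derivative_iff_has_vector_derivative)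
    define s where "s = \<sigma> t"
    define a where "a = Y s x"
    have s: "s \<in> S" using sigma[OF im tx(1)] by (simp add: s_def)
    have a: "a \<in> Ipi" using Y_Ipi[OF s tx(2)] by (simp add: a_def)
    \<comment> \<open>The transport term of the equation, velocity times \<open>E 1\<close>, cancels
      the one hidden in \<open>Ws\<close>, leaving the identity \<open>riccati\<close>.\<close>
    have "Ws s x / P s + Xs s a / P s * E 1 s a = Fs s a / P s"
      using P_nz[OF s] by (simp add: Ws_def a_def field_simps)
    then show "Dt c sol t x + integral {-pi..x} (sol t) * Dx 1 (sol t) x - (sol t x)\<^sup>2
            + (1/pi) * integral Ipi (\<lambda>y. (sol t y)\<^sup>2)
          = (1/pi) * integral {0..t} (\<lambda>s. integral Ipi (\<lambda>y. (sol s y)\<^sup>2)) * sol t x"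
      using riccati[OF s a] Dx_W[OF s _ tx(2), of 1] intA[OF tx(1)] integral_W2[OF s] integral_W[OF s tx(2)]
      unfolding Dt[OF tx] sol_eq by (simp add: s_def[symmetric] a_def[symmetric] W_def)
  next
    show "continuous_on ({0..<c} \<times> Ipi) (\<lambda>p. Dt c sol (fst p) (snd p))"
    proof (rule continuous_on_eq)
      have "continuous_on (S \<times> Ipi) (\<lambda>p. Ws (fst p) (snd p) / P (fst p))"
        by (intro continuous_intros Ws_cont cont_fst[OF cont_P]) (use P_nz in auto)
      from comp[OF this] show "continuous_on ({0..<c} \<times> Ipi) (\<lambda>p. Ws (\<sigma> (fst p)) (snd p) / P (\<sigma> (fst p)))" .
    qed (use Dt in auto)
  next
    fix x assume x: "x \<in> Ipi"
    have G0: "G 0 a = a + pi" if "a \<in> Ipi" for a using that by (simp add: G_def D_def)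
    then have P0: "P 0 = 1" by (simp add: P_def)
    have "X 0 x = x" using G0[OF x] P0 by (simp add: X_def)
    then have "Y 0 x = x" using Y_X[OF zero_S x] by simp
    then show "sol 0 x = u x" using B0 P0 by (simp add: sol_def \<sigma>0 W_def E_def D_def B_def)
  qed (use c sigma[OF im] Ck_on_W mean_W in \<open>auto simp: sol_eq\<close>)
qed

end

section \<open>Uniqueness\<close>

locale classical_sol =
  fixes t :: real and b bx bt :: "real \<Rightarrow> real \<Rightarrow> real"
  assumes cb: "continuous_on ({0..t} \<times> Ipi) (\<lambda>p. b (fst p) (snd p))"
    and cbx: "continuous_on ({0..t} \<times> Ipi) (\<lambda>p. bx (fst p) (snd p))"
    and cbt: "continuous_on ({0..t} \<times> Ipi) (\<lambda>p. bt (fst p) (snd p))"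
    and dx: "\<And>s x. s \<in> {0..t} \<Longrightarrow> x \<in> Ipi \<Longrightarrow> (b s has_real_derivative bx s x) (at x within Ipi)"
    and dt: "\<And>s x. s \<in> {0..t} \<Longrightarrow> x \<in> Ipi \<Longrightarrow> ((\<lambda>s. b s x) has_real_derivative bt s x) (at s within {0..t})"
    and mean: "\<And>s. s \<in> {0..t} \<Longrightarrow> integral Ipi (b s) = 0"
begin

definition "f s x = integral {-pi..x} (b s)"
text \<open>Unlike the functions of the same names for the explicit solution, \<open>A\<close> and
  \<open>B\<close> carry no factor 1/pi here.\<close>

definition "A s = integral Ipi (\<lambda>x. (b s x)\<^sup>2)"
definition "B s = integral {0..s} A"

lemma slice:
  fixes g :: "real \<Rightarrow> real \<Rightarrow> real"
  assumes "continuous_on ({0..t} \<times> Ipi) (\<lambda>p. g (fst p) (snd p))" "s \<in> {0..t}"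
  shows "continuous_on Ipi (g s)"
  using continuous_on_compose2[OF assms(1), of Ipi "\<lambda>x. (s, x)"] assms(2) by (force intro: continuous_intros)

lemma df: "s \<in> {0..t} \<Longrightarrow> x \<in> Ipi \<Longrightarrow> (f s has_real_derivative b s x) (at x within Ipi)"
  unfolding f_def[abs_def] by (rule integral_has_real_derivative) (use slice[OF cb] in auto)

lemma f_ends: "f s (-pi) = 0" "s \<in> {0..t} \<Longrightarrow> f s pi = 0"
  using mean by (auto simp: f_def)

lemma cA: "continuous_on {0..t} A"
proof -
  have "continuous_on {0..t} (\<lambda>s. integral (cbox (-pi) pi) (\<lambda>x. (b s x)\<^sup>2))"
    by (rule integral_continuous_on_param) (auto simp: case_prod_beta intro!: continuous_intros cb)
  then show ?thesis by (simp add: A_def[abs_def])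
qed

lemma dB: "s \<in> {0..t} \<Longrightarrow> (B has_real_derivative A s) (at s within {0..t})"
  unfolding B_def[abs_def] by (rule integral_has_real_derivative[OF cA])

lemma bound: obtains K where "K > 0" "\<And>s x. s \<in> {0..t} \<Longrightarrow> x \<in> Ipi \<Longrightarrow> \<bar>b s x\<bar> \<le> K"
   "\<And>s x. s \<in> {0..t} \<Longrightarrow> x \<in> Ipi \<Longrightarrow> \<bar>bx s x\<bar> \<le> K" "\<And>s. s \<in> {0..t} \<Longrightarrow> \<bar>B s / pi\<bar> \<le> K"
proof -
  have comp: "compact ({0..t} \<times> Ipi)" by (intro compact_Times) auto
  obtain K1 where K1: "K1 > 0" "\<And>p. p \<in> {0..t} \<times> Ipi \<Longrightarrow> \<bar>b (fst p) (snd p)\<bar> \<le> K1"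
    using continuous_compact_abs_bound[OF comp cb] by blast
  obtain K2 where K2: "K2 > 0" "\<And>p. p \<in> {0..t} \<times> Ipi \<Longrightarrow> \<bar>bx (fst p) (snd p)\<bar> \<le> K2"
    using continuous_compact_abs_bound[OF comp cbx] by blast
  have "continuous_on {0..t} (\<lambda>s. B s / pi)"
    using dB by (intro continuous_intros) (auto intro: DERIV_continuous[OF dB] simp: continuous_on_eq_continuous_within)
  then obtain K3 where K3: "K3 > 0" "\<And>s. s \<in> {0..t} \<Longrightarrow> \<bar>B s / pi\<bar> \<le> K3"
    using continuous_compact_abs_bound[of "{0..t}" "\<lambda>s. B s / pi"] by auto
  show ?thesis
  proof (rule that[of "K1 + K2 + K3"])
    fix s x assume sx: "s \<in> {0..t}" "x \<in> Ipi"
    then have p: "(s, x) \<in> {0..t} \<times> Ipi" by auto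
    show "\<bar>b s x\<bar> \<le> K1 + K2 + K3" using K1(2)[OF p] K2(1) K3(1) by simp
    show "\<bar>bx s x\<bar> \<le> K1 + K2 + K3" using K2(2)[OF p] K1(1) K3(1) by simp
  next
    fix s assume "s \<in> {0..t}"
    then show "\<bar>B s / pi\<bar> \<le> K1 + K2 + K3" using K3(2)[of s] K1(1) K2(1) by simp
  qed (use K1(1) K2(1) K3(1) in simp)
qed

end

section \<open>Energy estimate for the difference of two solutions\<close>

text \<open>Cauchy-Schwarz against the constant 1, from integrating the square of
  \<open>\<bar>d x\<bar>\<close> minus its mean.\<close>

lemma integral_abs_square_le:
  fixes d :: "real \<Rightarrow> real"
  assumes "continuous_on Ipi d"
  shows "(integral Ipi (\<lambda>x. \<bar>d x\<bar>))\<^sup>2 \<le> 2 * pi * integral Ipi (\<lambda>x. (d x)\<^sup>2)"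
proof -
  define a where "a = integral Ipi (\<lambda>x. \<bar>d x\<bar>)"
  define e where "e = integral Ipi (\<lambda>x. (d x)\<^sup>2)"
  have i: "((\<lambda>x. \<bar>d x\<bar>) has_integral a) Ipi" "((\<lambda>x. (d x)\<^sup>2) has_integral e) Ipi"
    unfolding a_def e_def by (intro integrable_integral integrable_continuous_real continuous_intros assms)+
  have c: "((\<lambda>x. (a / (2 * pi))\<^sup>2) has_integral (a / (2 * pi))\<^sup>2 * (2 * pi)) Ipi"
    using has_integral_const_real[of "(a / (2 * pi))\<^sup>2" "-pi" pi] by (simp add: mult.commute)
  have "((\<lambda>x. (d x)\<^sup>2 - \<bar>d x\<bar> * (a / pi) + (a / (2 * pi))\<^sup>2) has_integral
      e - a * (a / pi) + (a / (2 * pi))\<^sup>2 * (2 * pi)) Ipi"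
    by (intro has_integral_add has_integral_diff has_integral_mult_left i c)
  moreover have "(d x)\<^sup>2 - \<bar>d x\<bar> * (a / pi) + (a / (2 * pi))\<^sup>2 \<ge> 0" for x
  proof -
    have "(d x)\<^sup>2 - \<bar>d x\<bar> * (a / pi) + (a / (2 * pi))\<^sup>2 = (\<bar>d x\<bar> - a / (2 * pi))\<^sup>2"
      unfolding power2_diff by (simp add: field_simps)
    then show ?thesis by simp
  qed
  ultimately have "0 \<le> e - a * (a / pi) + (a / (2 * pi))\<^sup>2 * (2 * pi)"
    using has_integral_nonneg by blast
  also have "\<dots> = e - a\<^sup>2 / (2 * pi)" by (simp add: field_simps power2_eq_square)
  finally show ?thesis unfolding a_def[symmetric] e_def[symmetric] by (simp add: field_simps)
qed

text \<open>The memory term makes the difference of the functions \<open>B\<close> a second unknown,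
  and its derivative is controlled by the L^1 norm of \<open>d\<close>. Together with the energy of
  \<open>d\<close> it satisfies a closed inequality.\<close>

lemma classical_sol_unique:
  assumes s1: "classical_sol t b bx bt" and s2: "classical_sol t b' bx' bt'"
    and init: "\<And>x. x \<in> Ipi \<Longrightarrow> b 0 x = b' 0 x"
    and eq1: "\<And>s x. s \<in> {0..t} \<Longrightarrow> x \<in> Ipi \<Longrightarrow>
      bt s x + classical_sol.f b s x * bx s x - (b s x)\<^sup>2 + classical_sol.A b s / pi = classical_sol.B b s / pi * b s x"
    and eq2: "\<And>s x. s \<in> {0..t} \<Longrightarrow> x \<in> Ipi \<Longrightarrow>
      bt' s x + classical_sol.f b' s x * bx' s x - (b' s x)\<^sup>2 + classical_sol.A b' s / pi = classical_sol.B b' s / pi * b' s x"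
    and t: "0 \<le> t" and x: "x \<in> Ipi"
  shows "b t x = b' t x"
proof -
  interpret b: classical_sol t b bx bt by (rule s1)
  interpret b': classical_sol t b' bx' bt' by (rule s2)
  define d where "d s x = b' s x - b s x" for s x
  define dt where "dt s x = bt' s x - bt s x" for s x
  define E where "E s = integral Ipi (\<lambda>x. (d s x)\<^sup>2)" for s
  define \<beta> where "\<beta> s = (b'.B s - b.B s) / pi" for s
  define a where "a s = integral Ipi (\<lambda>x. \<bar>d s x\<bar>)" for s
  obtain K1 where K1: "K1 > 0" "\<And>s x. s \<in> {0..t} \<Longrightarrow> x \<in> Ipi \<Longrightarrow> \<bar>b s x\<bar> \<le> K1"
   "\<And>s x. s \<in> {0..t} \<Longrightarrow> x \<in> Ipi \<Longrightarrow> \<bar>bx s x\<bar> \<le> K1" "\<And>s. s \<in> {0..t} \<Longrightarrow> \<bar>b.B s / pi\<bar> \<le> K1"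
    using b.bound by blast
  obtain K2 where K2: "K2 > 0" "\<And>s x. s \<in> {0..t} \<Longrightarrow> x \<in> Ipi \<Longrightarrow> \<bar>b' s x\<bar> \<le> K2"
   "\<And>s x. s \<in> {0..t} \<Longrightarrow> x \<in> Ipi \<Longrightarrow> \<bar>bx' s x\<bar> \<le> K2" "\<And>s. s \<in> {0..t} \<Longrightarrow> \<bar>b'.B s / pi\<bar> \<le> K2"
    using b'.bound by blast
  define K where "K = K1 + K2"
  have K: "K > 0" using K1(1) K2(1) by (simp add: K_def)
  have Kb: "\<bar>b s x\<bar> \<le> K" "\<bar>b' s x\<bar> \<le> K" "\<bar>bx s x\<bar> \<le> K" "\<bar>b'.B s / pi\<bar> \<le> K" if "s \<in> {0..t}" "x \<in> Ipi" for s x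
    using K1(2,3)[OF that] K2(2)[OF that] K2(4)[OF that(1)] K1(1) K2(1) unfolding K_def by linarith+
  have cd2: "continuous_on ({0..t} \<times> Ipi) (\<lambda>p. d (fst p) (snd p))"
    and cdt2: "continuous_on ({0..t} \<times> Ipi) (\<lambda>p. dt (fst p) (snd p))"
    unfolding d_def dt_def by (intro continuous_intros b.cb b'.cb b.cbt b'.cbt)+
  note cd = b.slice[OF cd2] and cdt = b.slice[OF cdt2]
  have ib: "b s integrable_on Ipi" "b' s integrable_on Ipi" if "s \<in> {0..t}" for s
    using b.slice[OF b.cb that] b'.slice[OF b'.cb that] integrable_continuous_real by blast+
  have Ed: "(E has_real_derivative integral Ipi (\<lambda>x. 2 * d s x * dt s x)) (at s within {0..t})"
    if s: "s \<in> {0..t}" for s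
    unfolding E_def[abs_def]
  proof (rule leibniz_real[where h = "\<lambda>s x. (d s x)\<^sup>2" and h' = "\<lambda>s x. 2 * d s x * dt s x"])
    show "((\<lambda>s. (d s x)\<^sup>2) has_real_derivative 2 * d s x * dt s x) (at s within {0..t})"
      if "s \<in> {0..t}" "x \<in> Ipi" for s x
    proof -
      have "((\<lambda>s. d s x) has_real_derivative dt s x) (at s within {0..t})"
        unfolding d_def dt_def by (intro DERIV_diff b.dt b'.dt that)
      from DERIV_power[OF this, of 2] show ?thesis by (simp add: ac_simps)
    qed
    show "continuous_on ({0..t} \<times> Ipi) (\<lambda>p. 2 * d (fst p) (snd p) * dt (fst p) (snd p))"
      by (intro continuous_intros cd2 cdt2)
  qed (use s cd in \<open>auto intro: continuous_intros\<close>)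
  have \<beta>d: "(\<beta> has_real_derivative (b'.A s - b.A s) / pi) (at s within {0..t})" if "s \<in> {0..t}" for s
    unfolding \<beta>_def[abs_def] by (intro DERIV_cdivide DERIV_diff b.dB b'.dB that)
  have a2: "(a s)\<^sup>2 \<le> 2 * pi * E s" if "s \<in> {0..t}" for s
    unfolding a_def E_def by (rule integral_abs_square_le[OF cd[OF that]])
  have a_nn: "a s \<ge> 0" if "s \<in> {0..t}" for s
    unfolding a_def by (rule integral_nonneg) (auto intro!: integrable_continuous_real continuous_intros cd that)
  have E_nn: "E s \<ge> 0" if "s \<in> {0..t}" for s
    unfolding E_def by (rule integral_nonneg) (auto intro!: integrable_continuous_real continuous_intros cd that)
  have ia: "((\<lambda>x. \<bar>d s x\<bar>) has_integral a s) Ipi" "((\<lambda>x. (d s x)\<^sup>2) has_integral E s) Ipi" if "s \<in> {0..t}" for s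
    unfolding a_def E_def by (intro integrable_integral integrable_continuous_real continuous_intros cd that)+
  have id0: "(d s has_integral 0) Ipi" if "s \<in> {0..t}" for s
    using has_integral_diff[OF integrable_integral[OF ib(2)[OF that]] integrable_integral[OF ib(1)[OF that]]]
      b.mean[OF that] b'.mean[OF that] by (simp add: d_def[abs_def])
  have fd: "\<bar>b'.f s x - b.f s x\<bar> \<le> a s" if s: "s \<in> {0..t}" and x: "x \<in> Ipi" for s x
  proof -
    have sub: "{-pi..x} \<subseteq> Ipi" using x by auto
    have i1: "(\<lambda>x. \<bar>d s x\<bar>) integrable_on {-pi..x}" "d s integrable_on {-pi..x}"
      "b s integrable_on {-pi..x}" "b' s integrable_on {-pi..x}"
      using ib[OF s] cd[OF s] sub
      by (auto intro!: integrable_continuous_real continuous_intros b.slice[OF b.cb s] b'.slice[OF b'.cb s]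
            intro: continuous_on_subset)
    have "b'.f s x - b.f s x = integral {-pi..x} (d s)"
      unfolding b.f_def b'.f_def d_def using i1 by (simp add: integral_diff)
    also have "\<bar>\<dots>\<bar> \<le> integral {-pi..x} (\<lambda>x. \<bar>d s x\<bar>)"
      using integral_norm_bound_integral[OF i1(2,1)] by simp
    also have "\<dots> \<le> a s" unfolding a_def
      by (rule integral_subset_le[OF sub i1(1)]) (use ia(1)[OF s] in auto)
    finally show ?thesis .
  qed
  have mainE: "integral Ipi (\<lambda>x. 2 * d s x * dt s x) \<le> 7 * K * E s + 2 * K * (a s)\<^sup>2 + 2 * K * \<bar>\<beta> s\<bar> * a s"
    if s: "s \<in> {0..t}" for s
  proof -
    \<comment> \<open>The derivative of \<open>b'.f s x * (d s x)\<^sup>2\<close>, which vanishes at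
      both ends by the zero mean of \<open>b'\<close>.\<close>
    define h where "h x = b' s x * (d s x)\<^sup>2 + b'.f s x * (2 * d s x * (bx' s x - bx s x))" for x
    have ih: "(h has_integral 0) Ipi"
    proof -
      have "(h has_integral (b'.f s pi * (d s pi)\<^sup>2 - b'.f s (-pi) * (d s (-pi))\<^sup>2)) Ipi"
      proof (rule real_FTC[where A = Ipi])
        fix x assume x: "x \<in> Ipi"
        have "(d s has_real_derivative bx' s x - bx s x) (at x within Ipi)"
          unfolding d_def[abs_def] by (intro DERIV_diff b.dx b'.dx s x)
        from DERIV_mult[OF b'.df[OF s x] DERIV_power[OF this, of 2]]
        show "((\<lambda>x. b'.f s x * (d s x)\<^sup>2) has_real_derivative h x) (at x within Ipi)"
          by (simp add: h_def ac_simps)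
      qed auto
      then show ?thesis using b'.f_ends s by simp
    qed
    \<comment> \<open>Two vanishing integrals are added to the energy derivative: \<open>h\<close>
      removes the spatial derivative of \<open>d\<close>, and the multiple of \<open>d\<close>, of
      zero mean, removes the difference of the quadratic nonlocal terms.\<close>
    have ig: "((\<lambda>x. 2 * d s x * dt s x + h x + (2 * (b'.A s - b.A s) / pi) * d s x) has_integral
        integral Ipi (\<lambda>x. 2 * d s x * dt s x) + 0 + (2 * (b'.A s - b.A s) / pi) * 0) Ipi"
      by (intro has_integral_add ih has_integral_mult_right id0 s integrable_integral
          integrable_continuous_real continuous_intros cd cdt)
    have iu: "((\<lambda>x. (d s x)\<^sup>2 * (7 * K) + \<bar>d s x\<bar> * (2 * K * a s) + \<bar>d s x\<bar> * (2 * K * \<bar>\<beta> s\<bar>)) has_integral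
        E s * (7 * K) + a s * (2 * K * a s) + a s * (2 * K * \<bar>\<beta> s\<bar>)) Ipi"
      by (intro has_integral_add has_integral_mult_left ia s)
    have "integral Ipi (\<lambda>x. 2 * d s x * dt s x) + 0 + (2 * (b'.A s - b.A s) / pi) * 0
      \<le> E s * (7 * K) + a s * (2 * K * a s) + a s * (2 * K * \<bar>\<beta> s\<bar>)"
    proof (rule has_integral_le[OF ig iu])
      fix x assume x: "x \<in> Ipi"
      define F where "F = b'.f s x - b.f s x"
      define q where "q = b' s x + 2 * (b' s x + b s x) + 2 * (b'.B s / pi)"
      have e: "dt s x = - b'.f s x * (bx' s x - bx s x) - F * bx s x + (b' s x + b s x) * d s x
         - (b'.A s - b.A s) / pi + b'.B s / pi * d s x + \<beta> s * b s x"
        using eq1[OF s x] eq2[OF s x] unfolding dt_def F_def \<beta>_def d_def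
        by (simp add: algebra_simps power2_eq_square diff_divide_distrib)
      have "2 * d s x * dt s x + h x + (2 * (b'.A s - b.A s) / pi) * d s x
         = q * (d s x)\<^sup>2 + - (2 * F * bx s x * d s x) + 2 * \<beta> s * b s x * d s x"
        unfolding h_def e q_def by (simp add: algebra_simps power2_eq_square diff_divide_distrib)
      also have "q * (d s x)\<^sup>2 \<le> 7 * K * (d s x)\<^sup>2"
      proof (rule mult_right_mono)
        \<comment> \<open>One \<open>K\<close> from \<open>b'\<close>, four from
          \<open>2 * (b' + b)\<close>, two from the memory term.\<close>
        show "q \<le> 7 * K" using Kb(1,2,4)[OF s x, THEN abs_le_D1] unfolding q_def by argo
      qed simp
      also have "- (2 * F * bx s x * d s x) \<le> 2 * a s * K * \<bar>d s x\<bar>"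
      proof -
        have "\<bar>F * bx s x * d s x\<bar> \<le> a s * K * \<bar>d s x\<bar>"
          unfolding abs_mult using Kb[OF s x] fd[OF s x] a_nn[OF s]
          by (intro mult_right_mono mult_mono) (auto simp: F_def)
        then show ?thesis by linarith
      qed
      also have "2 * \<beta> s * b s x * d s x \<le> 2 * \<bar>\<beta> s\<bar> * K * \<bar>d s x\<bar>"
      proof -
        have "\<bar>\<beta> s * b s x * d s x\<bar> \<le> \<bar>\<beta> s\<bar> * K * \<bar>d s x\<bar>"
          unfolding abs_mult using Kb[OF s x] by (intro mult_right_mono mult_mono) auto
        then show ?thesis by linarith
      qed
      finally show "2 * d s x * dt s x + h x + (2 * (b'.A s - b.A s) / pi) * d s x
         \<le> (d s x)\<^sup>2 * (7 * K) + \<bar>d s x\<bar> * (2 * K * a s) + \<bar>d s x\<bar> * (2 * K * \<bar>\<beta> s\<bar>)"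
        by (simp add: ac_simps)
    qed
    then show ?thesis by (simp add: ac_simps power2_eq_square)
  qed
  have Abound: "\<bar>b'.A s - b.A s\<bar> \<le> 2 * K * a s" if s: "s \<in> {0..t}" for s
  proof -
    have "((\<lambda>x. (b' s x)\<^sup>2 - (b s x)\<^sup>2) has_integral b'.A s - b.A s) Ipi"
      unfolding b.A_def b'.A_def
      by (intro has_integral_diff integrable_integral integrable_continuous_real continuous_intros
          b.slice[OF b.cb s] b'.slice[OF b'.cb s])
    then have i: "integral Ipi (\<lambda>x. (b' s x)\<^sup>2 - (b s x)\<^sup>2) = b'.A s - b.A s"
      "(\<lambda>x. (b' s x)\<^sup>2 - (b s x)\<^sup>2) integrable_on Ipi" by (auto simp: integral_unique)
    have ir: "((\<lambda>x. \<bar>d s x\<bar> * (2 * K)) has_integral a s * (2 * K)) Ipi"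
      by (intro has_integral_mult_left ia s)
    have "norm (integral Ipi (\<lambda>x. (b' s x)\<^sup>2 - (b s x)\<^sup>2)) \<le> integral Ipi (\<lambda>x. \<bar>d s x\<bar> * (2 * K))"
    proof (rule integral_norm_bound_integral[OF i(2)])
      fix x assume x: "x \<in> Ipi"
      have "(b' s x)\<^sup>2 - (b s x)\<^sup>2 = d s x * (b' s x + b s x)"
        by (simp add: d_def algebra_simps power2_eq_square)
      moreover have "\<bar>b' s x + b s x\<bar> \<le> 2 * K" using Kb[OF s x] by linarith
      ultimately show "norm ((b' s x)\<^sup>2 - (b s x)\<^sup>2) \<le> \<bar>d s x\<bar> * (2 * K)"
        by (simp add: abs_mult mult_left_mono)
    qed (use ir in auto)
    then show ?thesis unfolding integral_unique[OF ir] i(1) by (simp add: ac_simps)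
  qed
  define H where "H s = E s + (\<beta> s)\<^sup>2" for s
  \<comment> \<open>The Gronwall constant has to dominate \<open>7 * K + 10 * pi * K\<close>, the
    factor of \<open>E\<close>, and \<open>3 * K\<close>, the factor of
    \<open>(\<beta> s)\<^sup>2\<close>, in the estimate below; it does so generously.\<close>
  have "H t = 0"
  proof (rule gronwall_zero[where b = t and t = t and G = H and G' = "\<lambda>s. integral Ipi (\<lambda>x. 2 * d s x * dt s x) + 2 * \<beta> s * ((b'.A s - b.A s) / pi)"
        and C = "7 * K + 6 * pi * K + 6 * K * (2 * pi + 1)"])
    fix s assume s: "s \<in> {0..t}"
    have "((\<lambda>s. E s + (\<beta> s)\<^sup>2) has_real_derivative integral Ipi (\<lambda>x. 2 * d s x * dt s x) + 2 * \<beta> s * ((b'.A s - b.A s) / pi)) (at s within {0..t})"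
      using DERIV_add[OF Ed[OF s] DERIV_power[OF \<beta>d[OF s], of 2]] by (simp add: ac_simps)
    then show "(H has_real_derivative integral Ipi (\<lambda>x. 2 * d s x * dt s x) + 2 * \<beta> s * ((b'.A s - b.A s) / pi)) (at s within {0..t})"
      by (simp add: H_def[abs_def])
    have ab: "2 * (\<bar>\<beta> s\<bar> * a s) \<le> (\<beta> s)\<^sup>2 + (a s)\<^sup>2"
      using sum_squares_bound[of "\<bar>\<beta> s\<bar>" "a s"] by simp
    have "2 * \<beta> s * ((b'.A s - b.A s) / pi) \<le> 2 * \<bar>\<beta> s\<bar> * (2 * K * a s)"
    proof -
      have "\<bar>(b'.A s - b.A s) / pi\<bar> \<le> \<bar>b'.A s - b.A s\<bar>" 
        using pi_gt3 mult_left_mono[of 1 pi "\<bar>b'.A s - b.A s\<bar>"] by (simp add: divide_le_eq)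
      then have "\<bar>\<beta> s * ((b'.A s - b.A s) / pi)\<bar> \<le> \<bar>\<beta> s\<bar> * (2 * K * a s)"
        unfolding abs_mult[of "\<beta> s"] using Abound[OF s] by (intro mult_left_mono) auto
      then show ?thesis by linarith
    qed
    then have "integral Ipi (\<lambda>x. 2 * d s x * dt s x) + 2 * \<beta> s * ((b'.A s - b.A s) / pi)
      \<le> 7 * K * E s + 2 * K * (a s)\<^sup>2 + 3 * K * (2 * (\<bar>\<beta> s\<bar> * a s))"
      using mainE[OF s] by (simp add: ac_simps)
    also have "\<dots> \<le> 7 * K * E s + 2 * K * (a s)\<^sup>2 + 3 * K * ((\<beta> s)\<^sup>2 + (a s)\<^sup>2)"
      using ab K by (intro add_left_mono mult_left_mono) auto
    also have "\<dots> = 7 * K * E s + 5 * K * (a s)\<^sup>2 + 3 * K * (\<beta> s)\<^sup>2" by (simp add: algebra_simps)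
    also have "\<dots> \<le> 7 * K * E s + 5 * K * (2 * pi * E s) + 3 * K * (\<beta> s)\<^sup>2"
      using a2[OF s] K by (intro add_right_mono add_left_mono mult_left_mono) auto
    also have "\<dots> \<le> (7 * K + 6 * pi * K + 6 * K * (2 * pi + 1)) * H s"
    proof -
      have "(7 * K + 6 * pi * K + 6 * K * (2 * pi + 1)) * H s - (7 * K * E s + 5 * K * (2 * pi * E s) + 3 * K * (\<beta> s)\<^sup>2)
        = (8 * pi * K + 6 * K) * E s + (10 * K + 18 * pi * K) * (\<beta> s)\<^sup>2"
        by (simp add: H_def algebra_simps)
      moreover have "\<dots> \<ge> 0" using K E_nn[OF s] by (intro add_nonneg_nonneg mult_nonneg_nonneg) auto
      ultimately show ?thesis by linarith
    qed
    finally show "integral Ipi (\<lambda>x. 2 * d s x * dt s x) + 2 * \<beta> s * ((b'.A s - b.A s) / pi)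
      \<le> (7 * K + 6 * pi * K + 6 * K * (2 * pi + 1)) * H s" .
    show "H s \<ge> 0" using E_nn[OF s] by (simp add: H_def)
  next
    have "E 0 = integral Ipi (\<lambda>x. 0)" unfolding E_def by (rule integral_cong) (simp add: d_def init)
    then show "H 0 = 0" by (simp add: H_def \<beta>_def b.B_def b'.B_def)
  qed (use t in auto)
  then have "E t = 0" using E_nn[of t] t by (simp add: H_def add_nonneg_eq_0_iff)
  moreover have "continuous_on Ipi (\<lambda>x. (d t x)\<^sup>2)" using cd[of t] t by (intro continuous_intros) auto
  ultimately have "(d t x)\<^sup>2 = 0"
    unfolding E_def using integral_eq_0_iff[of "-pi" pi "\<lambda>x. (d t x)\<^sup>2"] x by auto
  then show ?thesis by (simp add: d_def)
qed

lemma is_sol_classical: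
  assumes sol: "is_sol T b0 b" and t: "0 \<le> t" "t < T"
  shows "classical_sol t b (\<lambda>s. Dx 1 (b s)) (Dt T b)"
proof
  have sub: "{0..t} \<subseteq> {0..<T}" using t by auto
  have sub2: "{0..t} \<times> Ipi \<subseteq> {0..<T} \<times> Ipi" using t by auto
  have c: "continuous_on ({0..<T} \<times> Ipi) (\<lambda>p. Dx j (b (fst p)) (snd p))" if "j \<le> 3" for j
    using sol that unfolding is_sol_def by blast
  show "continuous_on ({0..t} \<times> Ipi) (\<lambda>p. b (fst p) (snd p))"
    using continuous_on_subset[OF c[of 0] sub2] by simp
  show "continuous_on ({0..t} \<times> Ipi) (\<lambda>p. Dx 1 (b (fst p)) (snd p))"
    using continuous_on_subset[OF c[of 1] sub2] by simp
  show "continuous_on ({0..t} \<times> Ipi) (\<lambda>p. Dt T b (fst p) (snd p))"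
    using sol sub2 unfolding is_sol_def by (blast intro: continuous_on_subset)
  fix s x assume s: "s \<in> {0..t}" 
  then have sT: "s \<in> {0..<T}" using sub by auto
  then show "integral Ipi (b s) = 0" using sol unfolding is_sol_def by blast
  assume x: "x \<in> Ipi"
  have "Ck_on 3 (b s)" using sol sT unfolding is_sol_def by blast
  from Ck_onD[OF this, of 0 x] show "(b s has_real_derivative Dx 1 (b s) x) (at x within Ipi)" using x by simp
  have "((\<lambda>s. b s x) has_vector_derivative Dt T b s x) (at s within {0..<T})"
    using sol sT x unfolding is_sol_def by blast
  then show "((\<lambda>s. b s x) has_real_derivative Dt T b s x) (at s within {0..t})"
    by (auto simp: has_real_derivative_iff_has_vector_derivative intro: has_vector_derivative_within_subset[OF _ sub])
qed

text \<open>Compare on \<open>{0..t}\<close>, strictly before either lifespan ends: compactness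
  there bounds both solutions and their derivatives.\<close>

lemma is_sol_unique:
  assumes sol: "is_sol T b0 b" and sol': "is_sol T' b0 b'" and t: "0 \<le> t" "t < T" "t < T'" and x: "x \<in> Ipi"
  shows "b t x = b' t x"
proof -
  note c = is_sol_classical[OF sol t(1,2)] is_sol_classical[OF sol' t(1,3)]
  show ?thesis
  proof (rule classical_sol_unique[OF c])
    show "b 0 x = b' 0 x" if "x \<in> Ipi" for x using sol sol' that unfolding is_sol_def by metis
  next
    fix s x assume s: "s \<in> {0..t}" and x: "x \<in> Ipi"
    show "Dt T b s x + classical_sol.f b s x * Dx 1 (b s) x - (b s x)\<^sup>2 + classical_sol.A b s / pi = classical_sol.B b s / pi * b s x"
      using sol s t x
      unfolding is_sol_def classical_sol.f_def[OF c(1)] classical_sol.A_def[OF c(1), abs_def] classical_sol.B_def[OF c(1)] by auto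
    show "Dt T' b' s x + classical_sol.f b' s x * Dx 1 (b' s) x - (b' s x)\<^sup>2 + classical_sol.A b' s / pi = classical_sol.B b' s / pi * b' s x"
      using sol' s t x
      unfolding is_sol_def classical_sol.f_def[OF c(2)] classical_sol.A_def[OF c(2), abs_def] classical_sol.B_def[OF c(2)] by auto
  qed (use t x in auto)
qed

section \<open>Asymptotics at a nondegenerate maximum\<close>

lemma cos_lipschitz: "\<bar>cos x - cos y\<bar> \<le> \<bar>x - y\<bar>" for x y :: real
proof -
  obtain z where "cos x - cos y = - sin z * (x - y)"
    using real_mvt_segment[of UNIV y x cos "\<lambda>z. - sin z"] by (auto simp: DERIV_cos)
  then show ?thesis using mult_right_mono[OF abs_sin_le_one[of z], of "\<bar>x - y\<bar>"] by (simp add: abs_mult)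
qed

lemma sin_lipschitz: "\<bar>sin x - sin y\<bar> \<le> \<bar>x - y\<bar>" for x y :: real
  using cos_lipschitz[of "pi / 2 - x" "pi / 2 - y"] by (simp add: cos_diff abs_minus_commute)

text \<open>The remainder has exponent -3/4 > -1, so it cannot offset the leading term.\<close>

lemma rescale_limit:
  fixes C c :: real
  shows "filterlim (\<lambda>t. 1 / (c - t) - C * (c - t) powr (-3/4)) at_top (at_left c)"
proof -
  have "filterlim (\<lambda>x::real. 1 / x - C * x powr (-3/4)) at_top (at_right 0)" by real_asymp
  moreover have "filterlim (\<lambda>t. c - t) (at_right 0) (at_left c)"
    unfolding filterlim_at
    by (auto intro!: tendsto_eq_intros simp: eventually_at_filter)
  ultimately show ?thesis by (rule filterlim_compose)
qed

lemma arctan_bound: "x > 0 \<Longrightarrow> \<bar>pi / 2 - arctan x\<bar> \<le> 1 / x" for x :: real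
proof -
  assume x: "x > 0"
  have "pi / 2 - arctan x = arctan (1 / x)" using arctan_inverse[of x] x by (simp add: inverse_eq_divide)
  moreover have "arctan (1 / x) \<le> 1 / x" using arctan_le_self[of "1 / x"] x by simp
  moreover have "arctan (1 / x) > 0" using x by (simp add: zero_less_arctan_iff)
  ultimately show ?thesis by simp
qed

lemma cos_double_arctan: "cos (2 * arctan v) = (1 - v\<^sup>2) / (1 + v\<^sup>2)"
  and sin_double_arctan: "sin (2 * arctan v) = 2 * v / (1 + v\<^sup>2)" for v :: real
proof -
  have p: "1 + v\<^sup>2 > 0" by (simp add: add_pos_nonneg)
  have c: "(cos (arctan v))\<^sup>2 = 1 / (1 + v\<^sup>2)" using p by (simp add: cos_arctan power_divide)
  have s: "sin (arctan v) = v * cos (arctan v)" by (simp add: cos_arctan sin_arctan)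
  show "cos (2 * arctan v) = (1 - v\<^sup>2) / (1 + v\<^sup>2)"
    unfolding cos_double s power_mult_distrib c by (simp add: diff_divide_distrib)
  have "sin (2 * arctan v) = 2 * v * (cos (arctan v))\<^sup>2"
    unfolding sin_double s by (simp add: power2_eq_square)
  then show "sin (2 * arctan v) = 2 * v / (1 + v\<^sup>2)" unfolding c by simp
qed

section \<open>The singular label integral near the maximum\<close>

text \<open>\<open>r\<close> encodes the exact curvature at the maximum \<alpha>, while
  \<open>\<rho>\<close> gives a cruder quadratic lower bound on the whole interval, used for
  denominators. That \<alpha> is interior lets the arctangents at both ends approach their
  limits.\<close>

locale ipm_peak = ipm_data +
  fixes \<alpha> r \<rho> C0 :: real
  assumes \<alpha>: "-pi < \<alpha>" "\<alpha> < pi" and r: "r > 0" and \<rho>: "\<rho> > 0" and C0: "C0 > 0"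
    and peak_lower: "\<And>x. x \<in> Ipi \<Longrightarrow> \<rho>\<^sup>2 * (x - \<alpha>)\<^sup>2 \<le> M - u x"
    and peak_taylor: "\<And>x. x \<in> Ipi \<Longrightarrow> \<bar>M - u x - r\<^sup>2 * (x - \<alpha>)\<^sup>2\<bar> \<le> C0 * \<bar>x - \<alpha>\<bar> ^ 3"
    and peak_taylor1: "\<And>x. x \<in> Ipi \<Longrightarrow> \<bar>- u1 x - 2 * r\<^sup>2 * (x - \<alpha>)\<bar> \<le> C0 * (x - \<alpha>)\<^sup>2"
begin

definition "N x = M - u x"
text \<open>The blowup \<open>s \<rightarrow> 1/M\<close> is parametrised by \<open>q \<rightarrow> 0\<close>, where \<open>1/s - M = q\<^sup>4\<close>.\<close>

definition "sq q = 1 / (M + q ^ 4)" for q :: real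
definition "\<Gamma> q a = integral {-pi..a} (\<lambda>x. 1 / (q ^ 4 + N x))" for q :: real
definition "I q = \<Gamma> q pi" for q :: real

lemma N_lower: "x \<in> Ipi \<Longrightarrow> \<rho>\<^sup>2 * (x - \<alpha>)\<^sup>2 \<le> N x"
  and N_taylor: "x \<in> Ipi \<Longrightarrow> \<bar>N x - r\<^sup>2 * (x - \<alpha>)\<^sup>2\<bar> \<le> C0 * \<bar>x - \<alpha>\<bar> ^ 3"
  using peak_lower peak_taylor by (auto simp: N_def)

lemma sq_S: "q > 0 \<Longrightarrow> sq q \<in> S"
  using M by (auto simp: S_def sq_def add_pos_pos intro!: divide_strict_left_mono)

lemma sq_pos: "q > 0 \<Longrightarrow> sq q > 0"
  using M by (simp add: sq_def add_pos_pos)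

lemma D_sq: "q > 0 \<Longrightarrow> D (sq q) x = (q ^ 4 + N x) / (M + q ^ 4)"
  using M add_pos_pos[of M "q ^ 4"] by (simp add: D_def sq_def N_def field_simps)

lemma N_nonneg: "x \<in> Ipi \<Longrightarrow> N x \<ge> 0" using u_le by (simp add: N_def)

lemma qN_pos: "q > 0 \<Longrightarrow> x \<in> Ipi \<Longrightarrow> q ^ 4 + N x > 0"
  using N_nonneg by (simp add: add_pos_nonneg)

lemma cont_N: "continuous_on Ipi N"
  unfolding N_def[abs_def] by (intro continuous_intros cu)

lemma cont_qN: "q > 0 \<Longrightarrow> continuous_on Ipi (\<lambda>x. 1 / (q ^ 4 + N x))"
  by (intro continuous_intros cont_N) (use qN_pos in force)

lemma G_sq: "q > 0 \<Longrightarrow> a \<in> Ipi \<Longrightarrow> G (sq q) a = (M + q ^ 4) * \<Gamma> q a"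
proof -
  assume q: "q > 0"
  have "G (sq q) a = integral {-pi..a} (\<lambda>x. (M + q ^ 4) * (1 / (q ^ 4 + N x)))"
    unfolding G_def by (rule integral_cong) (simp add: D_sq q)
  then show ?thesis unfolding \<Gamma>_def integral_mult_right .
qed

lemma P_sq: "q > 0 \<Longrightarrow> P (sq q) = (M + q ^ 4) * I q / (2 * pi)"
  using G_sq[of q pi] by (simp add: P_def I_def)

lemma I_pos: "q > 0 \<Longrightarrow> I q > 0"
  using P_pos[OF sq_S[of q]] P_sq[of q] M add_pos_pos[of M "q ^ 4"]
  by (auto simp: zero_less_mult_iff zero_less_divide_iff)

lemma X_sq: "q > 0 \<Longrightarrow> a \<in> Ipi \<Longrightarrow> X (sq q) a = - pi + 2 * pi * \<Gamma> q a / I q"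
  using M add_pos_pos[of M "q ^ 4"] I_pos[of q] by (simp add: X_def P_sq G_sq)

lemma \<Gamma>_bounds: 
  assumes q: "q > 0" and a: "a \<in> Ipi"
  shows "0 \<le> \<Gamma> q a" "\<Gamma> q a \<le> I q"
proof -
  have i: "(\<lambda>x. 1 / (q ^ 4 + N x)) integrable_on {-pi..b}" if "b \<in> Ipi" for b
    using cont_qN[OF q] that by (auto intro!: integrable_continuous_real intro: continuous_on_subset)
  have nn: "1 / (q ^ 4 + N x) \<ge> 0" if "x \<in> Ipi" for x using qN_pos[OF q that] by simp
  show "0 \<le> \<Gamma> q a" unfolding \<Gamma>_def by (rule integral_nonneg[OF i[OF a]]) (use a nn in auto)
  show "\<Gamma> q a \<le> I q" unfolding \<Gamma>_def I_def
    by (rule integral_subset_le) (use a i[of a] i[of pi] nn in auto)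
qed

text \<open>The left side is the error of replacing \<open>N\<close> by its quadratic part in 1/(q^4
  + N). Two of the three powers in the cubic Taylor error are absorbed by the model denominator, at
  cost 1/r^2.\<close>

lemma cube_quotient:
  assumes q: "q > 0" and x: "x \<in> Ipi"
  shows "\<bar>N x - r\<^sup>2 * (x - \<alpha>)\<^sup>2\<bar> / ((q ^ 4 + N x) * (q ^ 4 + r\<^sup>2 * (x - \<alpha>)\<^sup>2))
    \<le> C0 / r\<^sup>2 * (\<bar>x - \<alpha>\<bar> / (q ^ 4 + \<rho>\<^sup>2 * (x - \<alpha>)\<^sup>2))"
proof -
  define y where "y = \<bar>x - \<alpha>\<bar>"
  have y2: "(x - \<alpha>)\<^sup>2 = y\<^sup>2" by (simp add: y_def)
  have p1: "q ^ 4 + \<rho>\<^sup>2 * y\<^sup>2 > 0" "q ^ 4 + r\<^sup>2 * y\<^sup>2 > 0" using q by (simp_all add: add_pos_nonneg)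
  have "\<bar>N x - r\<^sup>2 * y\<^sup>2\<bar> / ((q ^ 4 + N x) * (q ^ 4 + r\<^sup>2 * y\<^sup>2)) \<le> C0 * y ^ 3 / ((q ^ 4 + \<rho>\<^sup>2 * y\<^sup>2) * (q ^ 4 + r\<^sup>2 * y\<^sup>2))"
    using N_taylor[OF x] N_lower[OF x] p1 qN_pos[OF q x] C0
    by (intro frac_le mult_right_mono mult_pos_pos) (auto simp: y_def)
  also have "\<dots> = C0 * (y / (q ^ 4 + \<rho>\<^sup>2 * y\<^sup>2)) * (y\<^sup>2 / (q ^ 4 + r\<^sup>2 * y\<^sup>2))"
    by (simp add: power3_eq_cube power2_eq_square)
  also have "\<dots> \<le> C0 * (y / (q ^ 4 + \<rho>\<^sup>2 * y\<^sup>2)) * (1 / r\<^sup>2)"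
    using p1 r q C0 by (intro mult_left_mono) (auto simp: y_def field_simps)
  finally show ?thesis by (simp add: y2 y_def[symmetric] ac_simps)
qed

text \<open>AM-GM at the layer width. The pointwise loss 1/q^2 is harmless in
  \<open>Q_approx\<close>, where a factor q^4 stands in front.\<close>

lemma linear_quotient1:
  assumes q: "q > 0" 
  shows "\<bar>y\<bar> / (q ^ 4 + \<rho>\<^sup>2 * y\<^sup>2) \<le> 1 / (2 * \<rho> * q\<^sup>2)"
proof -
  have "2 * (q\<^sup>2 * (\<rho> * \<bar>y\<bar>)) \<le> (q\<^sup>2)\<^sup>2 + (\<rho> * \<bar>y\<bar>)\<^sup>2" using sum_squares_bound[of "q\<^sup>2" "\<rho> * \<bar>y\<bar>"] by (simp add: ac_simps)
  then have "2 * (q\<^sup>2 * (\<rho> * \<bar>y\<bar>)) \<le> q ^ 4 + \<rho>\<^sup>2 * y\<^sup>2" by (simp add: power_mult_distrib flip: power_mult)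
  moreover have "q ^ 4 + \<rho>\<^sup>2 * y\<^sup>2 > 0" using q by (simp add: add_pos_nonneg)
  ultimately show ?thesis using q \<rho> by (simp add: field_simps)
qed

text \<open>This weighted AM-GM step avoids the logarithm in \<open>\<integral> \<bar>y\<bar> / (q\<^sup>4 + y\<^sup>2)\<close>.\<close>

lemma linear_quotient2:
  assumes q: "q > 0" 
  shows "\<bar>y\<bar> / (q ^ 4 + \<rho>\<^sup>2 * y\<^sup>2) \<le> q / 2 * (1 / (q ^ 4 + \<rho>\<^sup>2 * y\<^sup>2)) + 1 / (2 * \<rho>\<^sup>2 * q)"
proof -
  define Z where "Z = q ^ 4 + \<rho>\<^sup>2 * y\<^sup>2"
  have Z: "Z > 0" unfolding Z_def using q by (simp add: add_pos_nonneg)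
  have "2 * q * \<bar>y\<bar> \<le> q\<^sup>2 + y\<^sup>2" using sum_squares_bound[of q "\<bar>y\<bar>"] by simp
  then have "\<bar>y\<bar> \<le> q / 2 + y\<^sup>2 / (2 * q)" using q by (simp add: field_simps power2_eq_square)
  then have "\<bar>y\<bar> / Z \<le> (q / 2 + y\<^sup>2 / (2 * q)) / Z" using Z by (intro divide_right_mono) auto
  also have "\<dots> = q / 2 * (1 / Z) + y\<^sup>2 / Z * (1 / (2 * q))" using Z q by (simp add: field_simps)
  also have "y\<^sup>2 / Z \<le> 1 / \<rho>\<^sup>2" using Z \<rho> q by (simp add: Z_def field_simps)
  then have "q / 2 * (1 / Z) + y\<^sup>2 / Z * (1 / (2 * q)) \<le> q / 2 * (1 / Z) + 1 / \<rho>\<^sup>2 * (1 / (2 * q))"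
    using q by (intro add_left_mono mult_right_mono) auto
  finally show ?thesis by (simp add: Z_def ac_simps)
qed

text \<open>Used with \<open>k = r\<close> for the quadratic model and with
  \<open>k = \<rho>\<close> for the majorant of its error.\<close>

lemma arctan_has_integral:
  assumes q: "q > 0" and k: "k > 0" and a: "a \<in> Ipi"
  shows "((\<lambda>x. 1 / (q ^ 4 + k\<^sup>2 * (x - \<alpha>)\<^sup>2)) has_integral
    (arctan (k * (a - \<alpha>) / q\<^sup>2) - arctan (k * (- pi - \<alpha>) / q\<^sup>2)) / (k * q\<^sup>2)) {-pi..a}"
proof -
  have "((\<lambda>x. arctan (k * (x - \<alpha>) / q\<^sup>2) / (k * q\<^sup>2)) has_real_derivative 1 / (q ^ 4 + k\<^sup>2 * (x - \<alpha>)\<^sup>2)) (at x within UNIV)" for x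
  proof -
    have p: "q ^ 4 + k\<^sup>2 * (x - \<alpha>)\<^sup>2 > 0" using q by (simp add: add_pos_nonneg)
    have "1 + (k * (x - \<alpha>) / q\<^sup>2)\<^sup>2 = (q ^ 4 + k\<^sup>2 * (x - \<alpha>)\<^sup>2) / q ^ 4"
      using q by (simp add: power_divide power_mult_distrib add_divide_distrib flip: power_mult)
    moreover have "inverse (h / q ^ 4) * (k / q\<^sup>2) / (k * q\<^sup>2) = 1 / h" if "h > 0" for h
      using q k that by (simp add: field_simps eval_nat_numeral)
    ultimately have e: "inverse (1 + (k * (x - \<alpha>) / q\<^sup>2)\<^sup>2) * (k / q\<^sup>2) / (k * q\<^sup>2) = 1 / (q ^ 4 + k\<^sup>2 * (x - \<alpha>)\<^sup>2)"
      using p by simp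
    have "((\<lambda>x. k * (x - \<alpha>) / q\<^sup>2) has_real_derivative k / q\<^sup>2) (at x within UNIV)"
      by (rule DERIV_cdivide) (auto intro!: derivative_eq_intros)
    from DERIV_cdivide[OF DERIV_chain2[OF DERIV_arctan this], of "k * q\<^sup>2"]
    show ?thesis unfolding e .
  qed
  from real_FTC[OF _ _ this, of "-pi" a] a
  show ?thesis by (simp add: diff_divide_distrib)
qed

text \<open>The integral of the quadratic model with its lower limit moved from -pi to minus
  infinity, whence the summand pi/2.\<close>

definition "G0 q a = (arctan (r * (a - \<alpha>) / q\<^sup>2) + pi / 2) / (r * q\<^sup>2)"

text \<open>Two errors: the cubic Taylor error, integrated by \<open>linear_quotient2\<close>, and
  the truncation at -pi, which is bounded and so at most a constant over \<open>q\<close> for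
  \<open>q\<close> up to 1.\<close>

lemma \<Gamma>_approx:
  "\<exists>C>0. \<forall>q a. 0 < q \<and> q \<le> 1 \<and> a \<in> Ipi \<longrightarrow> \<bar>\<Gamma> q a - G0 q a\<bar> \<le> C / q"
proof -
  \<comment> \<open>Obtained from \<open>linear_quotient2\<close> by bounding the arctangent
    difference by pi and the length of the interval by 2 pi.\<close>
  define C1 where "C1 = C0 / r\<^sup>2 * (pi / (2 * \<rho>) + pi / \<rho>\<^sup>2)"
  define C2 where "C2 = 1 / (r\<^sup>2 * (pi + \<alpha>))"
  have C1: "C1 > 0" unfolding C1_def using C0 r \<rho> by (intro mult_pos_pos divide_pos_pos add_pos_pos) auto
  have C2: "C2 > 0" unfolding C2_def using r \<alpha> by simp
  have main: "\<bar>\<Gamma> q a - G0 q a\<bar> \<le> (C1 + C2) / q" if q: "0 < q" "q \<le> 1" and a: "a \<in> Ipi" for q a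
  proof -
    define \<Gamma>0 where "\<Gamma>0 = (arctan (r * (a - \<alpha>) / q\<^sup>2) - arctan (r * (- pi - \<alpha>) / q\<^sup>2)) / (r * q\<^sup>2)"
    have sub: "{-pi..a} \<subseteq> Ipi" using a by auto
    have i1: "((\<lambda>x. 1 / (q ^ 4 + N x)) has_integral \<Gamma> q a) {-pi..a}"
      unfolding \<Gamma>_def by (intro integrable_integral integrable_continuous_real continuous_on_subset[OF cont_qN[OF q(1)] sub])
    have i2: "((\<lambda>x. 1 / (q ^ 4 + r\<^sup>2 * (x - \<alpha>)\<^sup>2)) has_integral \<Gamma>0) {-pi..a}"
      unfolding \<Gamma>0_def by (rule arctan_has_integral[OF q(1) r a])
    define R where "R = (arctan (\<rho> * (a - \<alpha>) / q\<^sup>2) - arctan (\<rho> * (- pi - \<alpha>) / q\<^sup>2)) / (\<rho> * q\<^sup>2)"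
    have i3: "((\<lambda>x. C0 / r\<^sup>2 * (q / 2 * (1 / (q ^ 4 + \<rho>\<^sup>2 * (x - \<alpha>)\<^sup>2)) + 1 / (2 * \<rho>\<^sup>2 * q))) has_integral
        C0 / r\<^sup>2 * (q / 2 * R + 1 / (2 * \<rho>\<^sup>2 * q) * (a + pi))) {-pi..a}"
      unfolding R_def
      by (intro has_integral_mult_right has_integral_add arctan_has_integral q \<rho> a)
        (use has_integral_const_real[of "1 / (2 * \<rho>\<^sup>2 * q)" "-pi" a] a in \<open>simp add: mult.commute\<close>)
    have i12: "((\<lambda>x. 1 / (q ^ 4 + N x) - 1 / (q ^ 4 + r\<^sup>2 * (x - \<alpha>)\<^sup>2)) has_integral \<Gamma> q a - \<Gamma>0) {-pi..a}"
      by (intro has_integral_diff i1 i2)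
    have "norm (integral {-pi..a} (\<lambda>x. 1 / (q ^ 4 + N x) - 1 / (q ^ 4 + r\<^sup>2 * (x - \<alpha>)\<^sup>2)))
      \<le> integral {-pi..a} (\<lambda>x. C0 / r\<^sup>2 * (q / 2 * (1 / (q ^ 4 + \<rho>\<^sup>2 * (x - \<alpha>)\<^sup>2)) + 1 / (2 * \<rho>\<^sup>2 * q)))"
    proof (rule integral_norm_bound_integral)
      fix x assume "x \<in> {-pi..a}"
      then have x: "x \<in> Ipi" using sub by auto
      have p: "q ^ 4 + r\<^sup>2 * (x - \<alpha>)\<^sup>2 > 0" using q by (simp add: add_pos_nonneg)
      have "1 / (q ^ 4 + N x) - 1 / (q ^ 4 + r\<^sup>2 * (x - \<alpha>)\<^sup>2) =
         - (N x - r\<^sup>2 * (x - \<alpha>)\<^sup>2) / ((q ^ 4 + N x) * (q ^ 4 + r\<^sup>2 * (x - \<alpha>)\<^sup>2))"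
        using p qN_pos[OF q(1) x] by (simp add: diff_frac_eq)
      then have "norm (1 / (q ^ 4 + N x) - 1 / (q ^ 4 + r\<^sup>2 * (x - \<alpha>)\<^sup>2)) =
         \<bar>N x - r\<^sup>2 * (x - \<alpha>)\<^sup>2\<bar> / ((q ^ 4 + N x) * (q ^ 4 + r\<^sup>2 * (x - \<alpha>)\<^sup>2))"
        using p qN_pos[OF q(1) x] by (simp add: abs_mult abs_minus_commute)
      also have "\<dots> \<le> C0 / r\<^sup>2 * (\<bar>x - \<alpha>\<bar> / (q ^ 4 + \<rho>\<^sup>2 * (x - \<alpha>)\<^sup>2))"
        by (rule cube_quotient[OF q(1) x])
      also have "\<dots> \<le> C0 / r\<^sup>2 * (q / 2 * (1 / (q ^ 4 + \<rho>\<^sup>2 * (x - \<alpha>)\<^sup>2)) + 1 / (2 * \<rho>\<^sup>2 * q))"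
        using linear_quotient2[OF q(1)] C0 by (intro mult_left_mono) auto
      finally show "norm (1 / (q ^ 4 + N x) - 1 / (q ^ 4 + r\<^sup>2 * (x - \<alpha>)\<^sup>2)) \<le> \<dots>" .
    qed (use i12 i3 in auto)
    then have "\<bar>\<Gamma> q a - \<Gamma>0\<bar> \<le> C0 / r\<^sup>2 * (q / 2 * R + 1 / (2 * \<rho>\<^sup>2 * q) * (a + pi))"
      unfolding integral_unique[OF i12] integral_unique[OF i3] by simp
    also have "\<dots> \<le> C0 / r\<^sup>2 * (q / 2 * (pi / (\<rho> * q\<^sup>2)) + 1 / (2 * \<rho>\<^sup>2 * q) * (2 * pi))"
    proof (intro mult_left_mono add_mono)
      show "R \<le> pi / (\<rho> * q\<^sup>2)" unfolding R_def
        using arctan_ubound[of "\<rho> * (a - \<alpha>) / q\<^sup>2"] arctan_lbound[of "\<rho> * (- pi - \<alpha>) / q\<^sup>2"] q \<rho>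
        by (intro divide_right_mono) auto
    qed (use q C0 a \<rho> in auto)
    also have "\<dots> = C1 / q" using q \<rho> by (simp add: C1_def field_simps power2_eq_square)
    finally have 1: "\<bar>\<Gamma> q a - \<Gamma>0\<bar> \<le> C1 / q" .
    have neg: "r * (- pi - \<alpha>) / q\<^sup>2 = - (r * (pi + \<alpha>) / q\<^sup>2)"
    proof -
      have "r * (- pi - \<alpha>) = - (r * (pi + \<alpha>))" by (simp add: algebra_simps)
      then show ?thesis by (simp only: minus_divide_left)
    qed
    have "\<Gamma>0 - G0 q a = (- arctan (r * (- pi - \<alpha>) / q\<^sup>2) - pi / 2) / (r * q\<^sup>2)"
      by (simp add: \<Gamma>0_def G0_def diff_divide_distrib add_divide_distrib)
    also have "\<dots> = - (pi / 2 - arctan (r * (pi + \<alpha>) / q\<^sup>2)) / (r * q\<^sup>2)"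
      unfolding neg arctan_minus by simp
    finally have "\<bar>\<Gamma>0 - G0 q a\<bar> = \<bar>pi / 2 - arctan (r * (pi + \<alpha>) / q\<^sup>2)\<bar> / (r * q\<^sup>2)"
      using q r by (simp add: abs_mult abs_minus_commute)
    also have "\<dots> \<le> 1 / (r * (pi + \<alpha>) / q\<^sup>2) / (r * q\<^sup>2)"
      using q r \<alpha> by (intro divide_right_mono arctan_bound) auto
    also have "\<dots> = C2"
    proof -
      have "1 / (r * h / q\<^sup>2) / (r * q\<^sup>2) = 1 / (r\<^sup>2 * h)" if "h > 0" for h
        using q r that by (simp add: field_simps power2_eq_square)
      then show ?thesis using \<alpha> by (simp add: C2_def)
    qed
    also have "\<dots> \<le> C2 / q" using q C2 by (simp add: pos_le_divide_eq mult_left_le)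
    finally show ?thesis using 1 by (simp add: add_divide_distrib)
  qed
  have "C1 + C2 > 0" using C1 C2 by simp
  then show ?thesis using main by blast
qed

text \<open>The new error beyond \<open>\<Gamma>_approx\<close> is the truncation at the right end,
  again bounded.\<close>

lemma I_approx: "\<exists>C>0. \<forall>q. 0 < q \<and> q \<le> 1 \<longrightarrow> \<bar>I q - pi / (r * q\<^sup>2)\<bar> \<le> C / q"
proof -
  obtain C where C: "C > 0" "\<And>q a. 0 < q \<Longrightarrow> q \<le> 1 \<Longrightarrow> a \<in> Ipi \<Longrightarrow> \<bar>\<Gamma> q a - G0 q a\<bar> \<le> C / q"
    using \<Gamma>_approx by blast
  define C2 where "C2 = 1 / (r\<^sup>2 * (pi - \<alpha>))"
  have C2: "C2 > 0" unfolding C2_def using r \<alpha> by simp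
  have main: "\<bar>I q - pi / (r * q\<^sup>2)\<bar> \<le> (C + C2) / q" if q: "0 < q" "q \<le> 1" for q
  proof -
    have "G0 q pi - pi / (r * q\<^sup>2) = - (pi / 2 - arctan (r * (pi - \<alpha>) / q\<^sup>2)) / (r * q\<^sup>2)"
      by (simp add: G0_def diff_divide_distrib add_divide_distrib)
    then have "\<bar>G0 q pi - pi / (r * q\<^sup>2)\<bar> = \<bar>pi / 2 - arctan (r * (pi - \<alpha>) / q\<^sup>2)\<bar> / (r * q\<^sup>2)"
      using q r by (simp add: abs_mult abs_minus_commute)
    also have "\<dots> \<le> 1 / (r * (pi - \<alpha>) / q\<^sup>2) / (r * q\<^sup>2)"
      using q r \<alpha> by (intro divide_right_mono arctan_bound) auto
    also have "\<dots> = C2"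
    proof -
      have "1 / (r * h / q\<^sup>2) / (r * q\<^sup>2) = 1 / (r\<^sup>2 * h)" if "h > 0" for h
        using q r that by (simp add: field_simps power2_eq_square)
      then show ?thesis using \<alpha> by (simp add: C2_def)
    qed
    also have "\<dots> \<le> C2 / q" using q C2 by (simp add: pos_le_divide_eq mult_left_le)
    finally show ?thesis using C(2)[OF q, of pi] by (simp add: add_divide_distrib I_def)
  qed
  have "C + C2 > 0" using C C2 by simp
  then show ?thesis using main by blast
qed

text \<open>
  \<open>Z\<close> is the flow map of the quadratic model, for which \<open>Q = cos Z\<close> and \<open>Sn = sin Z\<close> hold up to the error in \<open>I\<close>.
  On characteristics the solution is \<open>c0 + c1 * Q\<close> and its \<open>x\<close>-derivative \<open>- c1 * Sn\<close> (see \<open>E_sq\<close> below).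
\<close>

definition "Z q a = 2 * arctan (r * (a - \<alpha>) / q\<^sup>2)"
definition "Q q a = (q ^ 4 - N a) / (q ^ 4 + N a)"
definition "J q = I q * q ^ 4 / pi"
definition "Sn q a = J q * (- u1 a) / (q ^ 4 + N a)"

section \<open>Comparison with the quadratic model\<close>

text \<open>The integrals are of size 1/q^2 with errors of size 1/q, so their ratios agree up to
  O(q).\<close>

lemma X_approx: "\<exists>C>0. \<forall>q a. 0 < q \<and> q \<le> 1 \<and> a \<in> Ipi \<longrightarrow> \<bar>X (sq q) a - Z q a\<bar> \<le> C * q"
proof -
  obtain C1 where C1: "C1 > 0" "\<And>q a. 0 < q \<Longrightarrow> q \<le> 1 \<Longrightarrow> a \<in> Ipi \<Longrightarrow> \<bar>\<Gamma> q a - G0 q a\<bar> \<le> C1 / q"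
    using \<Gamma>_approx by blast
  obtain C2 where C2: "C2 > 0" "\<And>q. 0 < q \<Longrightarrow> q \<le> 1 \<Longrightarrow> \<bar>I q - pi / (r * q\<^sup>2)\<bar> \<le> C2 / q"
    using I_approx by blast
  have main: "\<bar>X (sq q) a - Z q a\<bar> \<le> 2 * r * (C1 + C2) * q" if q: "0 < q" "q \<le> 1" and a: "a \<in> Ipi" for q a
  proof -
    define I0 where "I0 = pi / (r * q\<^sup>2)"
    have I0: "I0 > 0" unfolding I0_def using r q by simp
    have I: "I q > 0" using I_pos q by simp
    have "Z q a = - pi + 2 * pi * G0 q a / I0"
      using r q by (simp add: Z_def G0_def I0_def field_simps)
    then have "X (sq q) a - Z q a = 2 * pi * (\<Gamma> q a / I q - G0 q a / I0)"
      unfolding X_sq[OF q(1) a] by (simp add: right_diff_distrib)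
    \<comment> \<open>This splitting multiplies the error of \<open>I\<close> by
      \<open>\<Gamma> q a / I q\<close>, which lies between 0 and 1, and divides only by the
      explicit \<open>I0\<close>.\<close>
    also have "\<Gamma> q a / I q - G0 q a / I0 = ((\<Gamma> q a - G0 q a) + \<Gamma> q a / I q * (I0 - I q)) / I0"
      using I I0 by (simp add: field_simps)
    finally have "\<bar>X (sq q) a - Z q a\<bar> = 2 * pi / I0 * \<bar>(\<Gamma> q a - G0 q a) + \<Gamma> q a / I q * (I0 - I q)\<bar>"
      using I0 by (simp add: abs_mult)
    also have "\<dots> \<le> 2 * pi / I0 * (C1 / q + 1 * (C2 / q))"
    proof (rule mult_left_mono)
      have "\<bar>\<Gamma> q a / I q\<bar> \<le> 1" using \<Gamma>_bounds[OF q(1) a] I by simp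
      moreover have "\<bar>I0 - I q\<bar> \<le> C2 / q" using C2(2)[OF q] by (simp add: I0_def abs_minus_commute)
      ultimately have "\<bar>\<Gamma> q a / I q * (I0 - I q)\<bar> \<le> 1 * (C2 / q)"
        unfolding abs_mult by (intro mult_mono) auto
      then show "\<bar>(\<Gamma> q a - G0 q a) + \<Gamma> q a / I q * (I0 - I q)\<bar> \<le> C1 / q + 1 * (C2 / q)"
        using C1(2)[OF q a] by linarith
    qed (use I0 in simp)
    also have "\<dots> = 2 * r * (C1 + C2) * q" using q r by (simp add: I0_def field_simps power2_eq_square)
    finally show ?thesis .
  qed
  have "2 * r * (C1 + C2) > 0" using C1 C2 r by simp
  then show ?thesis using main by blast
qed

text \<open>Over a common denominator the difference is -2 q^4 times the quotient of
  \<open>cube_quotient\<close>, so the singular factor is compensated pointwise.\<close>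

lemma Q_approx: 
  assumes q: "0 < q" and a: "a \<in> Ipi"
  shows "\<bar>Q q a - cos (Z q a)\<bar> \<le> C0 / (r\<^sup>2 * \<rho>) * q\<^sup>2"
proof -
  define w where "w = r\<^sup>2 * (a - \<alpha>)\<^sup>2"
  have w: "w \<ge> 0" by (simp add: w_def)
  have p: "q ^ 4 + w > 0" "q ^ 4 + N a > 0" using q w qN_pos[OF q a] by (simp_all add: add_pos_nonneg)
  have v: "(r * (a - \<alpha>) / q\<^sup>2)\<^sup>2 = w / q ^ 4"
    by (simp add: w_def power_divide power_mult_distrib flip: power_mult)
  have "cos (Z q a) = (q ^ 4 - w) / (q ^ 4 + w)"
  proof -
    have "1 - w / q ^ 4 = (q ^ 4 - w) / q ^ 4" "1 + w / q ^ 4 = (q ^ 4 + w) / q ^ 4"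
      using q by (simp_all add: diff_divide_distrib add_divide_distrib)
    then show ?thesis unfolding Z_def cos_double_arctan v using q by simp
  qed
  then have "Q q a - cos (Z q a) = ((q ^ 4 - N a) * (q ^ 4 + w) - (q ^ 4 - w) * (q ^ 4 + N a)) / ((q ^ 4 + N a) * (q ^ 4 + w))"
    using p unfolding Q_def by (simp only: diff_frac_eq)
  also have "(q ^ 4 - N a) * (q ^ 4 + w) - (q ^ 4 - w) * (q ^ 4 + N a) = - (2 * q ^ 4 * (N a - w))"
    by (simp add: algebra_simps)
  finally have "Q q a - cos (Z q a) = - (2 * q ^ 4 * ((N a - w) / ((q ^ 4 + N a) * (q ^ 4 + w))))"
    by simp
  then have "\<bar>Q q a - cos (Z q a)\<bar> = 2 * q ^ 4 * (\<bar>N a - w\<bar> / ((q ^ 4 + N a) * (q ^ 4 + w)))"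
    using p q by (simp add: abs_mult)
  also have "\<dots> \<le> 2 * q ^ 4 * (C0 / r\<^sup>2 * (1 / (2 * \<rho> * q\<^sup>2)))"
    using order_trans[OF cube_quotient[OF q a, folded w_def] mult_left_mono[OF linear_quotient1[OF q]]] C0 q
    by (intro mult_left_mono) auto
  also have "\<dots> = C0 / (r\<^sup>2 * \<rho>) * q\<^sup>2" using q \<rho> r by (simp add: field_simps eval_nat_numeral)
  finally show ?thesis .
qed

lemma J_approx: "\<exists>C>0. \<forall>q. 0 < q \<and> q \<le> 1 \<longrightarrow> \<bar>J q - q\<^sup>2 / r\<bar> \<le> C * q ^ 3"
proof -
  obtain C2 where C2: "C2 > 0" "\<And>q. 0 < q \<Longrightarrow> q \<le> 1 \<Longrightarrow> \<bar>I q - pi / (r * q\<^sup>2)\<bar> \<le> C2 / q"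
    using I_approx by blast
  have "\<bar>J q - q\<^sup>2 / r\<bar> \<le> C2 / pi * q ^ 3" if q: "0 < q" "q \<le> 1" for q
  proof -
    have "J q - q\<^sup>2 / r = q ^ 4 / pi * (I q - pi / (r * q\<^sup>2))"
      using q r by (simp add: J_def field_simps eval_nat_numeral)
    then have "\<bar>J q - q\<^sup>2 / r\<bar> = q ^ 4 / pi * \<bar>I q - pi / (r * q\<^sup>2)\<bar>" by (simp add: abs_mult)
    also have "\<dots> \<le> q ^ 4 / pi * (C2 / q)" using C2(2)[OF q] by (intro mult_left_mono) auto
    also have "\<dots> = C2 / pi * q ^ 3" using q by (simp add: field_simps eval_nat_numeral)
    finally show ?thesis .
  qed
  moreover have "C2 / pi > 0" using C2 by simp
  ultimately show ?thesis by blast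
qed

text \<open>Write \<open>Sn\<close> as \<open>J * n\<close> and sin Z as (q^2/r) n0. Then n - n0 is
  bounded and n0 is at most r/q^2, while \<open>J\<close> is O(q) and its error O(q^3); both
  products are O(q).\<close>

lemma Sn_approx: "\<exists>C>0. \<forall>q a. 0 < q \<and> q \<le> 1 \<and> a \<in> Ipi \<longrightarrow> \<bar>Sn q a - sin (Z q a)\<bar> \<le> C * q"
proof -
  obtain C where C: "C > 0" "\<And>q. 0 < q \<Longrightarrow> q \<le> 1 \<Longrightarrow> \<bar>J q - q\<^sup>2 / r\<bar> \<le> C * q ^ 3"
    using J_approx by blast
  have main: "\<bar>Sn q a - sin (Z q a)\<bar> \<le> ((1 / r + C) * (2 * C0 / \<rho>\<^sup>2 + C0 / \<rho>\<^sup>2) + C * r) * q"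
    if q: "0 < q" "q \<le> 1" and a: "a \<in> Ipi" for q a
  proof -
    define y where "y = a - \<alpha>"
    define w where "w = r\<^sup>2 * y\<^sup>2"
    define n where "n = - u1 a / (q ^ 4 + N a)"
    define n0 where "n0 = 2 * r\<^sup>2 * y / (q ^ 4 + w)"
    have w: "w \<ge> 0" by (simp add: w_def)
    have p: "q ^ 4 + w > 0" "q ^ 4 + N a > 0" "q ^ 4 + \<rho>\<^sup>2 * y\<^sup>2 > 0"
      using q w qN_pos[OF q(1) a] by (simp_all add: add_pos_nonneg)
    have v: "(r * y / q\<^sup>2)\<^sup>2 = w / q ^ 4"
      by (simp add: w_def power_divide power_mult_distrib flip: power_mult)
    have sinZ: "sin (Z q a) = q\<^sup>2 / r * n0"
      unfolding Z_def sin_double_arctan y_def[symmetric] v n0_def using q p r 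
      by (simp add: field_simps eval_nat_numeral)
    have y2: "y\<^sup>2 / (q ^ 4 + \<rho>\<^sup>2 * y\<^sup>2) \<le> 1 / \<rho>\<^sup>2" using p \<rho> q by (simp add: field_simps)
    have "n - n0 = (- u1 a - 2 * r\<^sup>2 * y) / (q ^ 4 + N a) - 2 * r\<^sup>2 * y * ((N a - w) / ((q ^ 4 + N a) * (q ^ 4 + w)))"
    proof -
      have "2 * r\<^sup>2 * y / (q ^ 4 + N a) - n0 = 2 * r\<^sup>2 * y * ((q ^ 4 + w) - (q ^ 4 + N a)) / ((q ^ 4 + N a) * (q ^ 4 + w))"
        unfolding n0_def using p by (subst diff_frac_eq) (auto simp: algebra_simps)
      also have "\<dots> = - (2 * r\<^sup>2 * y * ((N a - w) / ((q ^ 4 + N a) * (q ^ 4 + w))))"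
      proof -
        have "2 * r\<^sup>2 * y * ((q ^ 4 + w) - (q ^ 4 + N a)) = - (2 * r\<^sup>2 * y * (N a - w))" by (simp add: algebra_simps)
        then show ?thesis by (simp only: minus_divide_left[symmetric] times_divide_eq_right)
      qed
      finally show ?thesis by (simp add: n_def diff_divide_distrib)
    qed
    then have "\<bar>n - n0\<bar> \<le> \<bar>(- u1 a - 2 * r\<^sup>2 * y) / (q ^ 4 + N a)\<bar> + \<bar>2 * r\<^sup>2 * y * ((N a - w) / ((q ^ 4 + N a) * (q ^ 4 + w)))\<bar>"
      by linarith
    also have "\<bar>(- u1 a - 2 * r\<^sup>2 * y) / (q ^ 4 + N a)\<bar> \<le> C0 / \<rho>\<^sup>2"
    proof -
      have "\<bar>(- u1 a - 2 * r\<^sup>2 * y) / (q ^ 4 + N a)\<bar> \<le> C0 * y\<^sup>2 / (q ^ 4 + \<rho>\<^sup>2 * y\<^sup>2)"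
        unfolding abs_divide using p peak_taylor1[OF a] N_lower[OF a] C0
        by (intro frac_le) (auto simp: y_def)
      also have "\<dots> \<le> C0 / \<rho>\<^sup>2" using mult_left_mono[OF y2, of C0] C0 by simp
      finally show ?thesis .
    qed
    also have "\<bar>2 * r\<^sup>2 * y * ((N a - w) / ((q ^ 4 + N a) * (q ^ 4 + w)))\<bar> \<le> 2 * C0 / \<rho>\<^sup>2"
    proof -
      have "\<bar>2 * r\<^sup>2 * y * ((N a - w) / ((q ^ 4 + N a) * (q ^ 4 + w)))\<bar> = 2 * r\<^sup>2 * \<bar>y\<bar> * (\<bar>N a - w\<bar> / ((q ^ 4 + N a) * (q ^ 4 + w)))"
        using p by (simp add: abs_mult)
      also have "\<dots> \<le> 2 * r\<^sup>2 * \<bar>y\<bar> * (C0 / r\<^sup>2 * (\<bar>y\<bar> / (q ^ 4 + \<rho>\<^sup>2 * y\<^sup>2)))"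
        using cube_quotient[OF q(1) a] by (intro mult_left_mono) (auto simp: w_def y_def)
      also have "\<dots> = 2 * C0 * (y\<^sup>2 / (q ^ 4 + \<rho>\<^sup>2 * y\<^sup>2))"
      proof -
        have "2 * r\<^sup>2 * h * (C0 / r\<^sup>2 * (h / k)) = 2 * C0 * (h\<^sup>2 / k)" for h k
          using r by (simp add: power2_eq_square)
        from this[of "\<bar>y\<bar>"] show ?thesis by simp
      qed
      also have "\<dots> \<le> 2 * C0 * (1 / \<rho>\<^sup>2)" using y2 C0 by (intro mult_left_mono) auto
      finally show ?thesis by simp
    qed
    finally have nn: "\<bar>n - n0\<bar> \<le> 2 * C0 / \<rho>\<^sup>2 + C0 / \<rho>\<^sup>2" by simp
    \<comment> \<open>AM-GM for \<open>q\<^sup>2\<close> and \<open>r * \<bar>y\<bar>\<close>, whose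
      squares add up to the model denominator.\<close>
    have n0: "\<bar>n0\<bar> \<le> r / q\<^sup>2"
    proof -
      have "2 * (q\<^sup>2 * (r * \<bar>y\<bar>)) \<le> (q\<^sup>2)\<^sup>2 + (r * \<bar>y\<bar>)\<^sup>2" using sum_squares_bound[of "q\<^sup>2" "r * \<bar>y\<bar>"] by (simp add: ac_simps)
      then have "2 * (q\<^sup>2 * (r * \<bar>y\<bar>)) \<le> q ^ 4 + w" by (simp add: w_def power_mult_distrib flip: power_mult)
      then have "r * (2 * (q\<^sup>2 * (r * \<bar>y\<bar>))) \<le> r * (q ^ 4 + w)" using r by (intro mult_left_mono) auto
      moreover have "\<bar>n0\<bar> = 2 * r\<^sup>2 * \<bar>y\<bar> / (q ^ 4 + w)" using p by (simp add: n0_def abs_mult)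
      moreover have "m / h \<le> r / q\<^sup>2" if "h > 0" "m * q\<^sup>2 \<le> r * h" for m h
        using that q by (simp add: field_simps)
      from this[OF p(1), of "2 * r\<^sup>2 * \<bar>y\<bar>"] 
      have "r * (2 * (q\<^sup>2 * (r * \<bar>y\<bar>))) \<le> r * (q ^ 4 + w) \<Longrightarrow> 2 * r\<^sup>2 * \<bar>y\<bar> / (q ^ 4 + w) \<le> r / q\<^sup>2"
        by (simp add: power2_eq_square ac_simps)
      ultimately show ?thesis by simp
    qed
    have q3: "q ^ 3 \<le> q\<^sup>2" "q\<^sup>2 \<le> q" 
      using q power_decreasing[of 2 3 q] power_decreasing[of 1 2 q] by auto
    have J: "\<bar>J q\<bar> \<le> (1 / r + C) * q"
    proof -
      have "\<bar>J q\<bar> \<le> q\<^sup>2 / r + C * q ^ 3" 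
      proof -
        have "q\<^sup>2 / r \<ge> 0" using r by simp
        then show ?thesis using C(2)[OF q] by linarith
      qed
      also have "\<dots> \<le> q / r + C * q" using q3 r C(1) by (intro add_mono divide_right_mono mult_left_mono) auto
      finally show ?thesis by (simp add: algebra_simps)
    qed
    have "Sn q a - sin (Z q a) = J q * (n - n0) + (J q - q\<^sup>2 / r) * n0"
      unfolding sinZ by (simp add: Sn_def n_def algebra_simps)
    then have "\<bar>Sn q a - sin (Z q a)\<bar> \<le> \<bar>J q\<bar> * \<bar>n - n0\<bar> + \<bar>J q - q\<^sup>2 / r\<bar> * \<bar>n0\<bar>"
      using abs_triangle_ineq[of "J q * (n - n0)" "(J q - q\<^sup>2 / r) * n0"] by (simp add: abs_mult)
    also have "\<dots> \<le> (1 / r + C) * q * (2 * C0 / \<rho>\<^sup>2 + C0 / \<rho>\<^sup>2) + C * q ^ 3 * (r / q\<^sup>2)"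
      using J nn n0 C(2)[OF q] C(1) r q by (intro add_mono mult_mono) auto
    also have "\<dots> = ((1 / r + C) * (2 * C0 / \<rho>\<^sup>2 + C0 / \<rho>\<^sup>2) + C * r) * q"
      using q by (simp add: field_simps eval_nat_numeral)
    finally show ?thesis .
  qed
  have "((1 / r + C) * (2 * C0 / \<rho>\<^sup>2 + C0 / \<rho>\<^sup>2) + C * r) > 0"
    using C r C0 \<rho> by (intro add_pos_pos mult_pos_pos divide_pos_pos) auto
  then show ?thesis using main by blast
qed

section \<open>The solution against the cosine\<close>

lemma Mq_pos: "q > 0 \<Longrightarrow> M + q ^ 4 > 0" using M by (simp add: add_pos_pos)

lemma J_pos: "q > 0 \<Longrightarrow> J q > 0" using I_pos by (simp add: J_def)

definition "c1 q = (M + q ^ 4) / J q"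
text \<open>Everything in the solution that depends on time only. Its three large terms are not
  expanded; \<open>W_approx\<close> bounds their sum through the zero mean.\<close>

definition "c0 q = c1 q - 2 * pi / I q - B (sq q)"

lemma c1_pos: "q > 0 \<Longrightarrow> c1 q > 0" using Mq_pos J_pos by (simp add: c1_def)

text \<open>With h = q^4 + N both \<open>u\<close> and \<open>P * D\<close> are affine in h, so
  their quotient is affine in 1/h, and \<open>Q\<close> is 2 q^4/h - 1.\<close>

lemma E_sq:
  assumes q: "q > 0" and a: "a \<in> Ipi"
  shows "E 0 (sq q) a = c0 q + c1 q * Q q a" "E 1 (sq q) a = - c1 q * Sn q a"
proof -
  define h where "h = q ^ 4 + N a"
  have h: "h > 0" unfolding h_def by (rule qN_pos[OF q a])
  have m: "M + q ^ 4 > 0" by (rule Mq_pos[OF q])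
  have I: "I q > 0" by (rule I_pos[OF q])
  have u: "u a = (M + q ^ 4) - h" by (simp add: h_def N_def)
  have Q: "Q q a = 2 * q ^ 4 / h - 1" using h by (simp add: Q_def h_def field_simps)
  have PD: "P (sq q) * D (sq q) a = I q * h / (2 * pi)"
    unfolding P_sq[OF q] D_sq[OF q] h_def[symmetric] using m by simp
  have "u a / (P (sq q) * D (sq q) a) = 2 * pi * (M + q ^ 4) / (I q * h) - 2 * pi / I q"
    unfolding PD u using h I by (simp add: field_simps)
  moreover have "c1 q * Q q a = 2 * pi * (M + q ^ 4) / (I q * h) - c1 q"
    unfolding Q c1_def J_def using h I q by (simp add: field_simps)
  ultimately show "E 0 (sq q) a = c0 q + c1 q * Q q a"
    by (simp add: E_def c0_def B_def)
  show "E 1 (sq q) a = - c1 q * Sn q a"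
    unfolding E_def Sn_def c1_def D_sq[OF q] h_def[symmetric] using h m J_pos[OF q] by simp
qed

text \<open>At the label \<open>Y (sq q) x\<close> the flow map takes the value \<open>x\<close>, so
  \<open>X_approx\<close> puts \<open>x\<close> within O(q) of \<open>Z\<close>; cosine and sine are
  Lipschitz.\<close>

lemma profile: "\<exists>C>0. \<forall>q x. 0 < q \<and> q \<le> 1 \<and> x \<in> Ipi \<longrightarrow>
    \<bar>Q q (Y (sq q) x) - cos x\<bar> \<le> C * q \<and> \<bar>Sn q (Y (sq q) x) - sin x\<bar> \<le> C * q"
proof -
  obtain CX where CX: "CX > 0" "\<And>q a. 0 < q \<Longrightarrow> q \<le> 1 \<Longrightarrow> a \<in> Ipi \<Longrightarrow> \<bar>X (sq q) a - Z q a\<bar> \<le> CX * q"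
    using X_approx by blast
  obtain CS where CS: "CS > 0" "\<And>q a. 0 < q \<Longrightarrow> q \<le> 1 \<Longrightarrow> a \<in> Ipi \<Longrightarrow> \<bar>Sn q a - sin (Z q a)\<bar> \<le> CS * q"
    using Sn_approx by blast
  define CQ where "CQ = C0 / (r\<^sup>2 * \<rho>)"
  have CQ: "CQ > 0" unfolding CQ_def using C0 r \<rho> by simp
  have main: "\<bar>Q q (Y (sq q) x) - cos x\<bar> \<le> (CX + CS + CQ) * q \<and> \<bar>Sn q (Y (sq q) x) - sin x\<bar> \<le> (CX + CS + CQ) * q"
    if q: "0 < q" "q \<le> 1" and x: "x \<in> Ipi" for q x
  proof -
    define a where "a = Y (sq q) x"
    have a: "a \<in> Ipi" "X (sq q) a = x" using Y_Ipi X_Y sq_S[OF q(1)] x by (auto simp: a_def)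
    have xz: "\<bar>x - Z q a\<bar> \<le> CX * q" using CX(2)[OF q a(1)] a(2) by simp
    have q2: "q\<^sup>2 \<le> q" using q power_decreasing[of 1 2 q] by auto
    have "\<bar>Q q a - cos (Z q a)\<bar> \<le> CQ * q"
      using Q_approx[OF q(1) a(1)] mult_left_mono[OF q2, of CQ] CQ unfolding CQ_def by linarith
    moreover have "\<bar>cos (Z q a) - cos x\<bar> \<le> CX * q" using cos_lipschitz[of "Z q a" x] xz by linarith
    moreover have "\<bar>sin (Z q a) - sin x\<bar> \<le> CX * q" using sin_lipschitz[of "Z q a" x] xz by linarith
    moreover note CS(2)[OF q a(1)]
    moreover have "CX * q \<ge> 0" "CS * q \<ge> 0" "CQ * q \<ge> 0" using q CX CS CQ by auto
    ultimately show ?thesis unfolding a_def[symmetric] distrib_right by linarith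
  qed
  have "CX + CS + CQ > 0" using CX CS CQ by simp
  then show ?thesis using main by blast
qed

text \<open>Both \<open>W 0\<close> and the cosine have zero mean, so integrating the profile
  estimate leaves only \<open>c0\<close> and bounds it by the same error. Hence the factor
  2.\<close>

lemma W_approx: "\<exists>C>0. \<forall>q x. 0 < q \<and> q \<le> 1 \<and> x \<in> Ipi \<longrightarrow>
    \<bar>W 0 (sq q) x - c1 q * cos x\<bar> \<le> C * c1 q * q \<and> \<bar>W 1 (sq q) x + c1 q * sin x\<bar> \<le> C * c1 q * q"
proof -
  obtain C where C: "C > 0" "\<And>q x. 0 < q \<Longrightarrow> q \<le> 1 \<Longrightarrow> x \<in> Ipi \<Longrightarrow>
    \<bar>Q q (Y (sq q) x) - cos x\<bar> \<le> C * q" "\<And>q x. 0 < q \<Longrightarrow> q \<le> 1 \<Longrightarrow> x \<in> Ipi \<Longrightarrow> \<bar>Sn q (Y (sq q) x) - sin x\<bar> \<le> C * q"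
    using profile by blast
  have main: "\<bar>W 0 (sq q) x - c1 q * cos x\<bar> \<le> 2 * C * c1 q * q \<and> \<bar>W 1 (sq q) x + c1 q * sin x\<bar> \<le> 2 * C * c1 q * q"
    if q: "0 < q" "q \<le> 1" and x: "x \<in> Ipi" for q x
  proof -
    have S: "sq q \<in> S" using sq_S q by simp
    have c1: "c1 q > 0" by (rule c1_pos[OF q(1)])
    have b0: "\<bar>W 0 (sq q) x - c1 q * cos x - c0 q\<bar> \<le> c1 q * (C * q)" if x: "x \<in> Ipi" for x
    proof -
      have "W 0 (sq q) x - c1 q * cos x - c0 q = c1 q * (Q q (Y (sq q) x) - cos x)"
        unfolding W_def E_sq[OF q(1) Y_Ipi[OF S x]] by (simp add: algebra_simps)
      then have "\<bar>W 0 (sq q) x - c1 q * cos x - c0 q\<bar> = c1 q * \<bar>Q q (Y (sq q) x) - cos x\<bar>"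
        using c1 by (simp add: abs_mult)
      also have "\<dots> \<le> c1 q * (C * q)" using C(2)[OF q x] c1 by (intro mult_left_mono) auto
      finally show ?thesis .
    qed
    have b1: "\<bar>W 1 (sq q) x + c1 q * sin x\<bar> \<le> c1 q * (C * q)"
    proof -
      have "W 1 (sq q) x + c1 q * sin x = - (c1 q * (Sn q (Y (sq q) x) - sin x))"
        unfolding W_def E_sq[OF q(1) Y_Ipi[OF S x]] by (simp add: algebra_simps)
      then have "\<bar>W 1 (sq q) x + c1 q * sin x\<bar> = c1 q * \<bar>Sn q (Y (sq q) x) - sin x\<bar>"
        using c1 by (simp add: abs_mult)
      also have "\<dots> \<le> c1 q * (C * q)" using C(3)[OF q x] c1 by (intro mult_left_mono) auto
      finally show ?thesis .
    qed
    have cosi: "(cos has_integral sin pi - sin (- pi)) Ipi"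
      by (rule real_FTC[where A = UNIV]) (auto simp: DERIV_sin)
    have Wi: "(W 0 (sq q) has_integral 0) Ipi"
      using integrable_integral[OF integrable_continuous_real[OF W_cont_x[OF S, of 0]]] mean_W[OF S] by simp
    have i: "((\<lambda>x. W 0 (sq q) x - c1 q * cos x - c0 q) has_integral 0 - c1 q * (sin pi - sin (- pi)) - c0 q * (2 * pi)) Ipi"
      by (intro has_integral_diff has_integral_mult_right cosi Wi)
        (use has_integral_const_real[of "c0 q" "-pi" pi] in \<open>simp add: mult.commute\<close>)
    have k: "((\<lambda>x. c1 q * (C * q)) has_integral c1 q * (C * q) * (2 * pi)) Ipi"
      using has_integral_const_real[of "c1 q * (C * q)" "-pi" pi] by (simp add: mult.commute)
    have "norm (integral Ipi (\<lambda>x. W 0 (sq q) x - c1 q * cos x - c0 q)) \<le> integral Ipi (\<lambda>x. c1 q * (C * q))"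
      by (rule integral_norm_bound_integral) (use i k b0 in auto)
    then have "\<bar>c0 q\<bar> * (2 * pi) \<le> c1 q * (C * q) * (2 * pi)"
      unfolding integral_unique[OF i] integral_unique[OF k] by (simp add: abs_mult)
    then have "\<bar>c0 q\<bar> \<le> c1 q * (C * q)" by simp
    moreover have "c1 q * (C * q) \<ge> 0" using c1 C q by simp
    moreover have "2 * C * c1 q * q = 2 * (c1 q * (C * q))" by simp
    ultimately show ?thesis using b0[OF x] b1 by linarith
  qed
  have "2 * C > 0" using C by simp
  then show ?thesis using main by blast
qed

section \<open>The blowup time\<close>

lemma sq_deriv: "q > 0 \<Longrightarrow> (sq has_real_derivative - (4 * q ^ 3) / (M + q ^ 4)\<^sup>2) (at q within R)"
  unfolding sq_def[abs_def] using Mq_pos[of q]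
  by (auto intro!: derivative_eq_intros simp: power2_eq_square field_simps)

text \<open>As \<open>J\<close> is about q^2/r, the derivative is about -2 q/(M r), which integrates
  to the leading term q^2/(M r) of the remaining time.\<close>

lemma Tsq_deriv:
  assumes q: "q > 0"
  shows "((\<lambda>q. T (sq q)) has_real_derivative - (2 * J q / (q * (M + q ^ 4)))) (at q within {0<..})"
proof -
  have "((\<lambda>q. T (sq q)) has_real_derivative P (sq q) * (- (4 * q ^ 3) / (M + q ^ 4)\<^sup>2)) (at q within {0<..})"
    by (rule real_chain_within[OF dT sq_deriv]) (use q sq_S in auto)
  moreover have "m * I q / (2 * pi) * (- (4 * q ^ 3) / m\<^sup>2) = - (2 * J q / (q * m))" if "m > 0" for m
    unfolding J_def using q that by (simp add: field_simps eval_nat_numeral)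
  note this[OF Mq_pos[OF q]]
  ultimately show ?thesis unfolding P_sq[OF q] by (simp only:)
qed

text \<open>The added q^2/(M r) cancels the leading part of the derivative, leaving O(q^2). The
  bound is uniform in the smaller parameter \<open>p\<close>, so letting \<open>p\<close> tend to 0
  yields both a finite blowup time and its expansion.\<close>

lemma T_increment: "\<exists>C>0. \<forall>p q. 0 < p \<and> p < q \<and> q \<le> 1 \<longrightarrow>
    \<bar>(T (sq p) + p\<^sup>2 / (M * r)) - (T (sq q) + q\<^sup>2 / (M * r))\<bar> \<le> C * q ^ 3"
proof -
  obtain CJ where CJ: "CJ > 0" "\<And>q. 0 < q \<Longrightarrow> q \<le> 1 \<Longrightarrow> \<bar>J q - q\<^sup>2 / r\<bar> \<le> CJ * q ^ 3"
    using J_approx by blast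
  define C where "C = 2 * (M * CJ + 1 / r) / (M * M)"
  have C: "C > 0" unfolding C_def using CJ M r by (intro divide_pos_pos mult_pos_pos add_pos_pos) auto
  have main: "\<bar>(T (sq p) + p\<^sup>2 / (M * r)) - (T (sq q) + q\<^sup>2 / (M * r))\<bar> \<le> C * q ^ 3"
    if pq: "0 < p" "p < q" "q \<le> 1" for p q
  proof -
    define F' where "F' z = - (2 * J z / (z * (M + z ^ 4))) + 2 * z / (M * r)" for z
    have d: "((\<lambda>q. T (sq q) + q\<^sup>2 / (M * r)) has_real_derivative F' z) (at z within {p..q})" if z: "z \<in> {p..q}" for z
    proof -
      have "((\<lambda>q. q\<^sup>2 / (M * r)) has_real_derivative 2 * z / (M * r)) (at z within {p..q})"
        using M r by (auto intro!: derivative_eq_intros)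
      moreover have "((\<lambda>q. T (sq q)) has_real_derivative - (2 * J z / (z * (M + z ^ 4)))) (at z within {p..q})"
        by (rule DERIV_subset[OF Tsq_deriv]) (use z pq in auto)
      ultimately show ?thesis unfolding F'_def by (intro DERIV_add)
    qed
    have mem: "convex {p..q}" "q \<in> {p..q}" "p \<in> {p..q}" using pq by auto
    obtain z where z: "z \<in> {p..q}" "(T (sq p) + p\<^sup>2 / (M * r)) - (T (sq q) + q\<^sup>2 / (M * r)) = F' z * (p - q)"
      using real_mvt_segment[OF mem d] by blast
    have z01: "0 < z" "z \<le> 1" "z \<le> q" using z(1) pq by auto
    \<comment> \<open>The numerator separates the error of \<open>J\<close> from that of replacing M
      + z^4 by M; the latter is the term z^6/r.\<close>
    have "F' z = 2 / z * ((M * (z\<^sup>2 / r - J z) + z ^ 6 / r) / (M * (M + z ^ 4)))"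
    proof -
      have "- (2 * J z / (z * m)) + 2 * z / (M * r) = 2 / z * ((M * (z\<^sup>2 / r - J z) + z\<^sup>2 * (m - M) / r) / (M * m))" if "m > 0" for m
        using that z01 M r by (simp add: field_simps power2_eq_square)
      from this[OF Mq_pos[OF z01(1)]] show ?thesis unfolding F'_def by (simp add: power_add[symmetric])
    qed
    then have "\<bar>F' z\<bar> = 2 / z * (\<bar>M * (z\<^sup>2 / r - J z) + z ^ 6 / r\<bar> / (M * (M + z ^ 4)))"
      using z01 M Mq_pos[OF z01(1)] by (simp only: abs_mult abs_divide) simp
    also have "\<dots> \<le> 2 / z * ((M * (CJ * z ^ 3) + z ^ 3 / r) / (M * M))"
    proof (intro mult_left_mono frac_le)
      have "\<bar>M * (z\<^sup>2 / r - J z)\<bar> \<le> M * (CJ * z ^ 3)"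
        unfolding abs_mult using CJ(2)[OF z01(1,2)] M by (intro mult_mono) (auto simp: abs_minus_commute)
      moreover have "z ^ 6 / r \<le> z ^ 3 / r" "z ^ 6 / r \<ge> 0"
        using z01 r by (auto intro!: divide_right_mono power_decreasing)
      ultimately show "\<bar>M * (z\<^sup>2 / r - J z) + z ^ 6 / r\<bar> \<le> M * (CJ * z ^ 3) + z ^ 3 / r" by linarith
      show "0 \<le> M * (CJ * z ^ 3) + z ^ 3 / r" using M CJ z01 r by (intro add_nonneg_nonneg) auto
    qed (use M z01 in auto)
    also have "\<dots> = C * z\<^sup>2" unfolding C_def using z01 M r by (simp add: field_simps eval_nat_numeral)
    also have "\<dots> \<le> C * q\<^sup>2" using z01 C by (intro mult_left_mono power_mono) auto
    finally have F: "\<bar>F' z\<bar> \<le> C * q\<^sup>2" .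
    have "\<bar>F' z * (p - q)\<bar> \<le> (C * q\<^sup>2) * q"
      unfolding abs_mult using F pq C by (intro mult_mono) auto
    then show ?thesis unfolding z(2) by (simp add: eval_nat_numeral)
  qed
  show ?thesis using C main by blast
qed

lemma sq_surj:
  assumes "0 < s" "s \<in> S"
  obtains q where "q > 0" "s = sq q"
proof -
  have "1 / s > M" using assms M by (simp add: S_def field_simps)
  then have p: "1 / s - M > 0" by simp
  then have "root 4 (1 / s - M) ^ 4 = 1 / s - M" by simp
  then show ?thesis using that[of "root 4 (1 / s - M)"] p by (simp add: sq_def)
qed

lemma sq_less_iff: "p > 0 \<Longrightarrow> q > 0 \<Longrightarrow> sq p < sq q \<longleftrightarrow> q < p"
proof -
  assume pq: "p > 0" "q > 0"
  have "sq p < sq q \<longleftrightarrow> q ^ 4 < p ^ 4"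
    using Mq_pos[OF pq(1)] Mq_pos[OF pq(2)] by (simp add: sq_def field_simps)
  also have "\<dots> \<longleftrightarrow> q < p" using pq by (simp add: power_mono_iff flip: linorder_not_le)
  finally show ?thesis .
qed

text \<open>Suprema over \<open>S\<close> can be taken along \<open>sq p\<close> with
  \<open>p\<close> below any given threshold.\<close>

lemma sq_beyond:
  assumes s: "s \<in> S" and q: "q > 0"
  obtains p where "0 < p" "p < q" "s < sq p"
proof -
  have "max s (sq q) < 1 / M" using s sq_S[OF q] by (auto simp: S_def)
  then obtain s' where s': "max s (sq q) < s'" "s' < 1 / M" using dense by blast
  have s'0: "0 < s'" using s' sq_pos[OF q] by simp
  then obtain p where p: "p > 0" "s' = sq p" using sq_surj[of s'] s' by (auto simp: S_def)
  then show ?thesis using that[of p] s' sq_less_iff[OF q p(1)] by auto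
qed

definition "tstar = Sup (T ` S)"

text \<open>\<open>T_increment\<close> at \<open>q = 1\<close> bounds the times uniformly as
  \<open>p\<close> tends to 0.\<close>

lemma T_bdd: "bdd_above (T ` S)"
proof -
  obtain C where C: "C > 0" "\<And>p q. 0 < p \<Longrightarrow> p < q \<Longrightarrow> q \<le> 1 \<Longrightarrow>
    \<bar>(T (sq p) + p\<^sup>2 / (M * r)) - (T (sq q) + q\<^sup>2 / (M * r))\<bar> \<le> C * q ^ 3"
    using T_increment by blast
  show ?thesis
  proof (rule bdd_aboveI2)
    fix s assume s: "s \<in> S"
    obtain p where p: "0 < p" "p < 1" "s < sq p" using sq_beyond[OF s, of 1] by auto
    have "T s < T (sq p)" using T_strict[OF s sq_S p(3)] p by simp
    moreover have "p\<^sup>2 / (M * r) \<ge> 0" using M r by simp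
    ultimately show "T s \<le> T (sq 1) + 1\<^sup>2 / (M * r) + C * 1 ^ 3"
      using C(2)[OF p(1,2)] by (auto simp: abs_le_iff)
  qed
qed

lemma T_less_tstar: "s \<in> S \<Longrightarrow> T s < tstar"
proof -
  assume s: "s \<in> S"
  obtain p where p: "0 < p" "s < sq p" using sq_beyond[OF s, of 1] by auto
  have "T s < T (sq p)" using T_strict[OF s sq_S p(2)] p by simp
  also have "\<dots> \<le> tstar" unfolding tstar_def using sq_S p by (intro cSUP_upper T_bdd) auto
  finally show ?thesis .
qed

text \<open>The hypothesis of \<open>is_sol_sol\<close>. The supremum is not attained because
  \<open>S\<close> has no last element; every earlier time is reached by the intermediate value
  theorem.\<close>

lemma T_image: "T ` S = {0..<tstar}"
proof (intro equalityI subsetI)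
  fix t assume "t \<in> T ` S"
  then obtain s where s: "s \<in> S" "t = T s" by auto
  have "T 0 \<le> T s" using T_strict[OF zero_S s(1)] s(1) by (cases "s = 0") (auto simp: S_def)
  then show "t \<in> {0..<tstar}" using T_less_tstar s by simp
next
  fix t assume t: "t \<in> {0..<tstar}"
  then have "t < Sup (T ` S)" by (simp add: tstar_def)
  then obtain s where s: "s \<in> S" "t < T s"
    using less_cSup_iff[of "T ` S" t] T_bdd zero_S by auto
  have sub: "{0..s} \<subseteq> S" using s by (auto simp: S_def)
  have "continuous_on S T" using dT by (meson DERIV_continuous continuous_on_eq_continuous_within)
  then have "continuous_on {0..s} T" using sub continuous_on_subset by blast
  then have "\<exists>x\<ge>0. x \<le> s \<and> T x = t" using t s by (intro IVT') (auto simp: S_def)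
  then show "t \<in> T ` S" using sub by auto
qed

lemma tstar_approx: "\<exists>C>0. \<forall>q. 0 < q \<and> q \<le> 1 \<longrightarrow> \<bar>tstar - T (sq q) - q\<^sup>2 / (M * r)\<bar> \<le> C * q ^ 3"
proof -
  obtain C where C: "C > 0" "\<And>p q. 0 < p \<Longrightarrow> p < q \<Longrightarrow> q \<le> 1 \<Longrightarrow>
    \<bar>(T (sq p) + p\<^sup>2 / (M * r)) - (T (sq q) + q\<^sup>2 / (M * r))\<bar> \<le> C * q ^ 3"
    using T_increment by blast
  have main: "\<bar>tstar - T (sq q) - q\<^sup>2 / (M * r)\<bar> \<le> C * q ^ 3" if q: "0 < q" "q \<le> 1" for q
  proof -
    have "tstar \<le> T (sq q) + q\<^sup>2 / (M * r) + C * q ^ 3"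
      unfolding tstar_def
    proof (rule cSUP_least)
      fix s assume s: "s \<in> S"
      obtain p where p: "0 < p" "p < q" "s < sq p" using sq_beyond[OF s q(1)] by auto
      have "T s < T (sq p)" using T_strict[OF s sq_S p(3)] p by simp
      moreover have "p\<^sup>2 / (M * r) \<ge> 0" using M r by simp
      ultimately show "T s \<le> T (sq q) + q\<^sup>2 / (M * r) + C * q ^ 3"
        using C(2)[OF p(1,2) q(2)] by linarith
    qed (use zero_S in auto)
    moreover have "T (sq q) + q\<^sup>2 / (M * r) - C * q ^ 3 \<le> tstar"
    proof (rule field_le_epsilon)
      fix e :: real assume e: "e > 0"
      \<comment> \<open>Since p < 1, the second entry gives p^2 <= e M r; the first keeps p below
        q.\<close>
      define p where "p = min (q / 2) (e * (M * r))"
      have p: "0 < p" "p < q" using q e M r by (auto simp: p_def min_def)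
      have "p\<^sup>2 \<le> p * 1" unfolding power2_eq_square using p q by (intro mult_left_mono) auto
      also have "\<dots> \<le> e * (M * r)" by (simp add: p_def)
      finally have "p\<^sup>2 / (M * r) \<le> e" using M r by (simp add: divide_le_eq)
      moreover have "T (sq p) < tstar" using T_less_tstar sq_S p by simp
      ultimately show "T (sq q) + q\<^sup>2 / (M * r) - C * q ^ 3 \<le> tstar + e"
        using C(2)[OF p q(2)] by linarith
    qed
    ultimately show ?thesis by linarith
  qed
  show ?thesis using C main by blast
qed

section \<open>Rate, blowup and maximality\<close>

text \<open>The amplitude \<open>c1 q\<close> and 1/(tstar - t) are both L/q^2 + O(1/q) with L = M
  r, so the amplitude may be exchanged for the reciprocal remaining time.\<close>

lemma blowup_rate: "\<exists>q0 C K. 0 < q0 \<and> q0 \<le> 1 \<and> C > 0 \<and> K > 0 \<and> (\<forall>q. 0 < q \<and> q \<le> q0 \<longrightarrow>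
    tstar - T (sq q) \<le> K * q\<^sup>2 \<and>
   (\<forall>x\<in>Ipi. \<bar>W 0 (sq q) x - cos x / (tstar - T (sq q))\<bar> \<le> C / q \<and>
            \<bar>W 1 (sq q) x + sin x / (tstar - T (sq q))\<bar> \<le> C / q))"
proof -
  obtain CJ where CJ: "CJ > 0" "\<And>q. 0 < q \<Longrightarrow> q \<le> 1 \<Longrightarrow> \<bar>J q - q\<^sup>2 / r\<bar> \<le> CJ * q ^ 3"
    using J_approx by blast
  obtain CT where CT: "CT > 0" "\<And>q. 0 < q \<Longrightarrow> q \<le> 1 \<Longrightarrow> \<bar>tstar - T (sq q) - q\<^sup>2 / (M * r)\<bar> \<le> CT * q ^ 3"
    using tstar_approx by blast
  obtain CW where CW: "CW > 0" "\<And>q x. 0 < q \<Longrightarrow> q \<le> 1 \<Longrightarrow> x \<in> Ipi \<Longrightarrow> \<bar>W 0 (sq q) x - c1 q * cos x\<bar> \<le> CW * c1 q * q"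
     "\<And>q x. 0 < q \<Longrightarrow> q \<le> 1 \<Longrightarrow> x \<in> Ipi \<Longrightarrow> \<bar>W 1 (sq q) x + c1 q * sin x\<bar> \<le> CW * c1 q * q"
    using W_approx by blast
  define L where "L = M * r"
  have L: "L > 0" using M r by (simp add: L_def)
  \<comment> \<open>Below these thresholds the cubic errors are at most half of the leading terms of
    \<open>J\<close> and of the remaining time, which keeps both denominators away from 0 at order
    q^2.\<close>
  define q0 where "q0 = min 1 (min (1 / (2 * r * CJ)) (1 / (2 * L * CT)))"
  define Ca where "Ca = 2 * r * (1 + L * CJ)"
  define Cb where "Cb = 2 * L\<^sup>2 * CT"
  define C where "C = CW * (L + Ca) + Ca + Cb"
  have q0: "0 < q0" "q0 \<le> 1" using r CJ(1) L CT(1) by (auto simp: q0_def)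
  have Ca: "Ca > 0" "Cb > 0" unfolding Ca_def Cb_def using r L CJ CT by (auto intro!: mult_pos_pos add_pos_pos)
  then have C: "C > 0" unfolding C_def using CW L by (intro add_pos_pos mult_pos_pos) auto
  have main: "tstar - T (sq q) \<le> (1 / L + CT) * q\<^sup>2 \<and>
   (\<forall>x\<in>Ipi. \<bar>W 0 (sq q) x - cos x / (tstar - T (sq q))\<bar> \<le> C / q \<and>
            \<bar>W 1 (sq q) x + sin x / (tstar - T (sq q))\<bar> \<le> C / q)" if q: "0 < q" "q \<le> q0" for q
  proof -
    define \<tau> where "\<tau> = tstar - T (sq q)"
    have q1: "q \<le> 1" using q q0 by simp
    have "q \<le> 1 / (2 * r * CJ)" using q(2) by (simp add: q0_def)
    then have qJ: "CJ * q \<le> 1 / (2 * r)" using CJ r by (simp add: field_simps)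
    have "q \<le> 1 / (2 * L * CT)" using q(2) by (simp add: q0_def)
    then have qT: "CT * q \<le> 1 / (2 * L)" using CT L by (simp add: field_simps)
    have q3: "q ^ 3 \<le> q\<^sup>2" using q q1 power_decreasing[of 2 3 q] by auto
    have \<tau>a: "\<bar>\<tau> - q\<^sup>2 / L\<bar> \<le> CT * q ^ 3" using CT(2)[OF q(1) q1] by (simp add: \<tau>_def L_def)
    have "CT * q ^ 3 \<le> CT * q\<^sup>2" using q3 CT by simp
    then have \<tau>up: "\<tau> \<le> (1 / L + CT) * q\<^sup>2" using \<tau>a unfolding distrib_right by simp
    have "CT * q ^ 3 = CT * q * q\<^sup>2" by (simp add: eval_nat_numeral)
    also have "\<dots> \<le> 1 / (2 * L) * q\<^sup>2" using qT by (intro mult_right_mono) auto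
    finally have "q\<^sup>2 / L - 1 / (2 * L) * q\<^sup>2 \<le> \<tau>" using \<tau>a by linarith
    then have \<tau>lo: "q\<^sup>2 / (2 * L) \<le> \<tau>" by (simp add: field_simps)
    have \<tau>pos: "\<tau> > 0" using \<tau>lo q L less_le_trans[of 0 "q\<^sup>2 / (2 * L)" \<tau>] by simp
    have Ja: "\<bar>J q - q\<^sup>2 / r\<bar> \<le> CJ * q ^ 3" by (rule CJ(2)[OF q(1) q1])
    have "CJ * q ^ 3 = CJ * q * q\<^sup>2" by (simp add: eval_nat_numeral)
    also have "\<dots> \<le> 1 / (2 * r) * q\<^sup>2" using qJ by (intro mult_right_mono) auto
    finally have "q\<^sup>2 / r - 1 / (2 * r) * q\<^sup>2 \<le> J q" using Ja by linarith
    then have Jlo: "q\<^sup>2 / (2 * r) \<le> J q" by (simp add: field_simps)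
    have Jp: "J q > 0" by (rule J_pos[OF q(1)])
    have c1a: "\<bar>c1 q - L / q\<^sup>2\<bar> \<le> Ca / q"
    proof -
      have "c1 q - L / q\<^sup>2 = (q ^ 4 - L * (J q - q\<^sup>2 / r) / q\<^sup>2) / J q"
        unfolding c1_def L_def using Jp q r by (simp add: field_simps eval_nat_numeral)
      then have "\<bar>c1 q - L / q\<^sup>2\<bar> = \<bar>q ^ 4 - L * (J q - q\<^sup>2 / r) / q\<^sup>2\<bar> / J q"
        using Jp by (simp add: abs_divide)
      also have "\<dots> \<le> (q + L * CJ * q) / (q\<^sup>2 / (2 * r))"
      proof (rule frac_le)
        have "\<bar>L * (J q - q\<^sup>2 / r) / q\<^sup>2\<bar> = L * \<bar>J q - q\<^sup>2 / r\<bar> / q\<^sup>2" using L by (simp add: abs_mult)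
        also have "\<dots> \<le> L * (CJ * q ^ 3) / q\<^sup>2" using L Ja by (intro divide_right_mono mult_left_mono) auto
        also have "\<dots> = L * CJ * q" using q by (simp add: field_simps eval_nat_numeral)
        finally have "\<bar>L * (J q - q\<^sup>2 / r) / q\<^sup>2\<bar> \<le> L * CJ * q" .
        moreover have "q ^ 4 \<le> q" "q ^ 4 \<ge> 0" using q q1 power_decreasing[of 1 4 q] by auto
        ultimately show "\<bar>q ^ 4 - L * (J q - q\<^sup>2 / r) / q\<^sup>2\<bar> \<le> q + L * CJ * q" by linarith
      qed (use q r L CJ Jlo in auto)
      also have "\<dots> = Ca / q" unfolding Ca_def using q r by (simp add: field_simps power2_eq_square)
      finally show ?thesis .
    qed
    have \<tau>i: "\<bar>1 / \<tau> - L / q\<^sup>2\<bar> \<le> Cb / q"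
    proof -
      have "1 / \<tau> - L / q\<^sup>2 = - (L * (\<tau> - q\<^sup>2 / L) / (\<tau> * q\<^sup>2))"
        using \<tau>pos L q by (simp add: field_simps)
      then have "\<bar>1 / \<tau> - L / q\<^sup>2\<bar> = L * \<bar>\<tau> - q\<^sup>2 / L\<bar> / (\<tau> * q\<^sup>2)"
        using \<tau>pos L by (simp add: abs_mult)
      also have "\<dots> \<le> L * (CT * q ^ 3) / (q\<^sup>2 / (2 * L) * q\<^sup>2)"
        using \<tau>a \<tau>lo L q CT by (intro frac_le mult_left_mono mult_right_mono) auto
      also have "\<dots> = Cb / q" unfolding Cb_def using q L by (simp add: field_simps eval_nat_numeral)
      finally show ?thesis .
    qed
    have c1\<tau>: "\<bar>c1 q - 1 / \<tau>\<bar> \<le> (Ca + Cb) / q" using c1a \<tau>i unfolding add_divide_distrib by linarith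
    have c1q: "CW * c1 q * q \<le> CW * (L + Ca) / q"
    proof -
      have "Ca / q \<le> Ca / q\<^sup>2" using q q1 Ca by (intro divide_left_mono) (auto simp: power2_eq_square mult_left_le)
      then have "c1 q \<le> (L + Ca) / q\<^sup>2" using c1a unfolding add_divide_distrib by linarith
      then have "CW * c1 q * q \<le> CW * ((L + Ca) / q\<^sup>2) * q" using CW q by (intro mult_right_mono mult_left_mono) auto
      then show ?thesis using q by (simp add: power2_eq_square)
    qed
    have "\<bar>W 0 (sq q) x - cos x / \<tau>\<bar> \<le> C / q \<and> \<bar>W 1 (sq q) x + sin x / \<tau>\<bar> \<le> C / q" if x: "x \<in> Ipi" for x
    proof -
      have t: "\<bar>c1 q * k - k / \<tau>\<bar> \<le> (Ca + Cb) / q" if "\<bar>k\<bar> \<le> 1" for k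
      proof -
        have "\<bar>c1 q * k - k / \<tau>\<bar> = \<bar>c1 q - 1 / \<tau>\<bar> * \<bar>k\<bar>" by (simp add: left_diff_distrib flip: abs_mult)
        also have "\<dots> \<le> (Ca + Cb) / q * 1" using c1\<tau> that Ca q by (intro mult_mono) auto
        finally show ?thesis by simp
      qed
      have "C / q = CW * (L + Ca) / q + (Ca + Cb) / q" by (simp add: C_def add_divide_distrib)
      then show ?thesis
        using CW(2)[OF q(1) q1 x] CW(3)[OF q(1) q1 x] t[of "cos x"] t[of "sin x"] c1q
          abs_cos_le_one[of x] abs_sin_le_one[of x] by linarith
    qed
    then show ?thesis using \<tau>up by (simp add: \<tau>_def)
  qed
  have "1 / L + CT > 0" using L CT by (simp add: add_pos_pos)
  then show ?thesis using q0 C main by blast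
qed

lemma tstar_pos: "tstar > 0" using T_less_tstar[OF zero_S] by simp

lemma Dx_remainder:
  assumes s: "s \<in> S" and x: "x \<in> Ipi"
  shows "Dx 1 (\<lambda>x. W 0 s x - cos x / \<tau>) x = W 1 s x + sin x / \<tau>"
proof -
  define D where "D j = (if j = 0 then (\<lambda>x. W 0 s x - cos x / \<tau>) else (\<lambda>x. W 1 s x + sin x / \<tau>))" for j :: nat
  have "Dx 1 (\<lambda>x. W 0 s x - cos x / \<tau>) x = D 1 x"
  proof (rule Dx_eq[where k = 1 and D = D])
    fix j :: nat and x assume j: "j < 1" and x: "x \<in> Ipi"
    have "((\<lambda>x. W 0 s x - cos x / \<tau>) has_real_derivative W (Suc 0) s x - (- sin x) / \<tau>) (at x within Ipi)"
      by (intro DERIV_diff dW_x s x DERIV_cdivide DERIV_subset[OF DERIV_cos]) auto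
    then show "(D j has_real_derivative D (Suc j) x) (at x within Ipi)"
      using j by (simp add: D_def)
  qed (use x in \<open>auto simp: D_def\<close>)
  then show ?thesis by (simp add: D_def)
qed

text \<open>Close to blowup the rate comes from \<open>blowup_rate\<close>. On the compact earlier
  interval everything is bounded, and the negative power of the remaining time is bounded
  below.\<close>

lemma sol_rate:
  "\<exists>C. \<forall>t\<in>{0..<tstar}. Ck_norm 1 (\<lambda>x. sol t x - cos x / (tstar - t)) \<le> C * (tstar - t) powr (-3/4)"
proof -
  note im = T_image
  obtain q0 C K where q0: "0 < q0" "q0 \<le> 1" and C: "C > 0" and K: "K > 0"
    and rate: "\<And>q. 0 < q \<Longrightarrow> q \<le> q0 \<Longrightarrow> tstar - T (sq q) \<le> K * q\<^sup>2"
      "\<And>q x. 0 < q \<Longrightarrow> q \<le> q0 \<Longrightarrow> x \<in> Ipi \<Longrightarrow> \<bar>W 0 (sq q) x - cos x / (tstar - T (sq q))\<bar> \<le> C / q"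
      "\<And>q x. 0 < q \<Longrightarrow> q \<le> q0 \<Longrightarrow> x \<in> Ipi \<Longrightarrow> \<bar>W 1 (sq q) x + sin x / (tstar - T (sq q))\<bar> \<le> C / q"
    using blowup_rate by blast
  define t0 where "t0 = T (sq q0)"
  have t0: "0 \<le> t0" "t0 < tstar"
    using T_image sq_S[OF q0(1)] unfolding t0_def by (auto simp: set_eq_iff)
  have late: "Ck_norm 1 (\<lambda>x. sol t x - cos x / (tstar - t)) \<le> 2 * C * K powr (3/4) * (tstar - t) powr (-3/4)"
    if t: "t0 \<le> t" "t < tstar" for t
  proof -
    have t': "t \<in> {0..<tstar}" using t t0 by auto
    define s where "s = \<sigma> t"
    have s: "s \<in> S" "T s = t" using sigma[OF im t'] by (auto simp: s_def)
    have ge: "\<not> s < sq q0" using T_strict[OF s(1) sq_S[OF q0(1)]] s(2) t(1) by (auto simp: t0_def)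
    then have "s > 0" using sq_pos[OF q0(1)] by linarith
    then obtain q where q: "q > 0" "s = sq q" using sq_surj s by blast
    have qq0: "q \<le> q0" using ge sq_less_iff[OF q(1) q0(1)] q(2) by auto
    define \<tau> where "\<tau> = tstar - t"
    have \<tau>: "\<tau> > 0" "\<tau> \<le> K * q\<^sup>2" using t rate(1)[OF q(1) qq0] q s by (auto simp: \<tau>_def)
    have "Ck_norm 1 (\<lambda>x. W 0 s x - cos x / \<tau>) \<le> C / q + C / q"
      by (rule Ck_norm_1_le) (use Dx_remainder[OF s(1)] rate(2,3)[OF q(1) qq0] q s in \<open>auto simp: \<tau>_def\<close>)
    also have "\<dots> = 2 * C * (1 / q)" by simp
    also have "1 / q \<le> K powr (3/4) * \<tau> powr (-3/4)"
    proof -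
      have "\<tau> powr (3/4) \<le> (K * q\<^sup>2) powr (3/4)" using \<tau> by (intro powr_mono2) auto
      also have "\<dots> = K powr (3/4) * q powr (3/2)"
        using K q(1) by (simp add: powr_mult powr_powr flip: powr_numeral)
      \<comment> \<open>The slack between the order 1/q obtained and the exponent -3/4 asked for is
        given away here, using q <= 1.\<close>
      also have "q powr (3/2) \<le> q powr 1" using q qq0 q0 by (intro powr_mono') auto
      finally have "\<tau> powr (3/4) \<le> K powr (3/4) * q" using q K by simp
      then show ?thesis using \<tau>(1) q(1) by (simp add: powr_minus_divide field_simps)
    qed
    finally show ?thesis using C by (simp add: \<tau>_def sol_def[abs_def] s_def[symmetric] mult.assoc)
  qed
  have issol: "is_sol tstar u sol" by (rule is_sol_sol[OF im])
  have comp: "compact ({0..t0} \<times> Ipi)" by (intro compact_Times) auto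
  have c: "continuous_on ({0..t0} \<times> Ipi) (\<lambda>p. W j (\<sigma> (fst p)) (snd p))" if "j \<le> 3" for j
  proof -
    have "continuous_on ({0..<tstar} \<times> Ipi) (\<lambda>p. Dx j (sol (fst p)) (snd p))"
      using issol that unfolding is_sol_def by blast
    then have "continuous_on ({0..t0} \<times> Ipi) (\<lambda>p. Dx j (sol (fst p)) (snd p))"
      by (rule continuous_on_subset) (use t0 in auto)
    then show ?thesis
      by (rule continuous_on_eq) (use Dx_W that sigma[OF im] t0 in \<open>auto simp: sol_def[abs_def]\<close>)
  qed
  obtain B0 where B0: "B0 > 0" "\<And>p. p \<in> {0..t0} \<times> Ipi \<Longrightarrow> \<bar>W 0 (\<sigma> (fst p)) (snd p)\<bar> \<le> B0"
    using continuous_compact_abs_bound[OF comp c[of 0]] by auto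
  obtain B1 where B1: "B1 > 0" "\<And>p. p \<in> {0..t0} \<times> Ipi \<Longrightarrow> \<bar>W 1 (\<sigma> (fst p)) (snd p)\<bar> \<le> B1"
    using continuous_compact_abs_bound[OF comp c[of 1]] by auto
  define E where "E = (B0 + 1 / (tstar - t0)) + (B1 + 1 / (tstar - t0))"
  have E: "E > 0" unfolding E_def using B0 B1 t0 by (intro add_pos_pos) auto
  have early: "Ck_norm 1 (\<lambda>x. sol t x - cos x / (tstar - t)) \<le> E * tstar powr (3/4) * (tstar - t) powr (-3/4)"
    if t: "0 \<le> t" "t \<le> t0" for t
  proof -
    have t': "t \<in> {0..<tstar}" using t t0 by auto
    define s where "s = \<sigma> t"
    have s: "s \<in> S" "T s = t" using sigma[OF im t'] by (auto simp: s_def)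
    define \<tau> where "\<tau> = tstar - t"
    have \<tau>: "\<tau> \<ge> tstar - t0" "\<tau> > 0" "\<tau> \<le> tstar" using t t0 by (auto simp: \<tau>_def)
    have k: "\<bar>k / \<tau>\<bar> \<le> 1 / (tstar - t0)" if "\<bar>k\<bar> \<le> 1" for k
      unfolding abs_divide using that \<tau> t0 by (intro frac_le) auto
    have "Ck_norm 1 (\<lambda>x. W 0 s x - cos x / \<tau>) \<le> E"
      unfolding E_def
    proof (rule Ck_norm_1_le)
      fix x assume x: "x \<in> Ipi"
      have p: "(t, x) \<in> {0..t0} \<times> Ipi" using x t by auto
      show "\<bar>W 0 s x - cos x / \<tau>\<bar> \<le> B0 + 1 / (tstar - t0)"
      proof -
        have "\<bar>W 0 s x\<bar> \<le> B0" using B0(2)[OF p] by (simp add: s_def)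
        then show ?thesis using k[OF abs_cos_le_one[of x]] by linarith
      qed
      have "\<bar>W 1 s x + sin x / \<tau>\<bar> \<le> B1 + 1 / (tstar - t0)"
      proof -
        have "\<bar>W 1 s x\<bar> \<le> B1" using B1(2)[OF p] by (simp add: s_def)
        then show ?thesis using k[OF abs_sin_le_one[of x]] by linarith
      qed
      then show "\<bar>Dx 1 (\<lambda>x. W 0 s x - cos x / \<tau>) x\<bar> \<le> B1 + 1 / (tstar - t0)"
        using Dx_remainder[OF s(1) x] by simp
    qed
    \<comment> \<open>The inserted factor is 1; replacing \<open>tstar\<close> by the smaller
      \<open>\<tau>\<close> in the negative power only increases it.\<close>
    also have "E = E * (tstar powr (3/4) * tstar powr (-3/4))" using tstar_pos by (simp flip: powr_add)
    also have "\<dots> \<le> E * (tstar powr (3/4) * \<tau> powr (-3/4))"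
      using \<tau> E by (intro mult_left_mono powr_mono2') auto
    finally show ?thesis by (simp add: \<tau>_def sol_def[abs_def] s_def[symmetric] mult.assoc)
  qed
  define F where "F = max (2 * C * K powr (3/4)) (E * tstar powr (3/4))"
  have "Ck_norm 1 (\<lambda>x. sol t x - cos x / (tstar - t)) \<le> F * (tstar - t) powr (-3/4)" if t: "t \<in> {0..<tstar}" for t
  proof (cases "t \<le> t0")
    case True
    have "E * tstar powr (3/4) * (tstar - t) powr (-3/4) \<le> F * (tstar - t) powr (-3/4)"
      by (intro mult_right_mono) (auto simp: F_def)
    with early[of t] True t show ?thesis by (meson atLeastLessThan_iff order_trans)
  next
    case False
    have "2 * C * K powr (3/4) * (tstar - t) powr (-3/4) \<le> F * (tstar - t) powr (-3/4)"
      by (intro mult_right_mono) (auto simp: F_def)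
    with late[of t] False t show ?thesis by (meson atLeastLessThan_iff linorder_le_cases order_trans)
  qed
  then show ?thesis by blast
qed

lemma bdd_sol: "t \<in> {0..<tstar} \<Longrightarrow> bdd_above ((\<lambda>x. \<bar>sol t x\<bar>) ` Ipi)"
proof -
  assume "t \<in> {0..<tstar}"
  then have "continuous_on Ipi (W 0 (\<sigma> t))" using sigma[OF T_image] W_cont_x by blast
  then show ?thesis using bdd_Dx[of 0 "sol t"] by (simp add: sol_def[abs_def])
qed

text \<open>At \<open>x = 0\<close>, where the cosine is 1, the main term beats the remainder by
  \<open>rescale_limit\<close>.\<close>

lemma sol_blowup: "filterlim (\<lambda>t. Sup ((\<lambda>x. \<bar>sol t x\<bar>) ` Ipi)) at_top (at_left tstar)"
proof -
  obtain C where C: "\<And>t. t \<in> {0..<tstar} \<Longrightarrow> Ck_norm 1 (\<lambda>x. sol t x - cos x / (tstar - t)) \<le> C * (tstar - t) powr (-3/4)"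
    using sol_rate by blast
  have le: "1 / (tstar - t) - C * (tstar - t) powr (-3/4) \<le> Sup ((\<lambda>x. \<bar>sol t x\<bar>) ` Ipi)" if t: "t \<in> {0..<tstar}" for t
  proof -
    have s: "\<sigma> t \<in> S" using sigma[OF T_image t] by simp
    define g where "g = (\<lambda>x. W 0 (\<sigma> t) x - cos x / (tstar - t))"
    have c: "continuous_on Ipi (Dx j g)" if "j \<le> 1" for j
    proof (cases "j = 0")
      case True
      have "continuous_on Ipi g" unfolding g_def
        by (intro continuous_intros W_cont_x s) (use t in auto)
      then show ?thesis using True by simp
    next
      case False
      have "continuous_on Ipi (\<lambda>x. W 1 (\<sigma> t) x + sin x / (tstar - t))"
        by (intro continuous_intros W_cont_x s) (use t in auto)
      then have "continuous_on Ipi (Dx 1 g)"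
        by (rule continuous_on_eq) (use Dx_remainder[OF s] in \<open>auto simp: g_def\<close>)
      moreover have "j = 1" using False that by simp
      ultimately show ?thesis by simp
    qed
    have "\<bar>Dx 0 g 0\<bar> \<le> Ck_norm 1 g" by (rule abs_Dx_le_Ck_norm[OF c]) auto
    moreover have "Ck_norm 1 g \<le> C * (tstar - t) powr (-3/4)" using C[OF t] by (simp add: g_def sol_def)
    ultimately have "\<bar>sol t 0 - 1 / (tstar - t)\<bar> \<le> C * (tstar - t) powr (-3/4)" by (simp add: g_def sol_def)
    moreover have "\<bar>sol t 0\<bar> \<le> Sup ((\<lambda>x. \<bar>sol t x\<bar>) ` Ipi)" by (rule cSUP_upper[OF _ bdd_sol[OF t]]) auto
    ultimately show ?thesis by linarith
  qed
  have "\<forall>\<^sub>F t in at_left tstar. t \<in> {0..<tstar}"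
    using eventually_at_left_field tstar_pos by (metis atLeastLessThan_iff order_less_imp_le)
  then have "\<forall>\<^sub>F t in at_left tstar. 1 / (tstar - t) - C * (tstar - t) powr (-3/4) \<le> Sup ((\<lambda>x. \<bar>sol t x\<bar>) ` Ipi)"
    by eventually_elim (rule le)
  with rescale_limit show ?thesis by (rule filterlim_at_top_mono)
qed

text \<open>A solution living past \<open>tstar\<close> would be bounded on the compact set
  \<open>{0..tstar} \<times> Ipi\<close>, yet by uniqueness it agrees with \<open>sol\<close> before
  \<open>tstar\<close>.\<close>

lemma sol_maximal:
  assumes sol': "is_sol T' u b'"
  shows "T' \<le> tstar" "\<forall>t\<in>{0..<T'}. \<forall>x\<in>Ipi. b' t x = sol t x"
proof -
  have issol: "is_sol tstar u sol" by (rule is_sol_sol[OF T_image])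
  show le: "T' \<le> tstar"
  proof (rule ccontr)
    assume "\<not> T' \<le> tstar"
    then have gt: "tstar < T'" by simp
    have "continuous_on ({0..<T'} \<times> Ipi) (\<lambda>p. Dx 0 (b' (fst p)) (snd p))"
      using sol' unfolding is_sol_def by blast
    moreover have "{0..tstar} \<times> Ipi \<subseteq> {0..<T'} \<times> Ipi" using gt by auto
    ultimately have c: "continuous_on ({0..tstar} \<times> Ipi) (\<lambda>p. b' (fst p) (snd p))"
      using continuous_on_subset by (simp, blast)
    obtain K where K: "K > 0" "\<And>p. p \<in> {0..tstar} \<times> Ipi \<Longrightarrow> \<bar>b' (fst p) (snd p)\<bar> \<le> K"
      using continuous_compact_abs_bound[OF compact_Times[of "{0..tstar}" Ipi] c] by auto
    have sup: "Sup ((\<lambda>x. \<bar>sol t x\<bar>) ` Ipi) \<le> K" if t: "t \<in> {0..<tstar}" for t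
    proof (rule cSUP_least)
      fix x assume x: "x \<in> Ipi"
      have "sol t x = b' t x" using is_sol_unique[OF issol sol' _ _ _ x] t gt by auto
      then show "\<bar>sol t x\<bar> \<le> K" using K(2)[of "(t, x)"] t x by auto
    qed auto
    have "\<forall>\<^sub>F t in at_left tstar. t \<in> {0..<tstar}"
      using eventually_at_left_field tstar_pos by (metis atLeastLessThan_iff order_less_imp_le)
    moreover have "\<forall>\<^sub>F t in at_left tstar. K + 1 \<le> Sup ((\<lambda>x. \<bar>sol t x\<bar>) ` Ipi)"
      using sol_blowup by (simp add: filterlim_at_top)
    ultimately have "\<forall>\<^sub>F t in at_left tstar. False"
      by eventually_elim (use sup in force)
    then show False by simp
  qed
  show "\<forall>t\<in>{0..<T'}. \<forall>x\<in>Ipi. b' t x = sol t x"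
    using is_sol_unique[OF sol' issol] le by auto
qed

end

section \<open>Data close to the cosine\<close>

text \<open>Why 1/8 works: split at |x| = pi/3, where the cosine is 1/2. Outside, b0 is at most 5/8
  \<mu>, below the maximum, which is at least 7/8 \<mu>. Inside, the second derivative is at most
  -3/8 \<mu>. So the maximum lies inside and is nondegenerate.\<close>

lemma peak_from_closeness:
  fixes b0 :: "real \<Rightarrow> real"
  assumes \<mu>: "\<mu> > 0" and b0: "Ck_on 3 b0" and mean: "integral Ipi b0 = 0"
    and close: "Ck_norm 3 (\<lambda>x. b0 x - \<mu> * cos x) \<le> 1/8 * \<mu>"
  shows "\<exists>M \<alpha> r \<rho> C0. ipm_peak b0 (Dx 1 b0) (Dx 2 b0) (Dx 3 b0) M \<alpha> r \<rho> C0"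
proof -
  have d0: "(b0 has_real_derivative Dx 1 b0 x) (at x within Ipi)" if "x \<in> Ipi" for x
    using Ck_onD[OF b0, of 0 x] that by simp
  have d1: "(Dx 1 b0 has_real_derivative Dx 2 b0 x) (at x within Ipi)" if "x \<in> Ipi" for x
    using Ck_onD[OF b0, of 1 x] that by (simp add: numeral_2_eq_2)
  have d2: "(Dx 2 b0 has_real_derivative Dx 3 b0 x) (at x within Ipi)" if "x \<in> Ipi" for x
    using Ck_onD[OF b0, of 2 x] that by (simp add: numeral_3_eq_3 numeral_2_eq_2)
  have cont: "continuous_on Ipi (Dx j b0)" if "j \<le> 3" for j by (rule Ck_on_continuous[OF b0 that])
  define v where "v j x = (if j = 0 then b0 x - \<mu> * cos x else if j = 1 then Dx 1 b0 x + \<mu> * sin x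
     else if j = 2 then Dx 2 b0 x + \<mu> * cos x else Dx 3 b0 x - \<mu> * sin x)" for j :: nat and x
  have vd: "(v j has_real_derivative v (Suc j) x) (at x within Ipi)" if j: "j < 3" and x: "x \<in> Ipi" for j x
  proof -
    have cs: "((\<lambda>x. \<mu> * cos x) has_real_derivative \<mu> * (- sin x)) (at x within Ipi)"
      "((\<lambda>x. \<mu> * sin x) has_real_derivative \<mu> * cos x) (at x within Ipi)"
      by (intro DERIV_cmult DERIV_subset[OF DERIV_cos] DERIV_subset[OF DERIV_sin]; simp)+
    consider "j = 0" | "j = 1" | "j = 2" using j by linarith
    then show ?thesis
    proof cases
      case 1
      then show ?thesis using DERIV_diff[OF d0[OF x] cs(1)] by (simp add: v_def[abs_def])
    next
      case 2
      then show ?thesis using DERIV_add[OF d1[OF x] cs(2)] by (simp add: v_def[abs_def] numeral_2_eq_2)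
    next
      case 3
      then show ?thesis using DERIV_add[OF d2[OF x] cs(1)] by (simp add: v_def[abs_def])
    qed
  qed
  have vc: "continuous_on Ipi (v j)" for j
    unfolding v_def[abs_def] using cont[of 0] cont[of 1] cont[of 2] cont[of 3]
    by (cases "j = 0"; cases "j = 1"; cases "j = 2") (auto intro!: continuous_intros)
  define w where "w = (\<lambda>x. b0 x - \<mu> * cos x)"
  have Dv: "Dx j w x = v j x" if "j \<le> 3" "x \<in> Ipi" for j x
    using Dx_eq[of w v 3 j x] vd that by (auto simp: v_def w_def)
  have vbound: "\<bar>v j x\<bar> \<le> \<mu> / 8" if j: "j \<le> 3" and x: "x \<in> Ipi" for j x
  proof -
    have "continuous_on Ipi (Dx i w)" if "i \<le> 3" for i
      by (rule continuous_on_eq[OF vc[of i]]) (use Dv that in auto)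
    from abs_Dx_le_Ck_norm[OF this j x] show ?thesis using Dv[OF j x] close by (simp add: w_def)
  qed
  have b0c: "\<bar>b0 x - \<mu> * cos x\<bar> \<le> \<mu> / 8" if "x \<in> Ipi" for x using vbound[of 0 x] that by (simp add: v_def)
  have b2c: "\<bar>Dx 2 b0 x + \<mu> * cos x\<bar> \<le> \<mu> / 8" if "x \<in> Ipi" for x using vbound[of 2 x] that by (simp add: v_def)
  have "\<exists>\<alpha>\<in>Ipi. \<forall>x\<in>Ipi. b0 x \<le> b0 \<alpha>"
    by (rule continuous_attains_sup) (use cont[of 0] in auto)
  then obtain \<alpha> where \<alpha>: "\<alpha> \<in> Ipi" and max: "\<And>x. x \<in> Ipi \<Longrightarrow> b0 x \<le> b0 \<alpha>" by blast
  define M where "M = b0 \<alpha>"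
  have M: "M \<ge> 7/8 * \<mu>"
  proof -
    have "\<bar>b0 0 - \<mu>\<bar> \<le> \<mu> / 8" "b0 0 \<le> M" using b0c[of 0] max[of 0] by (simp_all add: M_def)
    then show ?thesis by linarith
  qed
  have far: "b0 x \<le> 5/8 * \<mu>" if x: "x \<in> Ipi" and "pi / 3 \<le> \<bar>x\<bar>" for x
  proof -
    have "cos \<bar>x\<bar> \<le> cos (pi / 3)" using that by (intro cos_monotone_0_pi_le) auto
    then have "cos x \<le> 1 / 2" by (simp add: cos_60)
    then have "\<mu> * cos x \<le> \<mu> * (1 / 2)" using \<mu> by (intro mult_left_mono) auto
    then show ?thesis using b0c[OF x] by linarith
  qed
  have near: "Dx 2 b0 x \<le> - (3/8) * \<mu>" if "\<bar>x\<bar> \<le> pi / 3" for x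
  proof -
    have "cos (pi / 3) \<le> cos \<bar>x\<bar>" using that pi_gt_zero by (intro cos_monotone_0_pi_le) auto
    then have "1 / 2 \<le> cos x" by (simp add: cos_60)
    then have "\<mu> * (1 / 2) \<le> \<mu> * cos x" using \<mu> by (intro mult_left_mono) auto
    moreover have "x \<in> Ipi" using that by auto
    ultimately show ?thesis using b2c[of x] by argo
  qed
  have \<alpha>3: "\<bar>\<alpha>\<bar> < pi / 3" using far[OF \<alpha>] M \<mu> by (force simp: M_def)
  have \<alpha>i: "-pi < \<alpha>" "\<alpha> < pi" using \<alpha>3 by (auto simp: abs_less_iff)
  \<comment> \<open>Away from the ends one-sided derivatives are ordinary ones, as Fermat's
    criterion and Taylor's theorem require.\<close>
  have at_eq: "at x within Ipi = at x" if "\<bar>x\<bar> \<le> pi / 3" for x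
    by (rule at_within_Icc_at) (use that pi_gt_zero in linarith)+
  have crit: "Dx 1 b0 \<alpha> = 0"
  proof (rule DERIV_local_max)
    show "(b0 has_real_derivative Dx 1 b0 \<alpha>) (at \<alpha>)" using d0[OF \<alpha>] at_eq \<alpha>3 by simp
    show "0 < pi / 3" by simp
    show "\<forall>y. \<bar>\<alpha> - y\<bar> < pi / 3 \<longrightarrow> b0 y \<le> b0 \<alpha>"
    proof (intro allI impI)
      fix y assume "\<bar>\<alpha> - y\<bar> < pi / 3"
      then have "- pi \<le> y" "y \<le> pi" using \<alpha>3 by linarith+
      then have "y \<in> Ipi" by simp
      then show "b0 y \<le> b0 \<alpha>" by (rule max)
    qed
  qed
  define r where "r = sqrt (- Dx 2 b0 \<alpha> / 2)"
  have r2: "r\<^sup>2 = - Dx 2 b0 \<alpha> / 2" and r: "r > 0" using near[of \<alpha>] \<alpha>3 \<mu> by (auto simp: r_def)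
  \<comment> \<open>Chosen so that \<open>\<rho>\<^sup>2 * (2 * pi)\<^sup>2\<close> is \<mu>/4, the
    gap between 7/8 \<mu> and 5/8 \<mu>. It is then also below 3/16 \<mu>, the quadratic coefficient
    available near the maximum.\<close>
  define \<rho> where "\<rho> = sqrt (\<mu> / (16 * pi\<^sup>2))"
  have \<rho>2: "\<rho>\<^sup>2 = \<mu> / (16 * pi\<^sup>2)" and \<rho>: "\<rho> > 0" using \<mu> by (auto simp: \<rho>_def)
  obtain K where K: "K > 0" "\<And>x. x \<in> Ipi \<Longrightarrow> \<bar>Dx 3 b0 x\<bar> \<le> K"
    using continuous_compact_abs_bound[OF _ cont[of 3]] by auto
  \<comment> \<open>Three uses of the mean value theorem climb from the bound on the third
    derivative to the cubic remainder. As each intermediate point stays within |x - \<alpha>| of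
    \<alpha>, one constant \<open>K\<close> serves all of them.\<close>
  have t2: "\<bar>Dx 2 b0 x - Dx 2 b0 \<alpha>\<bar> \<le> K * \<bar>x - \<alpha>\<bar>" if x: "x \<in> Ipi" for x
  proof -
    obtain z where "z \<in> Ipi" "Dx 2 b0 x - Dx 2 b0 \<alpha> = Dx 3 b0 z * (x - \<alpha>)"
      using real_mvt_segment[OF _ \<alpha> x d2] by auto
    then show ?thesis using mult_right_mono[OF K(2)[of z], of "\<bar>x - \<alpha>\<bar>"] by (simp add: abs_mult)
  qed
  have t1: "\<bar>Dx 1 b0 x + 2 * r\<^sup>2 * (x - \<alpha>)\<bar> \<le> K * (x - \<alpha>)\<^sup>2" if x: "x \<in> Ipi" for x
  proof -
    obtain z where z: "z \<in> Ipi" "\<bar>z - \<alpha>\<bar> \<le> \<bar>x - \<alpha>\<bar>" "Dx 1 b0 x - Dx 1 b0 \<alpha> = Dx 2 b0 z * (x - \<alpha>)"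
      using real_mvt_segment[OF _ \<alpha> x d1] by auto
    have "Dx 1 b0 x + 2 * r\<^sup>2 * (x - \<alpha>) = (Dx 2 b0 z - Dx 2 b0 \<alpha>) * (x - \<alpha>)"
      using z(3) crit by (simp add: r2 algebra_simps)
    then have "\<bar>Dx 1 b0 x + 2 * r\<^sup>2 * (x - \<alpha>)\<bar> = \<bar>Dx 2 b0 z - Dx 2 b0 \<alpha>\<bar> * \<bar>x - \<alpha>\<bar>" by (simp add: abs_mult)
    also have "\<dots> \<le> (K * \<bar>x - \<alpha>\<bar>) * \<bar>x - \<alpha>\<bar>"
      using order_trans[OF t2[OF z(1)] mult_left_mono[OF z(2), of K]] K(1) by (intro mult_right_mono) auto
    finally show ?thesis by (simp add: power2_eq_square)
  qed
  have t0: "\<bar>M - b0 x - r\<^sup>2 * (x - \<alpha>)\<^sup>2\<bar> \<le> K * \<bar>x - \<alpha>\<bar> ^ 3" if x: "x \<in> Ipi" for x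
  proof -
    have d: "((\<lambda>x. b0 x + r\<^sup>2 * (x - \<alpha>)\<^sup>2) has_real_derivative Dx 1 b0 x + 2 * r\<^sup>2 * (x - \<alpha>)) (at x within Ipi)"
      if "x \<in> Ipi" for x by (auto intro!: derivative_eq_intros d0[OF that])
    obtain z where z: "z \<in> Ipi" "\<bar>z - \<alpha>\<bar> \<le> \<bar>x - \<alpha>\<bar>"
      "(b0 x + r\<^sup>2 * (x - \<alpha>)\<^sup>2) - (b0 \<alpha> + r\<^sup>2 * (\<alpha> - \<alpha>)\<^sup>2) = (Dx 1 b0 z + 2 * r\<^sup>2 * (z - \<alpha>)) * (x - \<alpha>)"
      using real_mvt_segment[OF convex_real_interval(5) \<alpha> x d] by blast
    have "\<bar>M - b0 x - r\<^sup>2 * (x - \<alpha>)\<^sup>2\<bar> = \<bar>(Dx 1 b0 z + 2 * r\<^sup>2 * (z - \<alpha>)) * (x - \<alpha>)\<bar>"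
      using z(3) by (simp add: M_def abs_minus_commute algebra_simps)
    also have "\<dots> \<le> (K * \<bar>x - \<alpha>\<bar>\<^sup>2) * \<bar>x - \<alpha>\<bar>"
      unfolding abs_mult
    proof (rule mult_right_mono)
      have "(z - \<alpha>)\<^sup>2 \<le> \<bar>x - \<alpha>\<bar>\<^sup>2" using power_mono[OF z(2), of 2] by simp
      then show "\<bar>Dx 1 b0 z + 2 * r\<^sup>2 * (z - \<alpha>)\<bar> \<le> K * \<bar>x - \<alpha>\<bar>\<^sup>2"
        using t1[OF z(1)] K(1) by (smt (verit) mult_left_mono)
    qed simp
    finally show ?thesis by (simp add: eval_nat_numeral mult.assoc)
  qed
  have low: "\<rho>\<^sup>2 * (x - \<alpha>)\<^sup>2 \<le> M - b0 x" if x: "x \<in> Ipi" for x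
  proof (cases "\<bar>x\<bar> \<le> pi / 3")
    case False
    have "\<bar>x - \<alpha>\<bar> \<le> 2 * pi" using x \<alpha> by auto
    then have "(x - \<alpha>)\<^sup>2 \<le> (2 * pi)\<^sup>2" using power_mono[of "\<bar>x - \<alpha>\<bar>" "2 * pi" 2] by simp
    then have "\<rho>\<^sup>2 * (x - \<alpha>)\<^sup>2 \<le> \<rho>\<^sup>2 * (2 * pi)\<^sup>2" by (intro mult_left_mono) auto
    also have "\<dots> = \<mu> / 4" by (simp add: \<rho>2 power_mult_distrib)
    also have "\<dots> \<le> M - b0 x" using far[OF x] M False by simp
    finally show ?thesis .
  next
    case True
    show ?thesis
    proof (cases "x = \<alpha>")
      case False
      \<comment> \<open>The cubic remainder would be too weak at a fixed distance from \<alpha>; the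
        second-order Lagrange form uses concavity on the whole central interval.\<close>
      have "\<exists>t. (if x < \<alpha> then x < t \<and> t < \<alpha> else \<alpha> < t \<and> t < x) \<and>
        b0 x = (\<Sum>m<2. Dx m b0 \<alpha> / fact m * (x - \<alpha>) ^ m) + Dx 2 b0 t / fact 2 * (x - \<alpha>) ^ 2"
      proof (rule Taylor[where a = "- (pi / 3)" and b = "pi / 3"])
        show "\<forall>m t. m < 2 \<and> - (pi / 3) \<le> t \<and> t \<le> pi / 3 \<longrightarrow> DERIV (Dx m b0) t :> Dx (Suc m) b0 t"
        proof (intro allI impI)
          fix m :: nat and t assume mt: "m < 2 \<and> - (pi / 3) \<le> t \<and> t \<le> pi / 3"
          then have t: "t \<in> Ipi" "\<bar>t\<bar> \<le> pi / 3" using pi_gt_zero unfolding atLeastAtMost_iff by linarith+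
          have "m < 3" using mt by simp
          from Ck_onD[OF b0 this t(1)] show "DERIV (Dx m b0) t :> Dx (Suc m) b0 t"
            unfolding at_eq[OF t(2)] .
        qed
      qed (use True False \<alpha>3 in auto)
      then obtain t where t: "if x < \<alpha> then x < t \<and> t < \<alpha> else \<alpha> < t \<and> t < x"
        "b0 x = (\<Sum>m<2. Dx m b0 \<alpha> / fact m * (x - \<alpha>) ^ m) + Dx 2 b0 t / fact 2 * (x - \<alpha>) ^ 2" by blast
      have "(\<Sum>m<2. Dx m b0 \<alpha> / fact m * (x - \<alpha>) ^ m) = Dx 0 b0 \<alpha> + Dx 1 b0 \<alpha> * (x - \<alpha>)"
        by (simp add: numeral_2_eq_2)
      then have eq: "M - b0 x = - Dx 2 b0 t / 2 * (x - \<alpha>)\<^sup>2" using t(2) crit by (simp add: M_def)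
      have "\<bar>t\<bar> \<le> pi / 3" using t(1) True \<alpha>3 by (auto simp: abs_le_iff abs_less_iff split: if_splits)
      then have t2: "3 / 16 * \<mu> \<le> - Dx 2 b0 t / 2" using near[of t] by simp
      have "\<mu> / (16 * pi\<^sup>2) \<le> \<mu> / 16" 
        using \<mu> pi_gt3 by (intro divide_left_mono) (auto simp: one_le_power)
      then have "\<rho>\<^sup>2 \<le> - Dx 2 b0 t / 2" using t2 \<mu> by (simp add: \<rho>2)
      then show ?thesis unfolding eq by (intro mult_right_mono) auto
    qed (simp add: M_def)
  qed
  have "ipm_peak b0 (Dx 1 b0) (Dx 2 b0) (Dx 3 b0) M \<alpha> r \<rho> K"
  proof unfold_locales
    show "\<bar>- Dx 1 b0 x - 2 * r\<^sup>2 * (x - \<alpha>)\<bar> \<le> K * (x - \<alpha>)\<^sup>2" if "x \<in> Ipi" for x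
      using t1[OF that] by (simp add: abs_le_iff)
    show "M > 0" using M \<mu> by simp
  qed (use d0 d1 d2 cont mean max \<alpha>i r \<rho> K low t0 in \<open>auto simp: M_def\<close>)
  then show ?thesis by blast
qed

theorem theorem1p1:
  shows "\<exists>\<delta>>0. \<forall>\<mu>>0. \<forall>b0.
     Ck_on 3 b0 \<and> integral Ipi b0 = 0
     \<and> Ck_norm 3 (\<lambda>x. b0 x - \<mu> * cos x) \<le> \<delta> * \<mu>
     \<longrightarrow> (\<exists>tstar>0. \<exists>b. is_sol tstar b0 b
           \<and> (\<forall>T b'. is_sol T b0 b' \<longrightarrow>
                 T \<le> tstar \<and> (\<forall>tau\<in>{0..<T}. \<forall>x\<in>Ipi. b' tau x = b tau x))
           \<and> filterlim (\<lambda>tau. Sup ((\<lambda>x. \<bar>b tau x\<bar>) ` Ipi)) at_top (at_left tstar)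
           \<and> (\<exists>C. \<forall>tau\<in>{0..<tstar}.
                 Ck_norm 1 (\<lambda>x. b tau x - cos x / (tstar - tau))
                   \<le> C * (tstar - tau) powr (-3/4)))"
proof (rule exI[of _ "1/8"], intro conjI allI impI)
  fix \<mu> :: real and b0 :: "real \<Rightarrow> real"
  assume \<mu>: "\<mu> > 0" and h: "Ck_on 3 b0 \<and> integral Ipi b0 = 0 \<and> Ck_norm 3 (\<lambda>x. b0 x - \<mu> * cos x) \<le> 1/8 * \<mu>"
  then obtain M \<alpha> r \<rho> C0 where "ipm_peak b0 (Dx 1 b0) (Dx 2 b0) (Dx 3 b0) M \<alpha> r \<rho> C0"
    using peak_from_closeness[OF \<mu>] by blast
  then interpret ipm_peak b0 "Dx 1 b0" "Dx 2 b0" "Dx 3 b0" M \<alpha> r \<rho> C0 .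
  show "\<exists>tstar>0. \<exists>b. is_sol tstar b0 b
           \<and> (\<forall>T b'. is_sol T b0 b' \<longrightarrow>
                 T \<le> tstar \<and> (\<forall>tau\<in>{0..<T}. \<forall>x\<in>Ipi. b' tau x = b tau x))
           \<and> filterlim (\<lambda>tau. Sup ((\<lambda>x. \<bar>b tau x\<bar>) ` Ipi)) at_top (at_left tstar)
           \<and> (\<exists>C. \<forall>tau\<in>{0..<tstar}.
                 Ck_norm 1 (\<lambda>x. b tau x - cos x / (tstar - tau))
                   \<le> C * (tstar - tau) powr (-3/4))"
    using tstar_pos is_sol_sol[OF T_image] sol_maximal sol_blowup sol_rate by blast
qed simp

end
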